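(* Let $X=(\Omega,\mathcal{F},\mu)$ be a probability space, let $n$ be a positive integer, and let $f:X^n\to\{0,1\}$ be a measurable function. For every $\epsilon>0$, there exists an $e^{10^{15}\epsilon^{-3}\lceil I_f\rceil^3}$-pseudo-junta $h:X^n\to\{0,1\}$ such that $\|f-h\|_1\le\epsilon$.
   Context: $X^n$ is the product space with product probability measure $\mu^n$; integrals and norms on $X^n$ are with respect to $\mu^n$. Write $[n]=\{1,\dots,n\}$, $\mathcal{P}([n])$ for the set of subsets of $[n]$, and $x_S=(x_i)_{i\in S}\in X^S$ for $x\in X^n$, $S\subseteq[n]$. Functions on $X^S$ are identified with functions on $X^n$ via $g(x):=g(x_S)$. Influence: for measurable $f:X^n\to\{0,1\}$ and $j\in[n]$, $I_f(j)=\Pr[f(x_1,\dots,x_n)\ne f(x_1,\dots,x_{j-1},y_j,x_{j+1},\dots,x_n)]$, where $x_1,\dots,x_n,y_1,\dots,y_n$ are i.i.d. with law $\mu$. The total influence is $I_f=\sum_{j=1}^n I_f(j)$. Pseudo-juntas: let $\mathcal{J}=\{J_S\}_{S\subseteq[n]}$ be a collection of measurable functions $J_S:X^S\to\{0,1\}$. Define $J_{\mathcal{J}}:X^n\to\mathcal{P}([n])$ by $J_{\mathcal{J}}(x)=\bigcup_{S\subseteq[n]:\,J_S(x_S)=1}S$. Let $\mathcal{F}_{\mathcal{J}}$ be the sub-$\sigma$-algebra on $X^n$ induced by the map $x\mapsto(J_{\mathcal{J}}(x),x_{J_{\mathcal{J}}(x)})$ (with values in the disjoint union $\bigsqcup_{A\subseteq[n]}\{A\}\times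 X^A$), i.e. the coarsest $\sigma$-algebra on $X^n$ making this map measurable. For a constant $k>0$, a $k$-pseudo-junta is a function $h:X^n\to\{0,1\}$ that is measurable with respect to $\mathcal{F}_{\mathcal{J}}$ for some such $\mathcal{J}$ satisfying $\int|J_{\mathcal{J}}(x)|\,dx\le k$, where $|\cdot|$ denotes cardinality. *)

theory Defs
  imports "HOL-Probability.Probability"
begin

text \<open>
  The power \<open>X\<^sup>S\<close> of a probability space \<open>M\<close>; the space \<open>X\<^sup>n\<close> is \<open>power_space M {1..n}\<close>.
  Its points are extensional functions, so the projection of \<open>x\<close> to \<open>X\<^sup>S\<close> is \<open>restrict x S\<close>.
  Functions with values in \<open>{0,1}\<close> are real valued functions taking only these values on the space.
\<close>

abbreviation power_space :: "'a measure \<Rightarrow> nat set \<Rightarrow> (nat \<Rightarrow> 'a) measure" where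
  "power_space M S \<equiv> PiM S (\<lambda>_. M)"

definition zero_one_measurable :: "'b measure \<Rightarrow> ('b \<Rightarrow> real) \<Rightarrow> bool" where
  "zero_one_measurable N g \<longleftrightarrow> g \<in> borel_measurable N \<and> g \<in> space N \<rightarrow> {0, 1}"

text \<open>The pair \<open>(x, y)\<close> below is distributed as \<open>2 n\<close> independent points with law \<open>M\<close>.\<close>

definition influence :: "'a measure \<Rightarrow> nat \<Rightarrow> ((nat \<Rightarrow> 'a) \<Rightarrow> real) \<Rightarrow> nat \<Rightarrow> real" where
  "influence M n f j =
     (let P = power_space M {1..n} \<Otimes>\<^sub>M power_space M {1..n}
      in measure P {(x, y) \<in> space P. f x \<noteq> f (x(j := y j))})"

definition total_influence :: "'a measure \<Rightarrow> nat \<Rightarrow> ((nat \<Rightarrow> 'a) \<Rightarrow> real) \<Rightarrow> real" where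
  "total_influence M n f = (\<Sum>j=1..n. influence M n f j)"

definition junta_set :: "nat \<Rightarrow> (nat set \<Rightarrow> (nat \<Rightarrow> 'a) \<Rightarrow> real) \<Rightarrow> (nat \<Rightarrow> 'a) \<Rightarrow> nat set" where
  "junta_set n J x = \<Union>{S. S \<subseteq> {1..n} \<and> J S (restrict x S) = 1}"

text \<open>
  The disjoint union of the spaces \<open>{A} \<times> X\<^sup>A\<close> over \<open>A \<subseteq> {1..n}\<close>. Only its \<open>\<sigma>\<close>-algebra is used;
  \<open>sigma\<close> equips it with the zero measure.
\<close>

definition subcube_union :: "'a measure \<Rightarrow> nat \<Rightarrow> (nat set \<times> (nat \<Rightarrow> 'a)) measure" where
  "subcube_union M n =
     sigma (SIGMA A:Pow {1..n}. space (power_space M A))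
           {{A} \<times> B | A B. A \<subseteq> {1..n} \<and> B \<in> sets (power_space M A)}"

definition junta_algebra ::
  "'a measure \<Rightarrow> nat \<Rightarrow> (nat set \<Rightarrow> (nat \<Rightarrow> 'a) \<Rightarrow> real) \<Rightarrow> (nat \<Rightarrow> 'a) measure" where
  "junta_algebra M n J =
     vimage_algebra (space (power_space M {1..n}))
       (\<lambda>x. (junta_set n J x, restrict x (junta_set n J x)))
       (subcube_union M n)"

text \<open>
  The integrand below is measurable with values in \<open>[0, n]\<close>, hence integrable, so the Bochner
  integral does not collapse to its default value.
\<close>

definition pseudo_junta :: "'a measure \<Rightarrow> nat \<Rightarrow> real \<Rightarrow> ((nat \<Rightarrow> 'a) \<Rightarrow> real) \<Rightarrow> bool" where
  "pseudo_junta M n k h \<longleftrightarrow>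
     (\<exists>J. (\<forall>S. S \<subseteq> {1..n} \<longrightarrow> zero_one_measurable (power_space M S) (J S)) \<and>
          (\<integral>x. real (card (junta_set n J x)) \<partial>power_space M {1..n}) \<le> k \<and>
          zero_one_measurable (junta_algebra M n J) h)"

end

theory Submission
  imports Defs
begin

text \<open>
  Write \<open>f\<close> as the sum of its Efron--Stein components \<open>f_S\<close>; those with \<open>card S > m\<close> have small total
  norm because the influences of \<open>f\<close> add up to a multiple of the sum of \<open>card S * norm (f_S)^2\<close>.
  Call \<open>U\<close> active at \<open>x\<close> if the conditional energy of the components \<open>f_S\<close>, \<open>S \<supseteq> U\<close>, given \<open>x_U\<close>
  exceeds a threshold, and split \<open>f_S\<close> according to whether the active subsets of \<open>S\<close> cover \<open>S\<close>.

  For fixed \<open>i\<close>, the parts of the components on which \<open>i\<close> is not covered form, after recentring, a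
  function of low degree all of whose conditional energies are small. A hypercontractive inequality
  bounds its fourth moment, and since its correlation with the \<open>i\<close>-th difference of \<open>f\<close> is its
  energy, that energy is a small multiple of the \<open>i\<close>-th influence.

  As \<open>f\<close> is bounded, the conditional expected number of active sets containing a given set is
  bounded, hence so is the expected number of covered sets, and the covered parts have bounded total
  \<open>L1\<close> norm. From the largest sets downwards, one keeps the large values of such a family of
  components; the recentred small values are orthogonal with small norm, and the recentring errors
  live on smaller sets. The sets carrying a kept value define the pseudo-junta.
\<close>

subsection \<open>Averaging over coordinates\<close>

text \<open>On an arbitrary probability space no moment comparison holds with a constant depending
  only on the degree: a centred function of one coordinate, concentrated on a small atom, violates
  it. The substitute controls a fourth moment by conditional energies given \<open>x_U\<close>,
  which is why activity is defined through them. It also makes activity of \<open>U\<close> depend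
  on \<open>x_U\<close> alone, so a cut-off component on \<open>S\<close> is still a function of
  \<open>x_S\<close>. A cutoff destroys vanishing means, hence the recentring by
  \<open>proj\<close>. Recentring in turn spreads averages to subsets of \<open>S\<close>, and these
  need not vanish off the covered event. So a bounded expected number of covered sets does not yet
  give a pseudo-junta; truncation recovers a bound on supports from the total L1 norm by Markov's
  inequality. With \<open>K\<close> the rounded-up total influence and
  \<open>N = K / \<epsilon>\<close>, the degree \<open>m\<close> is about \<open>36 * N\<close> and
  the threshold \<open>\<tau>\<close> is exponentially small in \<open>m\<close>. Unions of up to
  \<open>m\<close> active sets cost about the \<open>m\<close>-th power of
  \<open>1 / \<tau>\<close>, and truncation over \<open>m\<close> levels costs
  \<open>2 ^ (m * (m + 3))\<close>; both are exponential in the square of \<open>m\<close>.\<close>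

lemma sum_Pow_insert:
  fixes f :: "'b set \<Rightarrow> 'c :: comm_monoid_add"
  assumes "finite A" "j \<notin> A"
  shows "(\<Sum>T\<in>Pow (insert j A). f T) = (\<Sum>T\<in>Pow A. f T + f (insert j T))"
proof -
  have "inj_on (insert j) (Pow A)" using assms(2) by (auto simp: inj_on_def)
  moreover have "Pow A \<inter> insert j ` Pow A = {}" using assms(2) by auto
  ultimately show ?thesis using assms(1)
    by (simp add: Pow_insert sum.union_disjoint sum.reindex sum.distrib)
qed

locale finite_power = prob_space M for M :: "'a measure" +
  fixes I :: "nat set"
  assumes finite_I [simp]: "finite I"
begin

abbreviation P :: "(nat \<Rightarrow> 'a) measure" where "P \<equiv> power_space M I"

sublocale P: prob_space P
  by (rule prob_space_PiM) (simp add: prob_space_axioms)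

sublocale PP: pair_prob_space P P ..

lemma override_on_space:
  "x \<in> space P \<Longrightarrow> y \<in> space P \<Longrightarrow> override_on x y A \<in> space P"
  by (auto simp: space_PiM PiE_def Pi_def extensional_def override_on_def)

lemma measurable_override_on [measurable]:
  "(\<lambda>(x, y). override_on x y A) \<in> P \<Otimes>\<^sub>M P \<rightarrow>\<^sub>M P"
proof (rule measurable_PiM_single')
  show "(\<lambda>p. (case p of (x, y) \<Rightarrow> override_on x y A) i) \<in> P \<Otimes>\<^sub>M P \<rightarrow>\<^sub>M M" if "i \<in> I" for i
    using that by (cases "i \<in> A") (simp_all add: override_on_def split_beta)
next
  show "(\<lambda>p i. (case p of (x, y) \<Rightarrow> override_on x y A) i) \<in> space (P \<Otimes>\<^sub>M P) \<rightarrow> (\<Pi>\<^sub>E i\<in>I. space M)"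
    using override_on_space[of _ _ A] unfolding space_pair_measure space_PiM by clarify metis
qed

lemma measurable_override_on_right:
  "x \<in> space P \<Longrightarrow> (\<lambda>y. override_on x y A) \<in> P \<rightarrow>\<^sub>M P"
  using measurable_compose[OF measurable_Pair1' measurable_override_on, of x A] by simp

text \<open>Choosing each coordinate from one of two independent points leaves the coordinates
  independent with law \<open>M\<close>. Rectangles suffice, and their preimages are products of two
  rectangles.\<close>

lemma distr_override_on: "distr (P \<Otimes>\<^sub>M P) P (\<lambda>(x, y). override_on x y A) = P"
proof -
  interpret pm: product_sigma_finite "\<lambda>_::nat. M" by unfold_locales
  show ?thesis
  proof (rule pm.PiM_eqI)
    fix E assume E: "\<And>i. i \<in> I \<Longrightarrow> E i \<in> sets M"
    define F where "F = (\<lambda>i. if i \<in> A then space M else E i)"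
    define G where "G = (\<lambda>i. if i \<in> A then E i else space M)"
    have FG: "\<And>i. i \<in> I \<Longrightarrow> F i \<in> sets M" "\<And>i. i \<in> I \<Longrightarrow> G i \<in> sets M"
      using E by (auto simp: F_def G_def)
    have sub: "\<And>i. i \<in> I \<Longrightarrow> E i \<subseteq> space M" using E sets.sets_into_space by blast
    have "(\<lambda>(x, y). override_on x y A) -` (Pi\<^sub>E I E) \<inter> space (P \<Otimes>\<^sub>M P) = Pi\<^sub>E I F \<times> Pi\<^sub>E I G"
    proof (intro set_eqI iffI)
      fix p assume p: "p \<in> (\<lambda>(x, y). override_on x y A) -` (Pi\<^sub>E I E) \<inter> space (P \<Otimes>\<^sub>M P)"
      obtain x y where xy: "p = (x, y)" "x \<in> space P" "y \<in> space P" "override_on x y A \<in> Pi\<^sub>E I E"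
        using p by (auto simp: space_pair_measure)
      have "x i \<in> F i \<and> y i \<in> G i" if "i \<in> I" for i
        using that xy(2,3) PiE_mem[OF xy(4) that]
        by (cases "i \<in> A") (auto simp: F_def G_def space_PiM)
      thus "p \<in> Pi\<^sub>E I F \<times> Pi\<^sub>E I G" using xy(1-3) by (auto simp: space_PiM PiE_iff)
    next
      fix p assume "p \<in> Pi\<^sub>E I F \<times> Pi\<^sub>E I G"
      then obtain x y where xy: "p = (x, y)" "x \<in> Pi\<^sub>E I F" "y \<in> Pi\<^sub>E I G" by auto
      have *: "x i \<in> F i" "y i \<in> G i" if "i \<in> I" for i using xy that by auto
      have "F i \<subseteq> space M" "G i \<subseteq> space M" if "i \<in> I" for i using sub[OF that] by (auto simp: F_def G_def)
      hence sp: "x \<in> space P" "y \<in> space P" using xy by (auto simp: space_PiM PiE_iff subset_iff)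
      have "override_on x y A i \<in> E i" if "i \<in> I" for i
        using *[OF that] by (cases "i \<in> A") (auto simp: F_def G_def)
      hence "override_on x y A \<in> Pi\<^sub>E I E"
        using override_on_space[OF sp, of A] by (auto simp: space_PiM PiE_iff)
      thus "p \<in> (\<lambda>(x, y). override_on x y A) -` (Pi\<^sub>E I E) \<inter> space (P \<Otimes>\<^sub>M P)"
        using xy(1) sp by (auto simp: space_pair_measure)
    qed
    hence "emeasure (distr (P \<Otimes>\<^sub>M P) P (\<lambda>(x, y). override_on x y A)) (Pi\<^sub>E I E)
      = emeasure (P \<Otimes>\<^sub>M P) (Pi\<^sub>E I F \<times> Pi\<^sub>E I G)"
      using E by (subst emeasure_distr) (auto intro!: sets_PiM_I_finite)
    also have "\<dots> = emeasure P (Pi\<^sub>E I F) * emeasure P (Pi\<^sub>E I G)"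
      using FG by (intro P.emeasure_pair_measure_Times) (auto intro!: sets_PiM_I_finite)
    also have "\<dots> = (\<Prod>i\<in>I. emeasure M (F i)) * (\<Prod>i\<in>I. emeasure M (G i))"
      using FG by (simp add: pm.emeasure_PiM)
    also have "\<dots> = (\<Prod>i\<in>I. emeasure M (E i))"
      unfolding prod.distrib[symmetric] by (intro prod.cong) (auto simp: F_def G_def emeasure_space_1)
    finally show "emeasure (distr (P \<Otimes>\<^sub>M P) P (\<lambda>(x, y). override_on x y A)) (Pi\<^sub>E I E) = (\<Prod>i\<in>I. emeasure M (E i))" .
  qed auto
qed

text \<open>Vanishing outside the space lets operator identities such as
  \<open>avg {} \<phi> = \<phi>\<close> hold as equalities of functions, usable for rewriting under
  further operators.\<close>

definition bdd :: "((nat \<Rightarrow> 'a) \<Rightarrow> real) \<Rightarrow> bool" where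
  "bdd \<phi> \<longleftrightarrow> \<phi> \<in> borel_measurable P \<and> (\<exists>C. \<forall>x. \<bar>\<phi> x\<bar> \<le> C) \<and> (\<forall>x. x \<notin> space P \<longrightarrow> \<phi> x = 0)"

text \<open>This is conditional expectation given the coordinates outside \<open>A\<close>, made
  explicit by resampling \<open>A\<close>; being defined pointwise, it avoids almost-everywhere
  equalities.\<close>

definition avg :: "nat set \<Rightarrow> ((nat \<Rightarrow> 'a) \<Rightarrow> real) \<Rightarrow> (nat \<Rightarrow> 'a) \<Rightarrow> real" where
  "avg A \<phi> x = (if x \<in> space P then \<integral>y. \<phi> (override_on x y A) \<partial>P else 0)"

definition dep :: "nat set \<Rightarrow> ((nat \<Rightarrow> 'a) \<Rightarrow> real) \<Rightarrow> bool" where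
  "dep S \<phi> \<longleftrightarrow> (\<forall>x\<in>space P. \<forall>y\<in>space P. (\<forall>i\<in>S. x i = y i) \<longrightarrow> \<phi> x = \<phi> y)"

lemma bddD:
  assumes "bdd \<phi>"
  shows "\<phi> \<in> borel_measurable P" "x \<notin> space P \<Longrightarrow> \<phi> x = 0"
  using assms by (auto simp: bdd_def)

lemma bddE:
  assumes "bdd \<phi>"
  obtains C where "\<And>x. \<bar>\<phi> x\<bar> \<le> C" "C \<ge> 0"
proof -
  obtain C where C: "\<And>x. \<bar>\<phi> x\<bar> \<le> C" using assms by (auto simp: bdd_def)
  moreover have "C \<ge> 0" using C abs_ge_zero order_trans by blast
  ultimately show ?thesis using that by blast
qed

lemma bdd_zero [simp, intro!]: "bdd (\<lambda>x. 0)"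
  by (auto simp: bdd_def)

lemma bdd_add [intro!, simp]:
  assumes "bdd \<phi>" "bdd \<psi>" shows "bdd (\<lambda>x. \<phi> x + \<psi> x)"
proof -
  obtain C where C: "\<And>x. \<bar>\<phi> x\<bar> \<le> C" using bddE[OF assms(1)] by blast
  obtain D where D: "\<And>x. \<bar>\<psi> x\<bar> \<le> D" using bddE[OF assms(2)] by blast
  have "\<bar>\<phi> x + \<psi> x\<bar> \<le> C + D" for x using C[of x] D[of x] by linarith
  thus ?thesis using assms unfolding bdd_def by auto
qed

lemma bdd_mult [intro!, simp]:
  assumes "bdd \<phi>" "bdd \<psi>" shows "bdd (\<lambda>x. \<phi> x * \<psi> x)"
proof -
  obtain C where C: "\<And>x. \<bar>\<phi> x\<bar> \<le> C" "C \<ge> 0" using bddE[OF assms(1)] by blast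
  obtain D where D: "\<And>x. \<bar>\<psi> x\<bar> \<le> D" using bddE[OF assms(2)] by blast
  have "\<bar>\<phi> x * \<psi> x\<bar> \<le> C * D" for x
    unfolding abs_mult by (intro mult_mono C D) auto
  thus ?thesis using assms unfolding bdd_def by auto
qed

lemma bdd_cmult [intro!, simp]:
  assumes "bdd \<phi>" shows "bdd (\<lambda>x. c * \<phi> x)"
proof -
  obtain C where C: "\<And>x. \<bar>\<phi> x\<bar> \<le> C" using bddE[OF assms(1)] by blast
  have "\<bar>c * \<phi> x\<bar> \<le> \<bar>c\<bar> * C" for x
    unfolding abs_mult by (intro mult_left_mono C) auto
  thus ?thesis using assms unfolding bdd_def by auto
qed

lemma bdd_uminus [intro!, simp]: "bdd \<phi> \<Longrightarrow> bdd (\<lambda>x. - \<phi> x)"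
  using bdd_cmult[of \<phi> "-1"] by simp

lemma bdd_diff [intro!, simp]: "bdd \<phi> \<Longrightarrow> bdd \<psi> \<Longrightarrow> bdd (\<lambda>x. \<phi> x - \<psi> x)"
  using bdd_add[of \<phi> "\<lambda>x. - \<psi> x"] by simp

lemma bdd_divide [intro!, simp]: "bdd \<phi> \<Longrightarrow> bdd (\<lambda>x. \<phi> x / c)"
  using bdd_cmult[of \<phi> "1 / c"] by simp

lemma bdd_sum [intro!, simp]: "(\<And>s. s \<in> F \<Longrightarrow> bdd (\<phi> s)) \<Longrightarrow> bdd (\<lambda>x. \<Sum>s\<in>F. \<phi> s x)"
  by (induction F rule: infinite_finite_induct) auto

lemma bdd_abs [intro!, simp]: "bdd \<phi> \<Longrightarrow> bdd (\<lambda>x. \<bar>\<phi> x\<bar>)"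
  unfolding bdd_def by auto

lemma bdd_power [intro!, simp]: "bdd \<phi> \<Longrightarrow> 0 < k \<Longrightarrow> bdd (\<lambda>x. \<phi> x ^ k)"
proof (induction k)
  case (Suc k) thus ?case by (cases "k = 0") auto
qed simp

lemma bdd_of_bool_mult:
  assumes "bdd \<phi>" "{x \<in> space P. Q x} \<in> sets P"
  shows "bdd (\<lambda>x. \<phi> x * of_bool (Q x))"
proof -
  obtain C where C: "\<And>x. \<bar>\<phi> x\<bar> \<le> C" "C \<ge> 0" using bddE[OF assms(1)] by blast
  have "(\<lambda>x. \<phi> x * indicator {x \<in> space P. Q x} x) \<in> borel_measurable P"
    using assms bddD by measurable
  also have "?this \<longleftrightarrow> (\<lambda>x. \<phi> x * of_bool (Q x)) \<in> borel_measurable P"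
    by (intro measurable_cong) (auto simp: indicator_def)
  finally have "(\<lambda>x. \<phi> x * of_bool (Q x)) \<in> borel_measurable P" .
  moreover have "\<bar>\<phi> x * of_bool (Q x)\<bar> \<le> C" for x using C by (cases "Q x") auto
  ultimately show ?thesis using assms(1) unfolding bdd_def by (intro conjI exI[of _ C] allI impI) auto
qed

lemma bdd_of_bool:
  assumes "{x \<in> space P. Q x} \<in> sets P"
  shows "bdd (\<lambda>x. of_bool (x \<in> space P \<and> Q x))"
proof -
  have "(indicator {x \<in> space P. Q x} :: _ \<Rightarrow> real) \<in> borel_measurable P"
    using assms by simp
  also have "indicator {x \<in> space P. Q x} = (\<lambda>x. of_bool (x \<in> space P \<and> Q x) :: real)"
    by (auto simp: indicator_def)
  finally show ?thesis unfolding bdd_def by (auto intro!: exI[of _ 1])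
qed

lemma integrable_bdd: "bdd \<phi> \<Longrightarrow> integrable P \<phi>"
  by (rule bddE, assumption) (auto intro!: P.integrable_const_bound AE_I2 simp: bddD)

lemma integrable_override_on:
  assumes "bdd \<phi>" "x \<in> space P"
  shows "integrable P (\<lambda>y. \<phi> (override_on x y A))"
proof -
  obtain C where C: "\<And>x. \<bar>\<phi> x\<bar> \<le> C" using bddE[OF assms(1)] by blast
  show ?thesis
  proof (rule P.integrable_const_bound)
    show "AE y in P. norm (\<phi> (override_on x y A)) \<le> C" using C by simp
    show "(\<lambda>y. \<phi> (override_on x y A)) \<in> borel_measurable P"
      by (rule measurable_compose[OF measurable_override_on_right[OF assms(2)] bddD(1)[OF assms(1)]])
  qed
qed

lemma bdd_avg [intro!, simp]:
  assumes "bdd \<phi>" shows "bdd (avg A \<phi>)"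
proof -
  obtain C where C: "\<And>x. \<bar>\<phi> x\<bar> \<le> C" "C \<ge> 0" using bddE[OF assms(1)] by blast
  have m: "\<phi> \<in> borel_measurable P" using assms bddD by blast
  have "(\<lambda>x. \<integral>y. \<phi> (override_on x y A) \<partial>P) \<in> borel_measurable P"
  proof (rule P.borel_measurable_lebesgue_integral)
    have "(\<lambda>p. \<phi> (case p of (x, y) \<Rightarrow> override_on x y A)) \<in> borel_measurable (P \<Otimes>\<^sub>M P)"
      by (rule measurable_compose[OF measurable_override_on m])
    thus "(\<lambda>(x, y). \<phi> (override_on x y A)) \<in> borel_measurable (P \<Otimes>\<^sub>M P)"
      by (simp add: split_beta)
  qed
  also have "?this \<longleftrightarrow> avg A \<phi> \<in> borel_measurable P"
    by (intro measurable_cong) (auto simp: avg_def)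
  finally have 1: "avg A \<phi> \<in> borel_measurable P" .
  have "\<bar>avg A \<phi> x\<bar> \<le> C" for x
  proof (cases "x \<in> space P")
    case True
    have "\<bar>\<integral>y. \<phi> (override_on x y A) \<partial>P\<bar> \<le> (\<integral>y. \<bar>\<phi> (override_on x y A)\<bar> \<partial>P)"
      by (rule integral_abs_bound)
    also have "\<dots> \<le> (\<integral>y. C \<partial>P)"
      by (intro integral_mono integrable_abs integrable_override_on assms True C P.integrable_const)
    finally show ?thesis using True by (simp add: avg_def P.prob_space)
  qed (simp add: avg_def C)
  thus ?thesis using 1 unfolding bdd_def by (intro conjI exI[of _ C] allI impI) (auto simp: avg_def)
qed

lemma avg_add: "bdd \<phi> \<Longrightarrow> bdd \<psi> \<Longrightarrow> avg A (\<lambda>x. \<phi> x + \<psi> x) = (\<lambda>x. avg A \<phi> x + avg A \<psi> x)"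
  by (auto simp: avg_def fun_eq_iff integrable_override_on)

lemma avg_diff: "bdd \<phi> \<Longrightarrow> bdd \<psi> \<Longrightarrow> avg A (\<lambda>x. \<phi> x - \<psi> x) = (\<lambda>x. avg A \<phi> x - avg A \<psi> x)"
  by (auto simp: avg_def fun_eq_iff integrable_override_on)

lemma avg_cmult: "avg A (\<lambda>x. c * \<phi> x) = (\<lambda>x. c * avg A \<phi> x)"
  by (auto simp: avg_def fun_eq_iff)

lemma avg_uminus: "avg A (\<lambda>x. - \<phi> x) = (\<lambda>x. - avg A \<phi> x)"
  by (auto simp: avg_def fun_eq_iff)

lemma avg_divide: "avg A (\<lambda>x. \<phi> x / c) = (\<lambda>x. avg A \<phi> x / c)"
  by (auto simp: avg_def fun_eq_iff)

lemma avg_zero [simp]: "avg A (\<lambda>x. 0) = (\<lambda>x. 0)"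
  by (auto simp: avg_def fun_eq_iff)

lemma avg_sum:
  "(\<And>s. s \<in> F \<Longrightarrow> bdd (\<phi> s)) \<Longrightarrow> avg A (\<lambda>x. \<Sum>s\<in>F. \<phi> s x) = (\<lambda>x. \<Sum>s\<in>F. avg A (\<phi> s) x)"
  by (induction F rule: infinite_finite_induct) (auto simp: avg_add)

lemma avg_mono:
  assumes "bdd \<phi>" "bdd \<psi>" "\<And>x. x \<in> space P \<Longrightarrow> \<phi> x \<le> \<psi> x"
  shows "avg A \<phi> x \<le> avg A \<psi> x"
  unfolding avg_def
  by (auto intro!: integral_mono integrable_override_on assms override_on_space)

lemma avg_nonneg: "(\<And>x. x \<in> space P \<Longrightarrow> 0 \<le> \<phi> x) \<Longrightarrow> 0 \<le> avg A \<phi> x"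
  unfolding avg_def
  by (auto intro!: integral_nonneg_AE AE_I2 override_on_space)

lemma avg_le_const:
  assumes "bdd \<phi>" "\<And>x. x \<in> space P \<Longrightarrow> \<phi> x \<le> c" "0 \<le> c"
  shows "avg A \<phi> x \<le> c"
proof (cases "x \<in> space P")
  case True
  have "(\<integral>y. \<phi> (override_on x y A) \<partial>P) \<le> (\<integral>y. c \<partial>P)"
    by (intro integral_mono integrable_override_on assms True override_on_space P.integrable_const)
  thus ?thesis using True by (simp add: avg_def P.prob_space)
qed (simp add: avg_def assms)

text \<open>By Fubini, resampling \<open>A\<close> from \<open>y\<close> and then \<open>B\<close>
  from \<open>z\<close> is resampling \<open>A \<union> B\<close> from a mixture of \<open>y\<close>
  and \<open>z\<close>, which has law \<open>P\<close> by \<open>distr_override_on\<close>. Hence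
  all averages commute and are idempotent.\<close>

lemma avg_avg:
  assumes "bdd \<phi>" shows "avg A (avg B \<phi>) = avg (A \<union> B) \<phi>"
proof
  fix x
  show "avg A (avg B \<phi>) x = avg (A \<union> B) \<phi> x"
  proof (cases "x \<in> space P")
    case True
    define q where "q = (\<lambda>z. \<phi> (override_on x z (A \<union> B)))"
    obtain C where C: "\<And>x. \<bar>\<phi> x\<bar> \<le> C" "C \<ge> 0" using bddE[OF assms(1)] by blast
    have q: "q \<in> borel_measurable P" unfolding q_def
      by (intro measurable_compose[OF measurable_override_on_right[OF True]] bddD assms)
    have "integrable (P \<Otimes>\<^sub>M P) (\<lambda>p. q (case p of (y, z) \<Rightarrow> override_on y z B))"
      using C by (intro PP.P.integrable_const_bound[of _ C] measurable_compose[OF measurable_override_on q])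
         (auto simp: q_def)
    hence i: "integrable (P \<Otimes>\<^sub>M P) (\<lambda>(y, z). q (override_on y z B))" by (simp add: split_beta')
    have "avg (A \<union> B) \<phi> x = (\<integral>z. q z \<partial>P)" using True by (simp add: avg_def q_def)
    also have "\<dots> = (\<integral>z. q z \<partial>distr (P \<Otimes>\<^sub>M P) P (\<lambda>(x, y). override_on x y B))"
      by (simp add: distr_override_on)
    also have "\<dots> = (\<integral>p. q (case p of (y, z) \<Rightarrow> override_on y z B) \<partial>(P \<Otimes>\<^sub>M P))"
      by (rule integral_distr[OF measurable_override_on q])
    also have "\<dots> = (\<integral>(y, z). q (override_on y z B) \<partial>(P \<Otimes>\<^sub>M P))" by (simp add: split_beta')
    also have "\<dots> = (\<integral>y. \<integral>z. q (override_on y z B) \<partial>P \<partial>P)"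
      by (subst PP.integral_fst'[OF i, symmetric]) simp
    also have "\<dots> = avg A (avg B \<phi>) x"
      using True
      apply (simp add: avg_def q_def)
      apply (intro Bochner_Integration.integral_cong refl)
      apply (auto simp: override_on_space intro!: Bochner_Integration.integral_cong arg_cong[of _ _ \<phi>])
      apply (auto simp: override_on_def)
      done
    finally show ?thesis by simp
  qed (simp add: avg_def)
qed

lemma dep_avg: "dep S \<phi> \<Longrightarrow> dep (S - A) (avg A \<phi>)"
  unfolding dep_def avg_def
proof (clarsimp, intro Bochner_Integration.integral_cong refl)
  fix x y z
  assume *: "\<forall>x\<in>space P. \<forall>y\<in>space P. (\<forall>i\<in>S. x i = y i) \<longrightarrow> \<phi> x = \<phi> y"
    "x \<in> space P" "y \<in> space P" "\<forall>i\<in>S - A. x i = y i" "z \<in> space P"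
  show "\<phi> (override_on x z A) = \<phi> (override_on y z A)"
    using *(4) by (intro *(1)[rule_format] override_on_space *) (auto simp: override_on_def)
qed

lemma dep_avg': "dep S \<phi> \<Longrightarrow> dep S (avg A \<phi>)"
  using dep_avg[of S \<phi> A] unfolding dep_def by blast

lemma dep_mono: "dep S \<phi> \<Longrightarrow> S \<subseteq> T \<Longrightarrow> dep T \<phi>"
  unfolding dep_def by blast

lemma dep_I [simp]: "dep I \<phi>"
  unfolding dep_def
proof clarify
  fix x y assume "x \<in> space P" "y \<in> space P" "\<forall>i\<in>I. x i = y i"
  hence "x = y" unfolding space_PiM by (metis PiE_ext)
  thus "\<phi> x = \<phi> y" by simp
qed

lemma dep_avg_compl: "dep S (avg (I - S) \<phi>)"
  using dep_avg[OF dep_I, of "I - S" \<phi>] by (rule dep_mono) auto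

text \<open>The pull-out property of conditional expectation.\<close>

lemma avg_dep_mult:
  assumes "dep S \<phi>" "A \<inter> S = {}"
  shows "avg A (\<lambda>x. \<phi> x * \<psi> x) = (\<lambda>x. \<phi> x * avg A \<psi> x)"
proof
  fix x
  show "avg A (\<lambda>x. \<phi> x * \<psi> x) x = \<phi> x * avg A \<psi> x"
  proof (cases "x \<in> space P")
    case True
    have "(\<integral>y. \<phi> (override_on x y A) * \<psi> (override_on x y A) \<partial>P) = (\<integral>y. \<phi> x * \<psi> (override_on x y A) \<partial>P)"
    proof (intro Bochner_Integration.integral_cong refl)
      fix y assume y: "y \<in> space P"
      have "\<phi> (override_on x y A) = \<phi> x" using assms(2)
        by (intro assms(1)[unfolded dep_def, rule_format] override_on_space True y)
           (auto simp: override_on_def)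
      thus "\<phi> (override_on x y A) * \<psi> (override_on x y A) = \<phi> x * \<psi> (override_on x y A)" by simp
    qed
    thus ?thesis using True by (simp add: avg_def)
  qed (simp add: avg_def)
qed

lemma avg_dep:
  assumes "bdd \<phi>" "dep S \<phi>" "A \<inter> S = {}" shows "avg A \<phi> = \<phi>"
proof
  fix x
  show "avg A \<phi> x = \<phi> x"
  proof (cases "x \<in> space P")
    case True
    have "(\<integral>y. \<phi> (override_on x y A) \<partial>P) = (\<integral>y. \<phi> x \<partial>P)"
    proof (intro Bochner_Integration.integral_cong refl)
      fix y assume y: "y \<in> space P"
      show "\<phi> (override_on x y A) = \<phi> x" using assms(3)
        by (intro assms(2)[unfolded dep_def, rule_format] override_on_space True y)
           (auto simp: override_on_def)
    qed
    thus ?thesis using True by (simp add: avg_def P.prob_space)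
  qed (simp add: avg_def bddD(2)[OF assms(1)])
qed

lemma avg_I: 
  assumes "x \<in> space P" shows "avg I \<phi> x = (\<integral>x. \<phi> x \<partial>P)"
proof -
  have "override_on x y I = y" if "y \<in> space P" for y
    using that assms by (auto simp: override_on_def space_PiM fun_eq_iff PiE_def extensional_def)
  thus ?thesis using assms by (auto simp: avg_def intro!: Bochner_Integration.integral_cong)
qed

lemma avg_empty [simp]: "bdd \<phi> \<Longrightarrow> avg {} \<phi> = \<phi>"
  by (rule avg_dep[of _ I]) auto

subsection \<open>Products of averaging operators\<close>

lemma dep_add: "dep S \<phi> \<Longrightarrow> dep S \<psi> \<Longrightarrow> dep S (\<lambda>x. \<phi> x + \<psi> x)"
  and dep_mult: "dep S \<phi> \<Longrightarrow> dep S \<psi> \<Longrightarrow> dep S (\<lambda>x. \<phi> x * \<psi> x)"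
  and dep_cmult: "dep S \<phi> \<Longrightarrow> dep S (\<lambda>x. c * \<phi> x)"
  and dep_zero: "dep S (\<lambda>x. 0)"
  unfolding dep_def by metis+

lemma dep_sum: "(\<And>s. s \<in> F \<Longrightarrow> dep S (\<phi> s)) \<Longrightarrow> dep S (\<lambda>x. \<Sum>s\<in>F. \<phi> s x)"
  by (induction F rule: infinite_finite_induct) (auto intro: dep_add dep_zero)

text \<open>A function fixed by \<open>avg {j}\<close> does not depend on coordinate
  \<open>j\<close>, so the pull-out property applies.\<close>

lemma avg_invariant_mult:
  assumes "avg {j} \<phi> = \<phi>"
  shows "avg {j} (\<lambda>x. \<phi> x * \<psi> x) = (\<lambda>x. \<phi> x * avg {j} \<psi> x)"
proof (rule avg_dep_mult)
  show "dep (I - {j}) \<phi>" using dep_avg[OF dep_I, of "{j}" \<phi>] assms by simp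
qed auto

text \<open>The product of the commuting operators \<open>c + d \<cdot> avg {j}\<close> over \<open>j \<in> A\<close>.\<close>

definition mix :: "real \<Rightarrow> real \<Rightarrow> nat set \<Rightarrow> ((nat \<Rightarrow> 'a) \<Rightarrow> real) \<Rightarrow> (nat \<Rightarrow> 'a) \<Rightarrow> real" where
  "mix c d A \<phi> x = (\<Sum>T\<in>Pow A. c ^ card (A - T) * d ^ card T * avg T \<phi> x)"

text \<open>The product of the operators \<open>1 - avg {j}\<close>, which centres in each
  coordinate of \<open>A\<close>; on functions of \<open>x_A\<close> it is the projection to the top
  Efron--Stein component.\<close>

abbreviation proj :: "nat set \<Rightarrow> ((nat \<Rightarrow> 'a) \<Rightarrow> real) \<Rightarrow> (nat \<Rightarrow> 'a) \<Rightarrow> real" where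
  "proj \<equiv> mix 1 (-1)"

text \<open>The noise operator of rate one half: every coordinate of \<open>A\<close> is resampled
  independently with probability one half.\<close>

abbreviation noise :: "nat set \<Rightarrow> ((nat \<Rightarrow> 'a) \<Rightarrow> real) \<Rightarrow> (nat \<Rightarrow> 'a) \<Rightarrow> real" where
  "noise \<equiv> mix (1/2) (1/2)"

lemma bdd_mix [intro!, simp]: "bdd \<phi> \<Longrightarrow> bdd (mix c d A \<phi>)"
  unfolding mix_def by auto

lemma mix_empty [simp]: "bdd \<phi> \<Longrightarrow> mix c d {} \<phi> = \<phi>"
  by (simp add: mix_def fun_eq_iff)

lemma mix_add: "bdd \<phi> \<Longrightarrow> bdd \<psi> \<Longrightarrow> mix c d A (\<lambda>x. \<phi> x + \<psi> x) = (\<lambda>x. mix c d A \<phi> x + mix c d A \<psi> x)"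
  by (simp add: mix_def fun_eq_iff avg_add algebra_simps sum.distrib)

lemma mix_diff: "bdd \<phi> \<Longrightarrow> bdd \<psi> \<Longrightarrow> mix c d A (\<lambda>x. \<phi> x - \<psi> x) = (\<lambda>x. mix c d A \<phi> x - mix c d A \<psi> x)"
  by (simp add: mix_def fun_eq_iff avg_diff algebra_simps sum_subtractf)

lemma mix_cmult: "mix c d A (\<lambda>x. k * \<phi> x) = (\<lambda>x. k * mix c d A \<phi> x)"
  by (simp add: mix_def fun_eq_iff avg_cmult algebra_simps sum_distrib_left)

lemma mix_zero [simp]: "mix c d A (\<lambda>x. 0) = (\<lambda>x. 0)"
  by (simp add: mix_def fun_eq_iff)

lemma mix_sum:
  "(\<And>s. s \<in> F \<Longrightarrow> bdd (\<phi> s)) \<Longrightarrow> mix c d A (\<lambda>x. \<Sum>s\<in>F. \<phi> s x) = (\<lambda>x. \<Sum>s\<in>F. mix c d A (\<phi> s) x)"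
  by (induction F rule: infinite_finite_induct) (auto simp: mix_add)

lemma avg_commute: "bdd \<phi> \<Longrightarrow> avg A (avg B \<phi>) = avg B (avg A \<phi>)"
  by (simp add: avg_avg Un_commute)

lemma avg_mix: "bdd \<phi> \<Longrightarrow> avg B (mix c d A \<phi>) = mix c d A (avg B \<phi>)"
  unfolding mix_def by (simp add: fun_eq_iff avg_sum avg_cmult avg_commute[of _ B])

lemma mix_insert:
  assumes "finite A" "j \<notin> A" "bdd \<phi>"
  shows "mix c d (insert j A) \<phi> = (\<lambda>x. c * mix c d A \<phi> x + d * avg {j} (mix c d A \<phi>) x)"
proof
  fix x
  have 1: "card (insert j A - T) = Suc (card (A - T))" if "T \<subseteq> A" for T
    using assms that by (subst insert_Diff_if) (auto simp: finite_subset)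
  have 2: "card (insert j T) = Suc (card T)" "insert j A - insert j T = A - T" if "T \<subseteq> A" for T
    using assms that finite_subset[of T A] by (auto simp: subset_iff intro!: card_insert_disjoint)
  have "mix c d (insert j A) \<phi> x
    = (\<Sum>T\<in>Pow A. c * (c ^ card (A - T) * d ^ card T * avg T \<phi> x)
                 + d * (c ^ card (A - T) * d ^ card T * avg {j} (avg T \<phi>) x))"
    unfolding mix_def sum_Pow_insert[OF assms(1,2)]
    by (intro sum.cong refl) (auto simp: 1 2 avg_avg assms)
  also have "\<dots> = c * mix c d A \<phi> x + d * avg {j} (mix c d A \<phi>) x"
    unfolding mix_def using assms(3)
    by (simp add: avg_sum avg_cmult sum.distrib sum_distrib_left)
  finally show "mix c d (insert j A) \<phi> x = c * mix c d A \<phi> x + d * avg {j} (mix c d A \<phi>) x" .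
qed

lemma mix_Un:
  assumes "finite A" "finite B" "A \<inter> B = {}" "bdd \<phi>"
  shows "mix c d (A \<union> B) \<phi> = mix c d A (mix c d B \<phi>)"
  using assms
proof (induction A rule: finite_induct)
  case (insert j A)
  thus ?case by (simp add: mix_insert)
qed auto

lemma mix_invariant:
  assumes "finite A" "bdd \<phi>" "\<And>j. j \<in> A \<Longrightarrow> avg {j} \<phi> = \<phi>"
  shows "mix c d A \<phi> = (\<lambda>x. (c + d) ^ card A * \<phi> x)"
  using assms
proof (induction A rule: finite_induct)
  case (insert j A)
  thus ?case by (simp add: mix_insert avg_cmult) (simp add: algebra_simps)
qed auto

lemma mix_centred:
  assumes "finite A" "bdd \<phi>" "\<And>j. j \<in> A \<Longrightarrow> avg {j} \<phi> = (\<lambda>x. 0)"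
  shows "mix c d A \<phi> = (\<lambda>x. c ^ card A * \<phi> x)"
  using assms
proof (induction A rule: finite_induct)
  case (insert j A)
  thus ?case by (simp add: mix_insert avg_cmult) (simp add: algebra_simps)
qed auto

lemma dep_mix: "dep S \<phi> \<Longrightarrow> dep S (mix c d A \<phi>)"
  unfolding mix_def[abs_def] by (intro dep_sum dep_cmult dep_avg')

lemma avg_proj:
  assumes "finite S" "j \<in> S" "bdd \<phi>"
  shows "avg {j} (proj S \<phi>) = (\<lambda>x. 0)"
proof -
  obtain S' where S': "S = insert j S'" "j \<notin> S'" using assms(2) mk_disjoint_insert by metis
  hence "finite S'" using assms(1) by simp
  thus ?thesis using S' assms(3) by (simp add: mix_insert avg_diff avg_avg)
qed

text \<open>A combination of averages with nonnegative weights of total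
  \<open>(c + d) ^ card A\<close>, and each average preserves upper bounds.\<close>

lemma mix_le_const:
  assumes "finite A" "bdd \<phi>" "\<And>x. x \<in> space P \<Longrightarrow> \<phi> x \<le> k" "0 \<le> c" "0 \<le> d" "0 \<le> k"
  shows "mix c d A \<phi> x \<le> (c + d) ^ card A * k"
  using assms(1)
proof (induction A arbitrary: x rule: finite_induct)
  case empty
  thus ?case using assms bddD(2)[of \<phi> x] by (cases "x \<in> space P") auto
next
  case (insert j A)
  have "avg {j} (mix c d A \<phi>) x \<le> (c + d) ^ card A * k"
    using assms insert by (intro avg_le_const) auto
  hence "d * avg {j} (mix c d A \<phi>) x \<le> d * ((c + d) ^ card A * k)"
    using assms by (intro mult_left_mono)
  moreover have "c * mix c d A \<phi> x \<le> c * ((c + d) ^ card A * k)"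
    using assms insert by (intro mult_left_mono)
  ultimately show ?case using insert assms by (simp add: mix_insert algebra_simps)
qed

text \<open>The conditional variance, the average of \<open>(\<phi> - avg A \<phi>)\<^sup>2\<close>,
  is nonnegative.\<close>

lemma avg_square_le:
  assumes "bdd \<phi>" shows "(avg A \<phi> x)\<^sup>2 \<le> avg A (\<lambda>x. (\<phi> x)\<^sup>2) x"
proof -
  define a where "a = avg A \<phi>"
  have a: "bdd a" "dep (I - A) a" using assms by (auto simp: a_def intro: dep_avg[OF dep_I])
  have 1: "avg A (\<lambda>x. a x * \<phi> x) = (\<lambda>x. a x * a x)"
    using avg_dep_mult[OF a(2), of A \<phi>] by (simp add: a_def Diff_Diff_Int inf.commute)
  have 2: "avg A (\<lambda>x. a x * a x) = (\<lambda>x. a x * a x)"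
    by (rule avg_dep[of _ "I - A"]) (auto intro!: dep_mult a)
  have "0 \<le> avg A (\<lambda>x. (\<phi> x - a x)\<^sup>2) x" by (rule avg_nonneg) simp
  also have "(\<lambda>x. (\<phi> x - a x)\<^sup>2) = (\<lambda>x. (\<phi> x)\<^sup>2 - (2 * (a x * \<phi> x) - a x * a x))"
    by (auto simp: power2_eq_square algebra_simps)
  also have "avg A \<dots> x = avg A (\<lambda>x. (\<phi> x)\<^sup>2) x - (a x)\<^sup>2"
    using a assms by (simp add: avg_diff avg_cmult 1 2 power2_eq_square)
  finally show ?thesis by (simp add: a_def)
qed

text \<open>One coordinate at a time, \<open>(p - avg {j} p)\<^sup>2\<close> is at most
  \<open>2 * p\<^sup>2 + 2 * avg {j} (p\<^sup>2)\<close>. A pointwise majorant by a positive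
  operator can still be conditioned on \<open>x_U\<close> afterwards, unlike an L2 bound.\<close>

lemma proj_square_le:
  assumes "finite A" "bdd \<phi>"
  shows "(proj A \<phi> x)\<^sup>2 \<le> mix 2 2 A (\<lambda>x. (\<phi> x)\<^sup>2) x"
  using assms(1)
proof (induction A arbitrary: x rule: finite_induct)
  case (insert j A)
  define p where "p = proj A \<phi>"
  define q where "q = mix 2 2 A (\<lambda>x. (\<phi> x)\<^sup>2)"
  have pq: "bdd p" "bdd q" using assms by (auto simp: p_def q_def)
  have "(proj (insert j A) \<phi> x)\<^sup>2 = (p x - avg {j} p x)\<^sup>2"
    using insert assms by (simp add: mix_insert p_def)
  also have "\<dots> \<le> 2 * (p x)\<^sup>2 + 2 * (avg {j} p x)\<^sup>2"
    using sum_squares_ge_zero[of "p x + avg {j} p x" 0] by (simp add: power2_eq_square algebra_simps)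
  also have "(avg {j} p x)\<^sup>2 \<le> avg {j} (\<lambda>x. (p x)\<^sup>2) x" using pq by (intro avg_square_le)
  also have "avg {j} (\<lambda>x. (p x)\<^sup>2) x \<le> avg {j} q x"
    using insert.IH pq by (intro avg_mono) (auto simp: p_def q_def)
  also have "(p x)\<^sup>2 \<le> q x" using insert.IH by (auto simp: p_def q_def)
  finally show ?case using insert assms by (simp add: mix_insert q_def)
qed (use assms in auto)

text \<open>
  Two functions are needed even for fourth moments: the induction produces the cross term of the mean
  and the fluctuation in the new coordinate, which Cauchy--Schwarz would bound too crudely.
\<close>

theorem noise_hypercontractive:
  assumes "finite A" "bdd \<phi>" "bdd \<psi>"
  shows "avg A (\<lambda>x. (noise A \<phi> x)\<^sup>2 * (noise A \<psi> x)\<^sup>2) x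
    \<le> (\<Sum>U\<in>Pow A. avg A (\<lambda>x. avg (A - U) (\<lambda>x. (proj U \<phi> x)\<^sup>2) x * avg (A - U) (\<lambda>x. (proj U \<psi> x)\<^sup>2) x) x)"
  using assms
proof (induction A arbitrary: \<phi> \<psi> x rule: finite_induct)
  case (insert j A)
  \<comment> \<open>A conditional energy of the \<open>U\<close>-centred part of \<open>p\<close>;
    the coordinates outside \<open>A\<close>, among them \<open>j\<close>, are held fixed.\<close>
  define V where "V = (\<lambda>U p. avg (A - U) (\<lambda>x. (proj U p x)\<^sup>2))"
  \<comment> \<open>Means and fluctuations in coordinate \<open>j\<close>: the noise in
    \<open>j\<close> fixes the former and halves the latter.\<close>
  define a where "a = avg {j} \<phi>"
  define b where "b = (\<lambda>x. \<phi> x - avg {j} \<phi> x)"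
  define d where "d = avg {j} \<psi>"
  define e where "e = (\<lambda>x. \<psi> x - avg {j} \<psi> x)"
  define \<alpha> where "\<alpha> = noise A a"
  define \<beta> where "\<beta> = noise A b"
  define \<gamma> where "\<gamma> = noise A d"
  define \<delta> where "\<delta> = noise A e"
  note defs = a_def b_def d_def e_def \<alpha>_def \<beta>_def \<gamma>_def \<delta>_def
  have BV [simp]: "bdd (V U p)" if "bdd p" for U p
    using that by (auto simp: V_def)
  have B [simp]: "bdd a" "bdd b" "bdd d" "bdd e" "bdd \<alpha>" "bdd \<beta>" "bdd \<gamma>" "bdd \<delta>"
    using insert.prems by (auto simp: defs)
  have inv: "avg {j} a = a" "avg {j} d = d" "avg {j} b = (\<lambda>x. 0)" "avg {j} e = (\<lambda>x. 0)"
    using insert.prems by (auto simp: defs avg_avg avg_diff)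
  have inv': "avg {j} \<alpha> = \<alpha>" "avg {j} \<gamma> = \<gamma>" "avg {j} \<beta> = (\<lambda>x. 0)" "avg {j} \<delta> = (\<lambda>x. 0)"
    unfolding \<alpha>_def \<beta>_def \<gamma>_def \<delta>_def by (simp_all add: avg_mix inv)
  have ins: "avg (insert j A) p = avg A (avg {j} p)" "avg (insert j A) p = avg {j} (avg A p)" if "bdd p" for p
    using that by (simp_all add: avg_avg)
  have H: "avg (insert j A) (\<lambda>x. (noise A p x)\<^sup>2 * (noise A q x)\<^sup>2) x
      \<le> (\<Sum>U\<in>Pow A. avg (insert j A) (\<lambda>x. V U p x * V U q x) x)" if "bdd p" "bdd q" for p q
  proof -
    have "avg (insert j A) (\<lambda>x. (noise A p x)\<^sup>2 * (noise A q x)\<^sup>2) x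
      = avg {j} (avg A (\<lambda>x. (noise A p x)\<^sup>2 * (noise A q x)\<^sup>2)) x"
      using that by (subst ins(2)) auto
    also have "\<dots> \<le> avg {j} (\<lambda>x. \<Sum>U\<in>Pow A. avg A (\<lambda>x. V U p x * V U q x) x) x"
      using that insert.IH[OF that] by (intro avg_mono) (auto simp: V_def)
    also have "\<dots> = (\<Sum>U\<in>Pow A. avg (insert j A) (\<lambda>x. V U p x * V U q x) x)"
      using that by (simp add: avg_sum ins(2))
    finally show ?thesis .
  qed
  have N: "noise (insert j A) \<phi> = (\<lambda>x. \<alpha> x + \<beta> x / 2)" "noise (insert j A) \<psi> = (\<lambda>x. \<gamma> x + \<delta> x / 2)"
    using insert by (auto simp: mix_insert defs avg_mix mix_diff fun_eq_iff field_simps)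
  have "(noise (insert j A) \<phi> x)\<^sup>2 * (noise (insert j A) \<psi> x)\<^sup>2 \<le>
     (\<alpha> x)\<^sup>2 * (\<gamma> x)\<^sup>2 + (\<alpha> x)\<^sup>2 * \<gamma> x * \<delta> x + \<alpha> x * (\<gamma> x)\<^sup>2 * \<beta> x + (\<alpha> x)\<^sup>2 * (\<delta> x)\<^sup>2 + (\<gamma> x)\<^sup>2 * (\<beta> x)\<^sup>2 + (\<beta> x)\<^sup>2 * (\<delta> x)\<^sup>2" for x
  proof -
    \<comment> \<open>The two terms linear in the fluctuations \<open>t\<close>, \<open>v\<close>
      keep their exact coefficients because they average to zero in \<open>j\<close>; the remaining
      cross terms are absorbed by squares.\<close>
    have poly: "(s + t/2)\<^sup>2 * (u + v/2)\<^sup>2 \<le> s\<^sup>2*u\<^sup>2 + s\<^sup>2*u* v + s*u\<^sup>2*t + s\<^sup>2* v\<^sup>2 + u\<^sup>2*t\<^sup>2 + t\<^sup>2* v\<^sup>2" for s t u v :: real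
    proof -
      have eq: "s\<^sup>2*u\<^sup>2 + s\<^sup>2*u* v + s*u\<^sup>2*t + s\<^sup>2* v\<^sup>2 + u\<^sup>2*t\<^sup>2 + t\<^sup>2* v\<^sup>2 - (s + t/2)\<^sup>2 * (u + v/2)\<^sup>2
        = (s* v - t*u)\<^sup>2 / 2 + (s* v - t* v)\<^sup>2/8 + (t*u - t* v)\<^sup>2/8 + (s* v)\<^sup>2/8 + (t*u)\<^sup>2/8 + 11/16*(t* v)\<^sup>2"
        by (simp add: power2_eq_square field_simps)
      have "0 \<le> (s* v - t*u)\<^sup>2 / 2 + (s* v - t* v)\<^sup>2/8 + (t*u - t* v)\<^sup>2/8 + (s* v)\<^sup>2/8 + (t*u)\<^sup>2/8 + 11/16*(t* v)\<^sup>2"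
        by (intro add_nonneg_nonneg) auto
      thus ?thesis unfolding eq[symmetric] by linarith
    qed
    show ?thesis unfolding N by (rule poly)
  qed
  hence "avg (insert j A) (\<lambda>x. (noise (insert j A) \<phi> x)\<^sup>2 * (noise (insert j A) \<psi> x)\<^sup>2) x \<le>
     avg (insert j A) (\<lambda>x. (\<alpha> x)\<^sup>2 * (\<gamma> x)\<^sup>2 + (\<alpha> x)\<^sup>2 * \<gamma> x * \<delta> x + \<alpha> x * (\<gamma> x)\<^sup>2 * \<beta> x + (\<alpha> x)\<^sup>2 * (\<delta> x)\<^sup>2 + (\<gamma> x)\<^sup>2 * (\<beta> x)\<^sup>2 + (\<beta> x)\<^sup>2 * (\<delta> x)\<^sup>2) x"
    using insert.prems by (intro avg_mono) auto
  also have "\<dots> = avg (insert j A) (\<lambda>x. (\<alpha> x)\<^sup>2 * (\<gamma> x)\<^sup>2) x + avg (insert j A) (\<lambda>x. (\<alpha> x)\<^sup>2 * (\<delta> x)\<^sup>2) x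
     + avg (insert j A) (\<lambda>x. (\<gamma> x)\<^sup>2 * (\<beta> x)\<^sup>2) x + avg (insert j A) (\<lambda>x. (\<beta> x)\<^sup>2 * (\<delta> x)\<^sup>2) x"
  proof -
    have sq: "avg {j} (\<lambda>x. (p x)\<^sup>2) = (\<lambda>x. (p x)\<^sup>2)" if "avg {j} p = p" for p
      using avg_invariant_mult[OF that, of p] that by (simp add: power2_eq_square)
    have pr: "avg {j} (\<lambda>x. p x * q x) = (\<lambda>x. p x * q x)" if "avg {j} p = p" "avg {j} q = q" for p q
      using avg_invariant_mult[OF that(1), of q] that by simp
    have "avg {j} (\<lambda>x. (\<alpha> x)\<^sup>2 * \<gamma> x * \<delta> x) = (\<lambda>x. 0)"
      by (subst avg_invariant_mult) (auto intro!: pr sq inv' simp: inv')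
    moreover have "avg {j} (\<lambda>x. \<alpha> x * (\<gamma> x)\<^sup>2 * \<beta> x) = (\<lambda>x. 0)"
      by (subst avg_invariant_mult) (auto intro!: pr sq inv' simp: inv')
    ultimately have "avg (insert j A) (\<lambda>x. (\<alpha> x)\<^sup>2 * \<gamma> x * \<delta> x) = (\<lambda>x. 0)" "avg (insert j A) (\<lambda>x. \<alpha> x * (\<gamma> x)\<^sup>2 * \<beta> x) = (\<lambda>x. 0)"
      by (simp_all add: ins(1))
    thus ?thesis by (simp add: avg_add)
  qed
  also have "\<dots> \<le> (\<Sum>U\<in>Pow A. avg (insert j A) (\<lambda>x. V U a x * V U d x) x)
    + (\<Sum>U\<in>Pow A. avg (insert j A) (\<lambda>x. V U a x * V U e x) x)
    + (\<Sum>U\<in>Pow A. avg (insert j A) (\<lambda>x. V U d x * V U b x) x)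
    + (\<Sum>U\<in>Pow A. avg (insert j A) (\<lambda>x. V U b x * V U e x) x)"
    unfolding \<alpha>_def \<beta>_def \<gamma>_def \<delta>_def by (intro add_mono H B)
  also have "\<dots> = (\<Sum>U\<in>Pow A. avg (insert j A) (\<lambda>x. V U a x * V U d x) x + avg (insert j A) (\<lambda>x. V U a x * V U e x) x
      + avg (insert j A) (\<lambda>x. V U d x * V U b x) x + avg (insert j A) (\<lambda>x. V U b x * V U e x) x)"
    by (simp add: sum.distrib)
  \<comment> \<open>The three products involving a mean are absorbed by the summand of
    \<open>U\<close>, the product of two fluctuations by that of \<open>insert j U\<close>.\<close>
  also have "\<dots> \<le> (\<Sum>U\<in>Pow A.
       avg (insert j A) (\<lambda>x. avg (insert j A - U) (\<lambda>x. (proj U \<phi> x)\<^sup>2) x * avg (insert j A - U) (\<lambda>x. (proj U \<psi> x)\<^sup>2) x) x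
     + avg (insert j A) (\<lambda>x. avg (insert j A - insert j U) (\<lambda>x. (proj (insert j U) \<phi> x)\<^sup>2) x *
            avg (insert j A - insert j U) (\<lambda>x. (proj (insert j U) \<psi> x)\<^sup>2) x) x)"
  proof (rule sum_mono)
    fix U assume "U \<in> Pow A"
    hence U: "finite U" "j \<notin> U" "insert j A - U = insert j (A - U)" "insert j A - insert j U = A - U"
      using insert.hyps finite_subset by auto
    \<comment> \<open>Pythagoras in coordinate \<open>j\<close>: the energy is that of the mean plus
      the averaged energy of the fluctuation.\<close>
    have W: "avg (insert j A - U) (\<lambda>x. (proj U p x)\<^sup>2) = (\<lambda>x. V U (avg {j} p) x + avg {j} (V U (\<lambda>x. p x - avg {j} p x)) x)"
       and W': "avg (insert j A - insert j U) (\<lambda>x. (proj (insert j U) p x)\<^sup>2) = V U (\<lambda>x. p x - avg {j} p x)"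
       and invV: "avg {j} (V U (avg {j} p)) = V U (avg {j} p)"
      if p: "bdd p" for p
    proof -
      define r where "r = proj U (avg {j} p)"
      define s where "s = proj U (\<lambda>x. p x - avg {j} p x)"
      have rs: "bdd r" "bdd s" "avg {j} r = r" "avg {j} s = (\<lambda>x. 0)" using p
        by (auto simp: r_def s_def avg_mix avg_avg avg_diff)
      have "proj U p = (\<lambda>x. r x + s x)" using p by (simp add: r_def s_def mix_diff)
      hence "(\<lambda>x. (proj U p x)\<^sup>2) = (\<lambda>x. r x * r x + (2 * (r x * s x) + s x * s x))"
        by (simp add: power2_eq_square algebra_simps)
      hence "avg {j} (\<lambda>x. (proj U p x)\<^sup>2) = (\<lambda>x. r x * r x + avg {j} (\<lambda>x. s x * s x) x)"
        using rs by (simp add: avg_add avg_cmult avg_invariant_mult)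
      hence "avg (insert j A - U) (\<lambda>x. (proj U p x)\<^sup>2) = avg (A - U) (\<lambda>x. r x * r x + avg {j} (\<lambda>x. s x * s x) x)"
        using p by (simp add: U avg_avg flip: avg_avg[of _ "A - U" "{j}", simplified])
      also have "\<dots> = (\<lambda>x. V U (avg {j} p) x + avg {j} (V U (\<lambda>x. p x - avg {j} p x)) x)"
        using rs by (simp add: avg_add V_def flip: r_def s_def) (simp add: power2_eq_square avg_avg)
      finally show "avg (insert j A - U) (\<lambda>x. (proj U p x)\<^sup>2) = (\<lambda>x. V U (avg {j} p) x + avg {j} (V U (\<lambda>x. p x - avg {j} p x)) x)" .
      have "proj (insert j U) p = proj U (\<lambda>x. p x - avg {j} p x)"
        using U p by (simp add: mix_insert mix_diff avg_mix)
      thus "avg (insert j A - insert j U) (\<lambda>x. (proj (insert j U) p x)\<^sup>2) = V U (\<lambda>x. p x - avg {j} p x)"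
        by (simp add: V_def U)
      have "avg {j} (V U (avg {j} p)) = avg (A - U) (avg {j} (\<lambda>x. r x * r x))"
        using rs by (simp add: V_def avg_commute[of _ "{j}"] power2_eq_square flip: r_def)
      also have "\<dots> = V U (avg {j} p)" using rs
        by (simp add: avg_invariant_mult V_def flip: r_def) (simp add: power2_eq_square)
      finally show "avg {j} (V U (avg {j} p)) = V U (avg {j} p)" .
    qed
    have Va: "avg {j} (V U a) = V U a" "avg {j} (V U d) = V U d"
      using invV insert.prems by (simp_all add: a_def d_def)
    have Vn: "V U p x \<ge> 0" for p x unfolding V_def by (rule avg_nonneg) simp
    have "avg (insert j A) (\<lambda>x. V U a x * V U d x) x + avg (insert j A) (\<lambda>x. V U a x * V U e x) x
      + avg (insert j A) (\<lambda>x. V U d x * V U b x) x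
      = avg (insert j A) (\<lambda>x. V U a x * V U d x + V U a x * avg {j} (V U e) x + V U d x * avg {j} (V U b) x) x"
      using Va by (simp add: avg_add ins(1) avg_invariant_mult avg_avg)
    \<comment> \<open>The three terms lack one nonnegative summand of the expanded product, which is
      added here.\<close>
    also have "\<dots> \<le> avg (insert j A) (\<lambda>x. (V U a x + avg {j} (V U b) x) * (V U d x + avg {j} (V U e) x)) x"
    proof (intro avg_mono)
      fix x
      have "0 \<le> avg {j} (V U b) x * avg {j} (V U e) x" by (intro mult_nonneg_nonneg avg_nonneg Vn)
      thus "V U a x * V U d x + V U a x * avg {j} (V U e) x + V U d x * avg {j} (V U b) x
        \<le> (V U a x + avg {j} (V U b) x) * (V U d x + avg {j} (V U e) x)"
        by (simp add: algebra_simps)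
    qed auto
    finally show "avg (insert j A) (\<lambda>x. V U a x * V U d x) x + avg (insert j A) (\<lambda>x. V U a x * V U e x) x
      + avg (insert j A) (\<lambda>x. V U d x * V U b x) x + avg (insert j A) (\<lambda>x. V U b x * V U e x) x
      \<le> avg (insert j A) (\<lambda>x. avg (insert j A - U) (\<lambda>x. (proj U \<phi> x)\<^sup>2) x * avg (insert j A - U) (\<lambda>x. (proj U \<psi> x)\<^sup>2) x) x
     + avg (insert j A) (\<lambda>x. avg (insert j A - insert j U) (\<lambda>x. (proj (insert j U) \<phi> x)\<^sup>2) x *
            avg (insert j A - insert j U) (\<lambda>x. (proj (insert j U) \<psi> x)\<^sup>2) x) x"
      unfolding W[OF insert.prems(1)] W[OF insert.prems(2)] W'[OF insert.prems(1)] W'[OF insert.prems(2)]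
      by (simp add: a_def b_def d_def e_def)
  qed
  also have "\<dots> = (\<Sum>U\<in>Pow (insert j A). avg (insert j A) (\<lambda>x. avg (insert j A - U) (\<lambda>x. (proj U \<phi> x)\<^sup>2) x * avg (insert j A - U) (\<lambda>x. (proj U \<psi> x)\<^sup>2) x) x)"
    using insert.hyps by (simp add: sum_Pow_insert)
  finally show ?case .
qed simp

subsection \<open>The Efron--Stein decomposition\<close>

lemma finite_subset_I: "S \<subseteq> I \<Longrightarrow> finite S"
  by (rule finite_subset[OF _ finite_I])

lemma finite_family: "F \<subseteq> Pow I \<Longrightarrow> finite F"
  by (rule finite_subset[OF _ finite_Pow_iff[THEN iffD2, OF finite_I]])

lemma obtain_point: obtains x where "x \<in> space P"
  using P.not_empty by blast

lemma integral_avg: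
  assumes "bdd \<phi>" shows "(\<integral>x. avg A \<phi> x \<partial>P) = (\<integral>x. \<phi> x \<partial>P)"
proof -
  obtain x where x: "x \<in> space P" by (rule obtain_point)
  have "avg I (avg A \<phi>) x = avg I \<phi> x"
    using assms avg_commute[of \<phi> I A] avg_dep[of "avg I \<phi>" "{}" A] dep_avg_compl[of "{}" \<phi>]
    by simp
  thus ?thesis using x by (simp add: avg_I)
qed

text \<open>For \<open>S \<subseteq> I\<close> these are exactly the bounded functions equal to
  their own Efron--Stein component on \<open>S\<close>.\<close>

definition canonical :: "nat set \<Rightarrow> ((nat \<Rightarrow> 'a) \<Rightarrow> real) \<Rightarrow> bool" where
  "canonical S \<phi> \<longleftrightarrow> bdd \<phi> \<and> dep S \<phi> \<and> (\<forall>j\<in>S. avg {j} \<phi> = (\<lambda>x. 0))"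

lemma avg_singleton_dep: "bdd \<phi> \<Longrightarrow> dep S \<phi> \<Longrightarrow> j \<notin> S \<Longrightarrow> avg {j} \<phi> = \<phi>"
  by (rule avg_dep) auto

lemma canonical_orthogonal_aux:
  assumes "canonical S \<phi>" "canonical T \<psi>" "j \<in> S" "j \<notin> T" "j \<in> A"
  shows "avg A (\<lambda>x. \<phi> x * \<psi> x) = (\<lambda>x. 0)"
proof -
  have "avg {j} (\<lambda>x. \<psi> x * \<phi> x) = (\<lambda>x. 0)"
    using assms by (subst avg_invariant_mult) (auto simp: canonical_def intro!: avg_singleton_dep)
  moreover have "avg A (\<lambda>x. \<phi> x * \<psi> x) = avg A (avg {j} (\<lambda>x. \<psi> x * \<phi> x))"
    using assms by (simp add: avg_avg canonical_def mult.commute insert_absorb)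
  ultimately show ?thesis by simp
qed

text \<open>A coordinate in exactly one of \<open>S\<close> and \<open>T\<close> lies outside
  \<open>U\<close>, hence is averaged; one factor has mean zero in it and the other does not depend
  on it. Containment of \<open>U\<close> in both sets is what gives orthogonality already for fixed
  \<open>x_U\<close>.\<close>

lemma canonical_orthogonal:
  assumes "canonical S \<phi>" "canonical T \<psi>" "S \<noteq> T" "U \<subseteq> S" "U \<subseteq> T" "S \<subseteq> I" "T \<subseteq> I"
  shows "avg (I - U) (\<lambda>x. \<phi> x * \<psi> x) = (\<lambda>x. 0)"
proof -
  consider j where "j \<in> S" "j \<notin> T" | j where "j \<in> T" "j \<notin> S" using assms by blast
  thus ?thesis
  proof cases
    case 1
    thus ?thesis using assms by (intro canonical_orthogonal_aux[of S _ T _ j]) auto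
  next
    case 2
    hence "avg (I - U) (\<lambda>x. \<psi> x * \<phi> x) = (\<lambda>x. 0)"
      using assms by (intro canonical_orthogonal_aux[of T _ S _ j]) auto
    thus ?thesis by (simp add: mult.commute)
  qed
qed

lemma avg_canonical_sum_square:
  assumes "F \<subseteq> Pow I" "\<And>S. S \<in> F \<Longrightarrow> canonical S (g S)" "\<And>S. S \<in> F \<Longrightarrow> U \<subseteq> S"
  shows "avg (I - U) (\<lambda>x. (\<Sum>S\<in>F. g S x)\<^sup>2) = (\<lambda>x. \<Sum>S\<in>F. avg (I - U) (\<lambda>x. (g S x)\<^sup>2) x)"
proof
  fix x
  have F: "finite F" using assms(1) by (rule finite_family)
  have b: "bdd (g S)" if "S \<in> F" for S using assms(2)[OF that] by (simp add: canonical_def)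
  have "avg (I - U) (\<lambda>x. (\<Sum>S\<in>F. g S x)\<^sup>2) = avg (I - U) (\<lambda>x. \<Sum>S\<in>F. \<Sum>T\<in>F. g S x * g T x)"
    by (simp add: power2_eq_square sum_product)
  also have "\<dots> = (\<lambda>x. \<Sum>S\<in>F. \<Sum>T\<in>F. avg (I - U) (\<lambda>x. g S x * g T x) x)"
    using b by (simp add: avg_sum)
  finally have "avg (I - U) (\<lambda>x. (\<Sum>S\<in>F. g S x)\<^sup>2) x = (\<Sum>S\<in>F. \<Sum>T\<in>F. avg (I - U) (\<lambda>x. g S x * g T x) x)"
    by simp
  also have "\<dots> = (\<Sum>S\<in>F. \<Sum>T\<in>F. if S = T then avg (I - U) (\<lambda>x. (g S x)\<^sup>2) x else 0)"
  proof (intro sum.cong refl)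
    fix S T assume ST: "S \<in> F" "T \<in> F"
    show "avg (I - U) (\<lambda>x. g S x * g T x) x = (if S = T then avg (I - U) (\<lambda>x. (g S x)\<^sup>2) x else 0)"
    proof (cases "S = T")
      case False
      have "avg (I - U) (\<lambda>x. g S x * g T x) = (\<lambda>x. 0)"
        using assms(2,3)[OF ST(1)] assms(2,3)[OF ST(2)] assms(1) ST False
        by (intro canonical_orthogonal[of S _ T]) auto
      thus ?thesis using False by simp
    qed (simp add: power2_eq_square)
  qed
  also have "\<dots> = (\<Sum>S\<in>F. avg (I - U) (\<lambda>x. (g S x)\<^sup>2) x)" using F by simp
  finally show "avg (I - U) (\<lambda>x. (\<Sum>S\<in>F. g S x)\<^sup>2) x = (\<Sum>S\<in>F. avg (I - U) (\<lambda>x. (g S x)\<^sup>2) x)" .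
qed

lemma integral_canonical_sum_square:
  assumes "F \<subseteq> Pow I" "\<And>S. S \<in> F \<Longrightarrow> canonical S (g S)"
  shows "(\<integral>x. (\<Sum>S\<in>F. g S x)\<^sup>2 \<partial>P) = (\<Sum>S\<in>F. \<integral>x. (g S x)\<^sup>2 \<partial>P)"
proof -
  obtain x where x: "x \<in> space P" by (rule obtain_point)
  show ?thesis using fun_cong[OF avg_canonical_sum_square[of F g "{}"], of x] assms x
    by (simp add: avg_I)
qed

lemma canonical_proj:
  assumes "bdd \<phi>" "dep S \<phi>" "S \<subseteq> I" shows "canonical S (proj S \<phi>)"
  using assms finite_subset_I[of S] by (auto simp: canonical_def dep_mix avg_proj)

lemma proj_invariant:
  assumes "finite A" "j \<in> A" "bdd \<phi>" "avg {j} \<phi> = \<phi>"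
  shows "proj A \<phi> = (\<lambda>x. 0)"
proof -
  obtain S' where S': "A = insert j S'" "j \<notin> S'" using assms(2) mk_disjoint_insert by metis
  hence "finite S'" using assms(1) by simp
  thus ?thesis using S' assms(3,4) by (simp add: mix_insert avg_mix)
qed

lemma proj_canonical:
  assumes "canonical S \<phi>" "S \<subseteq> I" "U \<subseteq> I"
  shows "proj U \<phi> = (if U \<subseteq> S then \<phi> else (\<lambda>x. 0))"
proof -
  have fin: "finite U" using assms(3) by (rule finite_subset_I)
  show ?thesis
  proof (cases "U \<subseteq> S")
    case True
    thus ?thesis using assms fin by (subst mix_centred) (auto simp: canonical_def)
  next
    case False
    then obtain j where "j \<in> U" "j \<notin> S" by auto
    thus ?thesis using assms fin False
      by (subst proj_invariant[of _ j]) (auto simp: canonical_def intro!: avg_singleton_dep)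
  qed
qed

lemma noise_canonical:
  assumes "canonical S \<phi>" "S \<subseteq> I"
  shows "noise I \<phi> = (\<lambda>x. (1/2) ^ card S * \<phi> x)"
proof -
  have fin: "finite S" "finite (I - S)" using assms(2) by (auto intro: finite_subset_I)
  have "noise (S \<union> (I - S)) \<phi> = noise S (noise (I - S) \<phi>)"
    using assms fin by (intro mix_Un) (auto simp: canonical_def)
  also have "noise (I - S) \<phi> = \<phi>"
    using assms fin by (subst mix_invariant) (auto simp: canonical_def intro!: avg_singleton_dep)
  also have "noise S \<phi> = (\<lambda>x. (1/2) ^ card S * \<phi> x)"
    using assms fin by (intro mix_centred) (auto simp: canonical_def)
  finally show ?thesis using assms by (simp add: Un_absorb1)
qed

definition es :: "((nat \<Rightarrow> 'a) \<Rightarrow> real) \<Rightarrow> nat set \<Rightarrow> (nat \<Rightarrow> 'a) \<Rightarrow> real" where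
  "es \<phi> S = avg (I - S) (proj S \<phi>)"

lemma canonical_es:
  assumes "bdd \<phi>" "S \<subseteq> I" shows "canonical S (es \<phi> S)"
proof -
  have "es \<phi> S = proj S (avg (I - S) \<phi>)" using assms by (simp add: es_def avg_mix)
  thus ?thesis using assms by (simp add: canonical_proj dep_avg_compl)
qed

lemma bdd_es [simp, intro!]: "bdd \<phi> \<Longrightarrow> bdd (es \<phi> S)"
  by (simp add: es_def)

text \<open>The identity, written as the product of \<open>avg {j} + (1 - avg {j})\<close> over all
  coordinates, is expanded.\<close>

lemma efron_stein:
  assumes "bdd \<phi>" shows "(\<Sum>S\<in>Pow I. es \<phi> S x) = \<phi> x"
proof -
  have "(\<Sum>S\<in>Pow A. avg (A - S) (proj S \<phi>) x) = \<phi> x" if "finite A" for A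
    using that
  proof (induction A rule: finite_induct)
    case (insert j A)
    have "(\<Sum>S\<in>Pow (insert j A). avg (insert j A - S) (proj S \<phi>) x) = (\<Sum>S\<in>Pow A. avg (A - S) (proj S \<phi>) x)"
      unfolding sum_Pow_insert[OF insert.hyps]
    proof (intro sum.cong refl)
      fix S assume "S \<in> Pow A"
      hence S: "insert j A - S = insert j (A - S)" "insert j A - insert j S = A - S" "finite S" "j \<notin> S"
        using insert.hyps finite_subset by auto
      have "avg (insert j A - S) (proj S \<phi>) = avg (A - S) (avg {j} (proj S \<phi>))"
        using assms by (simp add: S avg_avg)
      thus "avg (insert j A - S) (proj S \<phi>) x + avg (insert j A - insert j S) (proj (insert j S) \<phi>) x
        = avg (A - S) (proj S \<phi>) x"
        using assms S by (simp add: mix_insert avg_diff)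
    qed
    thus ?case using insert.IH by simp
  qed (use assms in auto)
  thus ?thesis by (simp add: es_def)
qed

lemma proj_canonical_sum:
  assumes "F \<subseteq> Pow I" "\<And>S. S \<in> F \<Longrightarrow> canonical S (p S)" "U \<subseteq> I"
  shows "proj U (\<lambda>x. \<Sum>S\<in>F. c S * p S x) = (\<lambda>x. \<Sum>S\<in>{S\<in>F. U \<subseteq> S}. c S * p S x)"
proof
  fix x
  have F: "finite F" using assms(1) by (rule finite_family)
  have b: "bdd (p S)" if "S \<in> F" for S using assms(2)[OF that] by (simp add: canonical_def)
  have "proj U (\<lambda>x. \<Sum>S\<in>F. c S * p S x) x = (\<Sum>S\<in>F. c S * proj U (p S) x)"
    using b by (simp add: mix_sum mix_cmult)
  also have "\<dots> = (\<Sum>S\<in>F. if U \<subseteq> S then c S * p S x else 0)"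
  proof (intro sum.cong refl)
    fix S assume S: "S \<in> F"
    have "proj U (p S) = (if U \<subseteq> S then p S else (\<lambda>x. 0))"
      using assms S by (intro proj_canonical) auto
    thus "c S * proj U (p S) x = (if U \<subseteq> S then c S * p S x else 0)" by simp
  qed
  also have "\<dots> = (\<Sum>S\<in>{S\<in>F. U \<subseteq> S}. c S * p S x)" using F by (simp add: sum.inter_filter)
  finally show "proj U (\<lambda>x. \<Sum>S\<in>F. c S * p S x) x = (\<Sum>S\<in>{S\<in>F. U \<subseteq> S}. c S * p S x)" .
qed

lemma sum_swap_subsets:
  fixes h :: "nat set \<Rightarrow> nat set \<Rightarrow> real"
  assumes "F \<subseteq> Pow I"
  shows "(\<Sum>U\<in>Pow I. \<Sum>S\<in>{S\<in>F. U \<subseteq> S}. h U S) = (\<Sum>S\<in>F. \<Sum>U\<in>Pow S. h U S)"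
proof -
  have F: "finite F" using assms(1) by (rule finite_family)
  have "(\<Sum>U\<in>Pow I. \<Sum>S\<in>{S\<in>F. U \<subseteq> S}. h U S) = (\<Sum>S\<in>F. \<Sum>U\<in>{U\<in>Pow I. U \<subseteq> S}. h U S)"
    using F by (intro sum.swap_restrict) auto
  also have "\<dots> = (\<Sum>S\<in>F. \<Sum>U\<in>Pow S. h U S)"
    using assms by (intro sum.cong refl) auto
  finally show ?thesis .
qed

text \<open>Hypercontractivity is applied to the function with components enlarged by
  \<open>2 ^ card S\<close>, which \<open>noise\<close> turns into \<open>\<psi>\<close>. In each
  squared energy one factor is bounded by its supremum, giving \<open>64 ^ m * \<kappa>\<close>, and
  the other is integrated and summed, giving \<open>32 ^ m\<close>.\<close>

lemma fourth_moment:
  fixes F m g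
  defines "\<psi> \<equiv> (\<lambda>x. \<Sum>S\<in>F. proj S (g S) x)"
  assumes F: "F \<subseteq> Pow I" "\<And>S. S \<in> F \<Longrightarrow> card S \<le> m"
    and g: "\<And>S. S \<in> F \<Longrightarrow> bdd (g S)" "\<And>S. S \<in> F \<Longrightarrow> dep S (g S)"
    and \<kappa>: "\<And>U x. U \<subseteq> I \<Longrightarrow> x \<in> space P \<Longrightarrow> (\<Sum>S\<in>{S\<in>F. U \<subseteq> S}. avg (I - U) (\<lambda>x. (g S x)\<^sup>2) x) \<le> \<kappa>" "0 \<le> \<kappa>"
  shows "(\<integral>x. \<psi> x ^ 4 \<partial>P) \<le> 2048 ^ m * \<kappa> * (\<Sum>S\<in>F. \<integral>x. (g S x)\<^sup>2 \<partial>P)"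
proof -
  have finF: "finite F" using F(1) by (rule finite_family)
  have finS: "finite S" if "S \<in> F" for S using F(1) that finite_subset_I by auto
  define p where "p = (\<lambda>S. proj S (g S))"
  have can: "canonical S (p S)" if "S \<in> F" for S
    using that F g unfolding p_def by (intro canonical_proj) auto
  have pb [simp]: "bdd (p S)" if "S \<in> F" for S using can[OF that] by (simp add: canonical_def)
  define \<psi>' where "\<psi>' = (\<lambda>x. \<Sum>S\<in>F. 2 ^ card S * p S x)"
  have b': "bdd \<psi>'" unfolding \<psi>'_def by auto
  have "noise I \<psi>' = (\<lambda>x. \<Sum>S\<in>F. 2 ^ card S * noise I (p S) x)"
    unfolding \<psi>'_def by (simp add: mix_sum mix_cmult)
  also have "\<dots> = \<psi>"
  proof
    fix x
    show "(\<Sum>S\<in>F. 2 ^ card S * noise I (p S) x) = \<psi> x"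
      unfolding \<psi>_def
    proof (intro sum.cong refl)
      fix S assume S: "S \<in> F"
      have "noise I (p S) = (\<lambda>x. (1/2) ^ card S * p S x)"
        using can[OF S] F(1) S by (intro noise_canonical) auto
      thus "2 ^ card S * noise I (p S) x = proj S (g S) x" by (simp add: power_divide p_def)
    qed
  qed
  finally have noise: "noise I \<psi>' = \<psi>" .
  define h where "h = (\<lambda>U. avg (I - U) (\<lambda>x. (proj U \<psi>' x)\<^sup>2))"
  have hb [simp]: "bdd (h U)" for U unfolding h_def using b' by auto
  have hn: "0 \<le> h U x" for U x unfolding h_def by (rule avg_nonneg) auto
  have h: "h U x = (\<Sum>S\<in>{S\<in>F. U \<subseteq> S}. 4 ^ card S * avg (I - U) (\<lambda>x. (p S x)\<^sup>2) x)" if U: "U \<subseteq> I" for U x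
  proof -
    have "h U = avg (I - U) (\<lambda>x. (\<Sum>S\<in>{S\<in>F. U \<subseteq> S}. 2 ^ card S * p S x)\<^sup>2)"
      unfolding h_def \<psi>'_def using F can U by (simp add: proj_canonical_sum)
    also have "\<dots> = (\<lambda>x. \<Sum>S\<in>{S\<in>F. U \<subseteq> S}. avg (I - U) (\<lambda>x. (2 ^ card S * p S x)\<^sup>2) x)"
    proof (rule avg_canonical_sum_square)
      show "{S \<in> F. U \<subseteq> S} \<subseteq> Pow I" using F by auto
      fix S assume "S \<in> {S \<in> F. U \<subseteq> S}"
      thus "U \<subseteq> S" "canonical S (\<lambda>x. 2 ^ card S * p S x)"
        using can[of S] by (auto simp: canonical_def avg_cmult dep_cmult)
    qed
    finally have "h U = (\<lambda>x. \<Sum>S\<in>{S\<in>F. U \<subseteq> S}. avg (I - U) (\<lambda>x. (2 ^ card S * p S x)\<^sup>2) x)" .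
    moreover have "((2::real) ^ k)\<^sup>2 = 4 ^ k" for k
      by (simp add: power2_eq_square flip: power_mult_distrib)
    ultimately show ?thesis by (simp add: power_mult_distrib avg_cmult)
  qed
  have psq: "avg A (\<lambda>x. (p S x)\<^sup>2) x \<le> avg A (mix 2 2 S (\<lambda>x. (g S x)\<^sup>2)) x" if "S \<in> F" for S A x
    using that g finS unfolding p_def by (intro avg_mono proj_square_le) auto
  \<comment> \<open>Three factors \<open>4 ^ m\<close>: the squared enlargement, the recentring in
    \<open>S - U\<close>, and the recentring in \<open>U\<close>. For the last,
    \<open>\<kappa>\<close> must be a bound at every point, because \<open>mix 2 2 U\<close> moves
    \<open>x_U\<close>.\<close>
  have hsup: "h U x \<le> 64 ^ m * \<kappa>" if U: "U \<subseteq> I" for U x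
  proof (cases "{S\<in>F. U \<subseteq> S} = {}")
    case True
    thus ?thesis using U \<kappa>(2) by (simp only: h sum.empty) simp
  next
    case False
    then obtain S0 where "S0 \<in> F" "U \<subseteq> S0" by auto
    hence cU: "card U \<le> m" and finU: "finite U" using F(2)[of S0] finS[of S0] card_mono[of S0 U] finite_subset[of U S0] by auto
    define \<gamma> where "\<gamma> = (\<lambda>S. avg (I - U) (\<lambda>x. (g S x)\<^sup>2))"
    have \<gamma>b [simp]: "bdd (\<gamma> S)" if "S \<in> F" for S using g that by (auto simp: \<gamma>_def)
    have "h U x \<le> (\<Sum>S\<in>{S\<in>F. U \<subseteq> S}. 4 ^ m * (4 ^ m * mix 2 2 U (\<gamma> S) x))"
      unfolding h[OF U]
    proof (intro sum_mono mult_mono)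
      fix S assume S: "S \<in> {S \<in> F. U \<subseteq> S}"
      hence fS: "finite S" "finite (S - U)" "S \<in> F" "S \<subseteq> I" using finS F by auto
      have "avg (I - U) (\<lambda>x. (p S x)\<^sup>2) x \<le> mix 2 2 S (\<gamma> S) x"
        using psq[of S "I - U" x] S g by (simp add: avg_mix \<gamma>_def)
      also have "mix 2 2 S (\<gamma> S) = mix 2 2 (U \<union> (S - U)) (\<gamma> S)" using S by (simp add: Un_absorb1)
      also have "\<dots> = mix 2 2 U (mix 2 2 (S - U) (\<gamma> S))" using fS finU by (intro mix_Un) auto
      also have "mix 2 2 (S - U) (\<gamma> S) = (\<lambda>x. (2 + 2) ^ card (S - U) * \<gamma> S x)"
        using fS g by (intro mix_invariant) (auto simp: \<gamma>_def avg_avg insert_absorb)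
      also have "mix 2 2 U \<dots> = (\<lambda>x. (2 + 2) ^ card (S - U) * mix 2 2 U (\<gamma> S) x)" by (rule mix_cmult)
      also have "\<dots> x \<le> 4 ^ m * mix 2 2 U (\<gamma> S) x"
      proof (intro mult_right_mono)
        have "card (S - U) \<le> m" using F(2)[OF fS(3)] card_mono[OF fS(1), of "S - U"] by auto
        thus "(2 + 2) ^ card (S - U) \<le> (4::real) ^ m" by (simp add: power_increasing)
        show "0 \<le> mix 2 2 U (\<gamma> S) x" unfolding mix_def
          by (intro sum_nonneg mult_nonneg_nonneg avg_nonneg) (auto simp: \<gamma>_def intro!: avg_nonneg)
      qed
      finally show "avg (I - U) (\<lambda>x. (p S x)\<^sup>2) x \<le> 4 ^ m * mix 2 2 U (\<gamma> S) x" .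
      show "(4::real) ^ card S \<le> 4 ^ m" using F(2)[OF fS(3)] by (simp add: power_increasing)
      show "0 \<le> avg (I - U) (\<lambda>x. (p S x)\<^sup>2) x" by (rule avg_nonneg) simp
    qed simp
    also have "\<dots> = 16 ^ m * mix 2 2 U (\<lambda>x. \<Sum>S\<in>{S\<in>F. U \<subseteq> S}. \<gamma> S x) x"
      by (subst mix_sum) (auto simp: sum_distrib_left mult.assoc[symmetric] simp flip: power_mult_distrib)
    also have "\<dots> \<le> 16 ^ m * ((2 + 2) ^ card U * \<kappa>)"
      using finU U \<kappa> by (intro mult_left_mono mix_le_const) (auto simp: \<gamma>_def intro!: bdd_sum bdd_avg bdd_power g)
    also have "\<dots> \<le> 16 ^ m * (4 ^ m * \<kappa>)"
      using cU \<kappa> by (intro mult_left_mono mult_right_mono) (auto simp: power_increasing)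
    also have "\<dots> = 64 ^ m * \<kappa>" by (simp add: mult.assoc[symmetric] flip: power_mult_distrib)
    finally show ?thesis .
  qed
  obtain x where x: "x \<in> space P" by (rule obtain_point)
  have "(\<integral>x. \<psi> x ^ 4 \<partial>P) = avg I (\<lambda>x. (noise I \<psi>' x)\<^sup>2 * (noise I \<psi>' x)\<^sup>2) x"
    using x by (simp add: avg_I noise flip: power_add)
  also have "\<dots> \<le> (\<Sum>U\<in>Pow I. avg I (\<lambda>x. h U x * h U x) x)"
    unfolding h_def by (rule noise_hypercontractive) (auto intro: b')
  also have "\<dots> = (\<Sum>U\<in>Pow I. \<integral>x. h U x * h U x \<partial>P)" using x by (simp add: avg_I)
  also have "\<dots> \<le> (\<Sum>U\<in>Pow I. \<integral>x. (64 ^ m * \<kappa>) * h U x \<partial>P)"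
    by (intro sum_mono integral_mono integrable_bdd mult_right_mono hn hsup) auto
  also have "\<dots> = 64 ^ m * \<kappa> * (\<Sum>U\<in>Pow I. \<integral>x. h U x \<partial>P)"
    by (simp add: sum_distrib_left)
  also have "(\<Sum>U\<in>Pow I. \<integral>x. h U x \<partial>P) = (\<Sum>U\<in>Pow I. \<Sum>S\<in>{S\<in>F. U \<subseteq> S}. 4 ^ card S * (\<integral>x. (p S x)\<^sup>2 \<partial>P))"
  proof (intro sum.cong refl)
    fix U assume U: "U \<in> Pow I"
    have "(\<integral>x. h U x \<partial>P) = (\<integral>x. (\<Sum>S\<in>{S\<in>F. U \<subseteq> S}. 4 ^ card S * avg (I - U) (\<lambda>x. (p S x)\<^sup>2) x) \<partial>P)"
      using U by (intro Bochner_Integration.integral_cong refl) (auto simp: h)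
    also have "\<dots> = (\<Sum>S\<in>{S\<in>F. U \<subseteq> S}. \<integral>x. 4 ^ card S * avg (I - U) (\<lambda>x. (p S x)\<^sup>2) x \<partial>P)"
      by (intro Bochner_Integration.integral_sum integrable_bdd) auto
    also have "\<dots> = (\<Sum>S\<in>{S\<in>F. U \<subseteq> S}. 4 ^ card S * (\<integral>x. (p S x)\<^sup>2 \<partial>P))"
      by (intro sum.cong refl) (auto simp: integral_avg)
    finally show "(\<integral>x. h U x \<partial>P) = (\<Sum>S\<in>{S\<in>F. U \<subseteq> S}. 4 ^ card S * (\<integral>x. (p S x)\<^sup>2 \<partial>P))" .
  qed
  \<comment> \<open>Each \<open>S\<close> is counted for its \<open>2 ^ card S\<close> subsets
    \<open>U\<close>; with the squared enlargement and the recentring this makes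
    \<open>32 ^ m\<close>.\<close>
  also have "\<dots> = (\<Sum>S\<in>F. 2 ^ card S * (4 ^ card S * (\<integral>x. (p S x)\<^sup>2 \<partial>P)))"
    using finS F by (subst sum_swap_subsets) (auto simp: card_Pow)
  also have "\<dots> \<le> (\<Sum>S\<in>F. 2 ^ m * (4 ^ m * (4 ^ m * (\<integral>x. (g S x)\<^sup>2 \<partial>P))))"
  proof (intro sum_mono mult_mono)
    fix S assume S: "S \<in> F"
    have "(\<integral>x. (p S x)\<^sup>2 \<partial>P) \<le> avg I (mix 2 2 S (\<lambda>x. (g S x)\<^sup>2)) x"
      using psq[OF S, of I x] x by (simp add: avg_I)
    also have "avg I (mix 2 2 S (\<lambda>x. (g S x)\<^sup>2)) = mix 2 2 S (avg I (\<lambda>x. (g S x)\<^sup>2))"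
      using S g by (simp add: avg_mix)
    also have "\<dots> = (\<lambda>x. (2 + 2) ^ card S * avg I (\<lambda>x. (g S x)\<^sup>2) x)"
    proof (rule mix_invariant)
      fix j assume "j \<in> S"
      hence "insert j I = I" using S F by auto
      thus "avg {j} (avg I (\<lambda>x. (g S x)\<^sup>2)) = avg I (\<lambda>x. (g S x)\<^sup>2)" using S g by (simp add: avg_avg)
    qed (use S g finS in auto)
    also have "\<dots> x = 4 ^ card S * (\<integral>x. (g S x)\<^sup>2 \<partial>P)" using x by (simp add: avg_I)
    also have "\<dots> \<le> 4 ^ m * (\<integral>x. (g S x)\<^sup>2 \<partial>P)"
      using F(2)[OF S] by (intro mult_right_mono) (auto simp: power_increasing)
    finally show "(\<integral>x. (p S x)\<^sup>2 \<partial>P) \<le> 4 ^ m * (\<integral>x. (g S x)\<^sup>2 \<partial>P)" .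
  qed (use F in \<open>auto simp: power_increasing\<close>)
  also have "\<dots> = 32 ^ m * (\<Sum>S\<in>F. \<integral>x. (g S x)\<^sup>2 \<partial>P)"
    by (simp add: sum_distrib_left mult.assoc[symmetric] flip: power_mult_distrib)
  finally have "(\<integral>x. \<psi> x ^ 4 \<partial>P) \<le> 64 ^ m * \<kappa> * (32 ^ m * (\<Sum>S\<in>F. \<integral>x. (g S x)\<^sup>2 \<partial>P))"
    using \<kappa> by (auto simp: mult_left_mono)
  also have "\<dots> = (64 * 32) ^ m * \<kappa> * (\<Sum>S\<in>F. \<integral>x. (g S x)\<^sup>2 \<partial>P)" by (simp only: power_mult_distrib mult_ac)
  finally show ?thesis by simp
qed

section \<open>Self-adjointness of the averaging operators\<close>

lemma integral_avg_swap:
  assumes "bdd \<phi>" "bdd \<psi>"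
  shows "(\<integral>x. \<phi> x * avg A \<psi> x \<partial>P) = (\<integral>x. avg A \<phi> x * \<psi> x \<partial>P)"
proof -
  have *: "(\<integral>x. \<phi> x * avg A \<psi> x \<partial>P) = (\<integral>x. avg A \<phi> x * avg A \<psi> x \<partial>P)"
    if "bdd \<phi>" "bdd \<psi>" for \<phi> \<psi>
  proof -
    have "(\<integral>x. \<phi> x * avg A \<psi> x \<partial>P) = (\<integral>x. avg A (\<lambda>x. avg A \<psi> x * \<phi> x) x \<partial>P)"
      using that by (simp add: integral_avg mult.commute)
    also have "avg A (\<lambda>x. avg A \<psi> x * \<phi> x) = (\<lambda>x. avg A \<psi> x * avg A \<phi> x)"
      by (rule avg_dep_mult[OF dep_avg[OF dep_I]]) auto
    finally show ?thesis by (simp add: mult.commute)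
  qed
  show ?thesis using *[OF assms] *[OF assms(2,1)] by (simp add: mult.commute)
qed

lemma integral_mix_swap:
  assumes "bdd \<phi>" "bdd \<psi>"
  shows "(\<integral>x. \<phi> x * mix c d A \<psi> x \<partial>P) = (\<integral>x. mix c d A \<phi> x * \<psi> x \<partial>P)"
proof -
  let ?k = "\<lambda>T. c ^ card (A - T) * d ^ card T"
  have "(\<integral>x. \<phi> x * mix c d A \<psi> x \<partial>P) = (\<integral>x. (\<Sum>T\<in>Pow A. ?k T * (\<phi> x * avg T \<psi> x)) \<partial>P)"
    by (simp add: mix_def sum_distrib_left mult_ac)
  also have "\<dots> = (\<Sum>T\<in>Pow A. ?k T * (\<integral>x. \<phi> x * avg T \<psi> x \<partial>P))"
    using assms by (subst Bochner_Integration.integral_sum) (auto intro!: integrable_bdd)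
  also have "\<dots> = (\<Sum>T\<in>Pow A. ?k T * (\<integral>x. avg T \<phi> x * \<psi> x \<partial>P))"
    using assms by (simp add: integral_avg_swap)
  also have "\<dots> = (\<integral>x. (\<Sum>T\<in>Pow A. ?k T * (avg T \<phi> x * \<psi> x)) \<partial>P)"
    using assms by (subst Bochner_Integration.integral_sum) (auto intro!: integrable_bdd)
  also have "\<dots> = (\<integral>x. mix c d A \<phi> x * \<psi> x \<partial>P)"
    by (simp add: mix_def sum_distrib_right) (simp add: mult_ac)
  finally show ?thesis .
qed

text \<open>\<open>proj S\<close> is self-adjoint, and integrating against a function of
  \<open>x_S\<close> averages the other coordinates. Thus a recentred function of \<open>x_S\<close>
  is correlated only with the component on \<open>S\<close>.\<close>

lemma integral_proj_es:
  assumes "bdd \<phi>" "bdd \<psi>" "dep S \<psi>"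
  shows "(\<integral>x. \<phi> x * proj S \<psi> x \<partial>P) = (\<integral>x. es \<phi> S x * \<psi> x \<partial>P)"
proof -
  have "(\<integral>x. \<phi> x * proj S \<psi> x \<partial>P) = (\<integral>x. avg (I - S) (\<lambda>x. \<psi> x * proj S \<phi> x) x \<partial>P)"
    using assms by (subst integral_mix_swap) (auto simp: integral_avg mult.commute)
  also have "avg (I - S) (\<lambda>x. \<psi> x * proj S \<phi> x) = (\<lambda>x. \<psi> x * es \<phi> S x)"
    unfolding es_def by (rule avg_dep_mult[OF assms(3)]) auto
  finally show ?thesis by (simp add: mult.commute)
qed

lemma dep_es: "bdd \<phi> \<Longrightarrow> S \<subseteq> I \<Longrightarrow> dep S (es \<phi> S)"
  using canonical_es[of \<phi> S] by (simp add: canonical_def)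

subsection \<open>Truncation of families of local functions\<close>

text \<open>Each factor \<open>1 - avg {j}\<close> is an orthogonal projection, hence an L2
  contraction.\<close>

lemma integral_proj_square_le:
  assumes "finite A" "bdd \<phi>" shows "(\<integral>x. (proj A \<phi> x)\<^sup>2 \<partial>P) \<le> (\<integral>x. (\<phi> x)\<^sup>2 \<partial>P)"
  using assms(1)
proof (induction A rule: finite_induct)
  case (insert j A)
  define p where "p = proj A \<phi>"
  have p: "bdd p" using assms by (simp add: p_def)
  have "(\<integral>x. (proj (insert j A) \<phi> x)\<^sup>2 \<partial>P) = (\<integral>x. (p x)\<^sup>2 - 2 * (p x * avg {j} p x) + avg {j} p x * avg {j} p x \<partial>P)"
    using insert assms by (simp add: mix_insert p_def power2_eq_square algebra_simps)
  also have "\<dots> = (\<integral>x. (p x)\<^sup>2 \<partial>P) - 2 * (\<integral>x. p x * avg {j} p x \<partial>P) + (\<integral>x. p x * avg {j} (avg {j} p) x \<partial>P)"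
    using p integral_avg_swap[of p "avg {j} p" "{j}"] by (simp add: integrable_bdd)
  also have "\<dots> = (\<integral>x. (p x)\<^sup>2 \<partial>P) - (\<integral>x. avg {j} p x * avg {j} p x \<partial>P)"
    using p integral_avg_swap[of p "avg {j} p" "{j}"] by (simp add: avg_avg)
  also have "\<dots> \<le> (\<integral>x. (p x)\<^sup>2 \<partial>P)" by (simp add: integral_nonneg_AE)
  also have "\<dots> \<le> (\<integral>x. (\<phi> x)\<^sup>2 \<partial>P)" using insert.IH by (simp add: p_def)
  finally show ?case .
qed (use assms in simp)

lemma integral_proj_sum_square_le:
  assumes "F \<subseteq> Pow I" "\<And>S. S \<in> F \<Longrightarrow> bdd (g S)" "\<And>S. S \<in> F \<Longrightarrow> dep S (g S)"
  shows "(\<integral>x. (\<Sum>S\<in>F. proj S (g S) x)\<^sup>2 \<partial>P) \<le> (\<Sum>S\<in>F. \<integral>x. (g S x)\<^sup>2 \<partial>P)"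
proof -
  have "(\<integral>x. (\<Sum>S\<in>F. proj S (g S) x)\<^sup>2 \<partial>P) = (\<Sum>S\<in>F. \<integral>x. (proj S (g S) x)\<^sup>2 \<partial>P)"
    using assms by (intro integral_canonical_sum_square canonical_proj) auto
  also have "\<dots> \<le> (\<Sum>S\<in>F. \<integral>x. (g S x)\<^sup>2 \<partial>P)"
    using assms by (intro sum_mono integral_proj_square_le) (auto intro: finite_subset_I)
  finally show ?thesis .
qed

lemma abs_avg_le:
  assumes "bdd \<phi>" shows "\<bar>avg A \<phi> x\<bar> \<le> avg A (\<lambda>x. \<bar>\<phi> x\<bar>) x"
proof -
  have "avg A \<phi> x \<le> avg A (\<lambda>x. \<bar>\<phi> x\<bar>) x" "avg A (\<lambda>x. - \<phi> x) x \<le> avg A (\<lambda>x. \<bar>\<phi> x\<bar>) x"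
    using assms by (auto intro!: avg_mono)
  thus ?thesis unfolding avg_uminus by linarith
qed

lemma integral_abs_avg_le:
  assumes "bdd \<phi>" shows "(\<integral>x. \<bar>avg A \<phi> x\<bar> \<partial>P) \<le> (\<integral>x. \<bar>\<phi> x\<bar> \<partial>P)"
proof -
  have "(\<integral>x. \<bar>avg A \<phi> x\<bar> \<partial>P) \<le> (\<integral>x. avg A (\<lambda>x. \<bar>\<phi> x\<bar>) x \<partial>P)"
    using assms by (intro integral_mono integrable_bdd abs_avg_le) auto
  thus ?thesis using assms by (simp add: integral_avg)
qed

text \<open>Expanding \<open>proj S (q S)\<close> by inclusion--exclusion gives signed averages
  \<open>avg (S - V) (q S)\<close>, each a function of \<open>x_V\<close>; here those belonging to
  the same \<open>V\<close> are collected.\<close>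

definition redist :: "nat set set \<Rightarrow> (nat set \<Rightarrow> (nat \<Rightarrow> 'a) \<Rightarrow> real) \<Rightarrow> nat set \<Rightarrow> (nat \<Rightarrow> 'a) \<Rightarrow> real" where
  "redist F q V x = (\<Sum>S\<in>{S\<in>F. V \<subseteq> S}. (-1) ^ card (S - V) * avg (S - V) (q S) x)"

context
  fixes F :: "nat set set" and q :: "nat set \<Rightarrow> (nat \<Rightarrow> 'a) \<Rightarrow> real"
  assumes F: "F \<subseteq> Pow I" and q: "\<And>S. S \<in> F \<Longrightarrow> bdd (q S)" "\<And>S. S \<in> F \<Longrightarrow> dep S (q S)"
begin

lemma bdd_redist: "bdd (redist F q V)"
  unfolding redist_def[abs_def] using q by auto

lemma dep_redist: "dep V (redist F q V)"
  unfolding redist_def[abs_def]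
proof (intro dep_sum dep_cmult)
  fix S assume "S \<in> {S \<in> F. V \<subseteq> S}"
  thus "dep V (avg (S - V) (q S))" using dep_avg[OF q(2), of S "S - V"] by (simp add: double_diff)
qed

lemma sum_redist: "(\<Sum>V\<in>Pow I. redist F q V x) = (\<Sum>S\<in>F. proj S (q S) x)"
proof -
  have "(\<Sum>V\<in>Pow I. redist F q V x) = (\<Sum>S\<in>F. \<Sum>V\<in>Pow S. (-1) ^ card (S - V) * avg (S - V) (q S) x)"
    unfolding redist_def by (rule sum_swap_subsets[OF F])
  also have "\<dots> = (\<Sum>S\<in>F. proj S (q S) x)"
  proof (intro sum.cong refl)
    fix S :: "nat set"
    have "bij_betw (\<lambda>V. S - V) (Pow S) (Pow S)"
      by (rule bij_betwI[where g = "\<lambda>V. S - V"]) auto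
    hence "(\<Sum>V\<in>Pow S. (-1) ^ card (S - V) * avg (S - V) (q S) x) = (\<Sum>T\<in>Pow S. (-1) ^ card T * avg T (q S) x)"
      by (rule sum.reindex_bij_betw)
    thus "(\<Sum>V\<in>Pow S. (-1) ^ card (S - V) * avg (S - V) (q S) x) = proj S (q S) x"
      by (simp add: mix_def)
  qed
  finally show ?thesis .
qed

text \<open>Averaging contracts L1, and \<open>S\<close> contributes to its
  \<open>2 ^ card S\<close> subsets.\<close>

lemma redist_total: "(\<Sum>V\<in>Pow I. \<integral>x. \<bar>redist F q V x\<bar> \<partial>P) \<le> (\<Sum>S\<in>F. 2 ^ card S * (\<integral>x. \<bar>q S x\<bar> \<partial>P))"
proof -
  have "(\<Sum>V\<in>Pow I. \<integral>x. \<bar>redist F q V x\<bar> \<partial>P) \<le> (\<Sum>V\<in>Pow I. \<Sum>S\<in>{S\<in>F. V \<subseteq> S}. \<integral>x. \<bar>q S x\<bar> \<partial>P)"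
  proof (rule sum_mono)
    fix V
    have "(\<integral>x. \<bar>redist F q V x\<bar> \<partial>P) \<le> (\<integral>x. (\<Sum>S\<in>{S\<in>F. V \<subseteq> S}. \<bar>avg (S - V) (q S) x\<bar>) \<partial>P)"
    proof (intro integral_mono integrable_bdd bdd_abs bdd_redist)
      show "\<bar>redist F q V x\<bar> \<le> (\<Sum>S\<in>{S\<in>F. V \<subseteq> S}. \<bar>avg (S - V) (q S) x\<bar>)" for x
        unfolding redist_def by (rule order_trans[OF sum_abs]) (simp add: abs_mult)
    qed (use q in auto)
    also have "\<dots> = (\<Sum>S\<in>{S\<in>F. V \<subseteq> S}. \<integral>x. \<bar>avg (S - V) (q S) x\<bar> \<partial>P)"
      using q by (intro Bochner_Integration.integral_sum integrable_bdd) auto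
    also have "\<dots> \<le> (\<Sum>S\<in>{S\<in>F. V \<subseteq> S}. \<integral>x. \<bar>q S x\<bar> \<partial>P)"
      using q by (intro sum_mono integral_abs_avg_le) auto
    finally show "(\<integral>x. \<bar>redist F q V x\<bar> \<partial>P) \<le> (\<Sum>S\<in>{S\<in>F. V \<subseteq> S}. \<integral>x. \<bar>q S x\<bar> \<partial>P)" .
  qed
  also have "\<dots> = (\<Sum>S\<in>F. \<Sum>V\<in>Pow S. \<integral>x. \<bar>q S x\<bar> \<partial>P)" by (rule sum_swap_subsets[OF F])
  also have "\<dots> = (\<Sum>S\<in>F. 2 ^ card S * (\<integral>x. \<bar>q S x\<bar> \<partial>P))"
    using F by (intro sum.cong refl) (auto simp: card_Pow finite_subset_I)
  finally show ?thesis .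
qed

end

definition local_family :: "(nat set \<Rightarrow> (nat \<Rightarrow> 'a) \<Rightarrow> real) \<Rightarrow> bool" where
  "local_family u \<longleftrightarrow> (\<forall>S\<in>Pow I. bdd (u S) \<and> dep S (u S))"

lemma local_familyD: "local_family u \<Longrightarrow> S \<subseteq> I \<Longrightarrow> bdd (u S)" "local_family u \<Longrightarrow> S \<subseteq> I \<Longrightarrow> dep S (u S)"
  unfolding local_family_def by auto

text \<open>Dominates the expected size of the union of all \<open>S\<close> with
  \<open>v S x \<noteq> 0\<close>, which becomes the junta set of \<open>v\<close>; a constant
  component on \<open>{}\<close> is free.\<close>

definition support_cost :: "(nat set \<Rightarrow> (nat \<Rightarrow> 'a) \<Rightarrow> real) \<Rightarrow> real" where
  "support_cost v = (\<Sum>S\<in>Pow I. real (card S) * measure P {x \<in> space P. v S x \<noteq> 0})"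

lemma sets_nonzero:
  assumes "bdd \<phi>" shows "{x \<in> space P. \<phi> x \<noteq> 0} \<in> sets P"
proof -
  have [measurable]: "\<phi> \<in> borel_measurable P" using assms by (rule bddD)
  show ?thesis by measurable
qed

text \<open>
  Truncating the components on sets of maximal size at height \<open>t\<close>: the large values are kept, and
  the small ones are, up to a sum of orthogonal functions with small norm, a combination of
  components on smaller sets.
\<close>

lemma truncation:
  assumes t: "0 < t" and "local_family u" "\<And>S. S \<subseteq> I \<Longrightarrow> r < card S \<Longrightarrow> u S = (\<lambda>x. 0)"
    and "(\<Sum>S\<in>Pow I. \<integral>x. \<bar>u S x\<bar> \<partial>P) \<le> B"
  shows "\<exists>v. local_family v \<and> support_cost v \<le> B / t * 2 ^ (r * (r + 3)) \<and>
    (\<integral>x. ((\<Sum>S\<in>Pow I. u S x) - (\<Sum>S\<in>Pow I. v S x))\<^sup>2 \<partial>P) \<le> t * B * 2 ^ (r * (r + 3))"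
  using assms(2-)
proof (induction r arbitrary: u B)
  \<comment> \<open>Only the component on \<open>{}\<close> can be nonzero, and keeping it costs
    nothing.\<close>
  case 0
  have "0 \<le> (\<Sum>S\<in>Pow I. \<integral>x. \<bar>u S x\<bar> \<partial>P)" by (intro sum_nonneg integral_nonneg_AE) auto
  hence B: "0 \<le> B" using 0(3) by linarith
  have "real (card S) * measure P {x \<in> space P. u S x \<noteq> 0} = 0" if "S \<in> Pow I" for S
    using 0(2)[of S] that by (cases "card S = 0") auto
  hence "support_cost u = 0" unfolding support_cost_def by (intro sum.neutral) auto
  thus ?case using 0(1) B t by (intro exI[of _ u]) auto
next
  case (Suc r)
  note ub = local_familyD(1)[OF Suc.prems(1)] and ud = local_familyD(2)[OF Suc.prems(1)]
  have un: "0 \<le> (\<integral>x. \<bar>u S x\<bar> \<partial>P)" for S by (intro integral_nonneg_AE) auto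
  have "0 \<le> (\<Sum>S\<in>Pow I. \<integral>x. \<bar>u S x\<bar> \<partial>P)" by (intro sum_nonneg un)
  hence B: "0 \<le> B" using Suc.prems(3) by linarith
  define top where "top = {S \<in> Pow I. card S = Suc r}"
  have top: "top \<subseteq> Pow I" "finite top" by (auto simp: top_def)
  have topS: "S \<subseteq> I" "finite S" "card S = Suc r" if "S \<in> top" for S
    using that by (auto simp: top_def finite_subset_I)
  have top_total: "(\<Sum>S\<in>top. \<integral>x. \<bar>u S x\<bar> \<partial>P) \<le> B"
  proof -
    have "(\<Sum>S\<in>top. \<integral>x. \<bar>u S x\<bar> \<partial>P) \<le> (\<Sum>S\<in>Pow I. \<integral>x. \<bar>u S x\<bar> \<partial>P)"
      using top un by (intro sum_mono2) auto
    thus ?thesis using Suc.prems(3) by linarith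
  qed
  define big where "big = (\<lambda>S x. u S x * of_bool (t \<le> \<bar>u S x\<bar>))"
  define w where "w = (\<lambda>S x. u S x * of_bool (\<not> t \<le> \<bar>u S x\<bar>))"
  have uw: "u S x = big S x + w S x" for S x by (simp add: big_def w_def)
  have big: "bdd (big S)" "dep S (big S)" and w: "bdd (w S)" "dep S (w S)" if "S \<subseteq> I" for S
  proof -
    have [measurable]: "u S \<in> borel_measurable P" using ub[OF that] bddD(1) by blast
    show "bdd (big S)" "bdd (w S)" unfolding big_def w_def
      by (intro bdd_of_bool_mult ub that; measurable)+
    show "dep S (big S)" "dep S (w S)" using ud[OF that] unfolding dep_def big_def w_def
      by (intro ballI impI arg_cong2[where f = times] arg_cong[where f = of_bool]; metis)+
  qed
  \<comment> \<open>Top sets are cleared, and the errors of recentring their small values are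
    charged to smaller sets, so the induction hypothesis applies.\<close>
  define u' where "u' = (\<lambda>V x. if V \<in> top then 0 else u V x - redist top w V x)"
  have red: "bdd (redist top w V)" "dep V (redist top w V)" for V
    using top w by (auto intro!: bdd_redist dep_redist)
  have u'L: "local_family u'"
    unfolding local_family_def
  proof
    fix S assume S: "S \<in> Pow I"
    show "bdd (u' S) \<and> dep S (u' S)"
    proof (cases "S \<in> top")
      case True
      thus ?thesis by (simp add: u'_def dep_zero)
    next
      case False
      have "dep S (\<lambda>x. u S x + (-1) * redist top w S x)"
        using S by (intro dep_add dep_cmult red ud) auto
      thus ?thesis using False S red ub by (auto simp: u'_def)
    qed
  qed
  \<comment> \<open>Top sets have equal size, so none contains another and a top set receives only
    its own \<open>w\<close>.\<close>
  have redist_top: "redist top w V x = w V x" if "V \<in> top" for V x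
  proof -
    have "S = V" if "S \<in> top" "V \<subseteq> S" for S
      using card_subset_eq[of S V] topS[OF that(1)] topS[OF \<open>V \<in> top\<close>] that(2) by simp
    hence "{S \<in> top. V \<subseteq> S} = {V}" using that by blast
    thus ?thesis using w topS[OF that] by (simp add: redist_def)
  qed
  have u'0: "u' S = (\<lambda>x. 0)" if S: "S \<subseteq> I" "r < card S" for S
  proof (cases "S \<in> top")
    case False
    hence c: "Suc r < card S" using S by (auto simp: top_def)
    have "\<not> S \<subseteq> T" if "T \<in> top" for T
      using card_mono[of T S] topS[OF that] c by auto
    hence "{T \<in> top. S \<subseteq> T} = {}" by blast
    hence "redist top w S x = 0" for x unfolding redist_def by (simp only: sum.empty)
    thus ?thesis using Suc.prems(2)[OF S(1) c] by (auto simp: u'_def)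
  qed (simp add: u'_def)
  \<comment> \<open>A level multiplies the total L1 norm by at most \<open>1 + 2 ^ Suc r\<close>;
    accumulated over all levels this makes the exponent quadratic.\<close>
  have u'B: "(\<Sum>S\<in>Pow I. \<integral>x. \<bar>u' S x\<bar> \<partial>P) \<le> 2 ^ (r + 2) * B"
  proof -
    have "(\<Sum>S\<in>Pow I. \<integral>x. \<bar>u' S x\<bar> \<partial>P) \<le> (\<Sum>S\<in>Pow I. (\<integral>x. \<bar>u S x\<bar> \<partial>P) + (\<integral>x. \<bar>redist top w S x\<bar> \<partial>P))"
    proof (rule sum_mono)
      fix S assume S: "S \<in> Pow I"
      have "(\<integral>x. \<bar>u' S x\<bar> \<partial>P) \<le> (\<integral>x. \<bar>u S x\<bar> + \<bar>redist top w S x\<bar> \<partial>P)"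
        using local_familyD(1)[OF u'L, of S] S ub[of S] red
        by (intro integral_mono integrable_bdd bdd_abs bdd_add) (auto simp: u'_def)
      also have "\<dots> = (\<integral>x. \<bar>u S x\<bar> \<partial>P) + (\<integral>x. \<bar>redist top w S x\<bar> \<partial>P)"
        using S ub[of S] red by (intro Bochner_Integration.integral_add integrable_bdd) auto
      finally show "(\<integral>x. \<bar>u' S x\<bar> \<partial>P) \<le> (\<integral>x. \<bar>u S x\<bar> \<partial>P) + (\<integral>x. \<bar>redist top w S x\<bar> \<partial>P)" .
    qed
    also have "\<dots> \<le> B + (\<Sum>S\<in>top. 2 ^ card S * (\<integral>x. \<bar>w S x\<bar> \<partial>P))"
      unfolding sum.distrib using top w by (intro add_mono Suc.prems(3) redist_total) auto
    also have "\<dots> \<le> B + (\<Sum>S\<in>top. 2 ^ Suc r * (\<integral>x. \<bar>u S x\<bar> \<partial>P))"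
    proof (intro add_left_mono sum_mono)
      fix S assume S: "S \<in> top"
      have "(\<integral>x. \<bar>w S x\<bar> \<partial>P) \<le> (\<integral>x. \<bar>u S x\<bar> \<partial>P)"
        using w ub topS[OF S] by (intro integral_mono integrable_bdd) (auto simp: w_def)
      thus "2 ^ card S * (\<integral>x. \<bar>w S x\<bar> \<partial>P) \<le> 2 ^ Suc r * (\<integral>x. \<bar>u S x\<bar> \<partial>P)" using topS[OF S] by simp
    qed
    also have "\<dots> = B + 2 ^ Suc r * (\<Sum>S\<in>top. \<integral>x. \<bar>u S x\<bar> \<partial>P)"
      by (simp only: sum_distrib_left)
    also have "\<dots> \<le> B + 2 ^ Suc r * B"
      by (intro add_left_mono mult_left_mono top_total) simp
    also have "\<dots> \<le> 2 ^ (r + 2) * B"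
    proof -
      have "1 * B \<le> 2 ^ Suc r * B" using B by (intro mult_right_mono one_le_power) auto
      thus ?thesis by (simp add: mult_ac)
    qed
    finally show ?thesis .
  qed
  obtain v1 where v1: "local_family v1" "support_cost v1 \<le> (2 ^ (r + 2) * B) / t * 2 ^ (r * (r + 3))"
    "(\<integral>x. ((\<Sum>S\<in>Pow I. u' S x) - (\<Sum>S\<in>Pow I. v1 S x))\<^sup>2 \<partial>P) \<le> t * (2 ^ (r + 2) * B) * 2 ^ (r * (r + 3))"
    using Suc.IH[OF u'L u'0 u'B] by blast
  define v where "v = (\<lambda>S x. v1 S x + (if S \<in> top then big S x else 0))"
  have vL: "local_family v"
    unfolding local_family_def
  proof
    fix S assume S: "S \<in> Pow I"
    show "bdd (v S) \<and> dep S (v S)"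
      using S local_familyD[OF v1(1), of S] big[of S] unfolding v_def
      by (cases "S \<in> top") (auto intro!: dep_add dep_zero)
  qed
  have sum_u: "(\<Sum>S\<in>Pow I. u S x) - (\<Sum>S\<in>Pow I. v S x)
      = ((\<Sum>S\<in>Pow I. u' S x) - (\<Sum>S\<in>Pow I. v1 S x)) + (\<Sum>S\<in>top. proj S (w S) x)" for x
  proof -
    have split: "(\<Sum>S\<in>Pow I. g S) = (\<Sum>S\<in>Pow I - top. g S) + (\<Sum>S\<in>top. g S)" for g :: "nat set \<Rightarrow> real"
      using top by (intro sum.subset_diff) auto
    have "(\<Sum>S\<in>Pow I. u' S x) = (\<Sum>S\<in>Pow I - top. u S x) - (\<Sum>S\<in>Pow I - top. redist top w S x)"
      unfolding split[of "\<lambda>S. u' S x"] by (simp add: u'_def sum_subtractf)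
    moreover have "(\<Sum>S\<in>Pow I - top. redist top w S x) + (\<Sum>S\<in>top. w S x) = (\<Sum>S\<in>top. proj S (w S) x)"
    proof -
      have "(\<Sum>V\<in>Pow I. redist top w V x) = (\<Sum>S\<in>top. proj S (w S) x)"
        by (rule sum_redist[OF top(1)]) (use w topS in blast)+
      moreover have "(\<Sum>V\<in>top. redist top w V x) = (\<Sum>S\<in>top. w S x)"
        by (intro sum.cong refl redist_top)
      ultimately show ?thesis using split[of "\<lambda>S. redist top w S x"] by linarith
    qed
    moreover have "(\<Sum>S\<in>Pow I. u S x) = (\<Sum>S\<in>Pow I - top. u S x) + (\<Sum>S\<in>top. big S x) + (\<Sum>S\<in>top. w S x)"
      unfolding split[of "\<lambda>S. u S x"] by (simp add: uw sum.distrib)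
    moreover have "(\<Sum>S\<in>Pow I. v S x) = (\<Sum>S\<in>Pow I. v1 S x) + (\<Sum>S\<in>top. big S x)"
      using top by (simp add: v_def sum.distrib sum.inter_restrict[symmetric] Int_absorb1)
    ultimately show ?thesis by linarith
  qed
  let ?E = "r * (r + 3)"
  \<comment> \<open>A level needs \<open>r + 2\<close> more in the exponent for the L1 total, one
    for doubling squares, and one for the added lower-order term. The exponent grows by
    \<open>2 * r + 4\<close>, which suffices.\<close>
  have expo: "2 ^ (r + 3) * (2::real) ^ ?E * 2 = 2 ^ (r * r + 4 * r + 4)" "Suc r * (Suc r + 3) = r * r + 5 * r + 4"
    by (simp_all flip: power_add power_Suc2) (simp_all add: algebra_simps)
  have expo_le: "(2::real) ^ (r * r + 4 * r + 4) \<le> 2 ^ (Suc r * (Suc r + 3))"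
    unfolding expo(2) by (intro power_increasing) auto
  have cost: "support_cost v \<le> B / t * 2 ^ (Suc r * (Suc r + 3))"
  proof -
    have "support_cost v \<le> (\<Sum>S\<in>Pow I. real (card S) * measure P {x \<in> space P. v1 S x \<noteq> 0}
        + (if S \<in> top then real (Suc r) * ((\<integral>x. \<bar>u S x\<bar> \<partial>P) / t) else 0))"
      unfolding support_cost_def
    proof (rule sum_mono)
      fix S assume S: "S \<in> Pow I"
      show "real (card S) * measure P {x \<in> space P. v S x \<noteq> 0} \<le> real (card S) * measure P {x \<in> space P. v1 S x \<noteq> 0}
        + (if S \<in> top then real (Suc r) * ((\<integral>x. \<bar>u S x\<bar> \<partial>P) / t) else 0)"
      proof (cases "S \<in> top")
        case True
        note m = sets_nonzero[OF local_familyD(1)[OF v1(1) topS(1)[OF True]]] sets_nonzero[OF big(1)[OF topS(1)[OF True]]]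
        have "measure P {x \<in> space P. v S x \<noteq> 0} \<le> measure P ({x \<in> space P. v1 S x \<noteq> 0} \<union> {x \<in> space P. big S x \<noteq> 0})"
          using m by (intro P.finite_measure_mono) (auto simp: v_def)
        also have "\<dots> \<le> measure P {x \<in> space P. v1 S x \<noteq> 0} + measure P {x \<in> space P. big S x \<noteq> 0}"
          using m by (intro measure_Un_le) auto
        also have "measure P {x \<in> space P. big S x \<noteq> 0} \<le> measure P {x \<in> space P. t \<le> \<bar>u S x\<bar>}"
        proof (rule P.finite_measure_mono)
          have [measurable]: "u S \<in> borel_measurable P" using ub[OF topS(1)[OF True]] bddD(1) by blast
          show "{x \<in> space P. t \<le> \<bar>u S x\<bar>} \<in> sets P" by measurable
        qed (auto simp: big_def)
        also have "\<dots> \<le> (\<integral>x. \<bar>u S x\<bar> \<partial>P) / t"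
          using t ub[OF topS(1)[OF True]]
          by (intro integral_Markov_inequality_measure[where A = "{}"]) (auto intro!: integrable_bdd)
        finally have "real (Suc r) * measure P {x \<in> space P. v S x \<noteq> 0}
          \<le> real (Suc r) * (measure P {x \<in> space P. v1 S x \<noteq> 0} + (\<integral>x. \<bar>u S x\<bar> \<partial>P) / t)"
          by (intro mult_left_mono) simp_all
        thus ?thesis using True topS(3)[OF True] by (simp only: distrib_left if_True)
      qed (simp add: v_def)
    qed
    also have "\<dots> = support_cost v1 + real (Suc r) * ((\<Sum>S\<in>top. \<integral>x. \<bar>u S x\<bar> \<partial>P) / t)"
      using top by (simp add: sum.distrib support_cost_def sum.inter_restrict[symmetric] Int_absorb1 sum_distrib_left sum_divide_distrib)
    also have "\<dots> \<le> (2 ^ (r + 2) * B) / t * 2 ^ ?E + real (Suc r) * (B / t)"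
      using t by (intro add_mono v1(2) mult_left_mono divide_right_mono top_total) auto
    also have "\<dots> = B / t * (2 ^ (r + 2) * 2 ^ ?E + real (Suc r))" by (simp add: algebra_simps)
    also have "\<dots> \<le> B / t * (2 ^ (Suc r * (Suc r + 3)))"
    proof (rule mult_left_mono)
      have "real (Suc r) \<le> 2 ^ (r + 2)" using of_nat_less_two_power[of "Suc r", where 'a = real] by simp
      also have "\<dots> * 1 \<le> 2 ^ (r + 2) * (2::real) ^ ?E" by (intro mult_left_mono) auto
      finally have "2 ^ (r + 2) * 2 ^ ?E + real (Suc r) \<le> 2 ^ (r + 3) * 2 ^ ?E * 2" by (simp add: power_add)
      thus "2 ^ (r + 2) * 2 ^ ?E + real (Suc r) \<le> 2 ^ (Suc r * (Suc r + 3))"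
        using expo_le unfolding expo(1) by linarith
    qed (use B t in auto)
    finally show ?thesis .
  qed
  have err: "(\<integral>x. ((\<Sum>S\<in>Pow I. u S x) - (\<Sum>S\<in>Pow I. v S x))\<^sup>2 \<partial>P) \<le> t * B * 2 ^ (Suc r * (Suc r + 3))"
  proof -
    define \<alpha> where "\<alpha> = (\<lambda>x. (\<Sum>S\<in>Pow I. u' S x) - (\<Sum>S\<in>Pow I. v1 S x))"
    define \<beta> where "\<beta> = (\<lambda>x. \<Sum>S\<in>top. proj S (w S) x)"
    have b: "bdd \<alpha>" "bdd \<beta>" unfolding \<alpha>_def \<beta>_def
      using local_familyD(1)[OF u'L] local_familyD(1)[OF v1(1)] w topS by (auto intro!: bdd_diff bdd_sum)
    have "(\<integral>x. (\<beta> x)\<^sup>2 \<partial>P) \<le> (\<Sum>S\<in>top. \<integral>x. (w S x)\<^sup>2 \<partial>P)"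
      unfolding \<beta>_def using top w by (intro integral_proj_sum_square_le) auto
    \<comment> \<open>Small values satisfy
      \<open>(w S x)\<^sup>2 \<le> t * \<bar>u S x\<bar>\<close>, which converts the L1 bound into
      an L2 bound.\<close>
    also have "\<dots> \<le> (\<Sum>S\<in>top. \<integral>x. t * \<bar>u S x\<bar> \<partial>P)"
    proof (intro sum_mono integral_mono integrable_bdd)
      fix S x
      have "\<bar>u S x\<bar> * \<bar>u S x\<bar> \<le> t * \<bar>u S x\<bar>" if "\<bar>u S x\<bar> < t" using that by (intro mult_right_mono) auto
      thus "(w S x)\<^sup>2 \<le> t * \<bar>u S x\<bar>" using t by (auto simp: w_def power2_eq_square abs_mult[symmetric])
    qed (use w ub topS in auto)
    also have "\<dots> = t * (\<Sum>S\<in>top. \<integral>x. \<bar>u S x\<bar> \<partial>P)" by (simp add: sum_distrib_left)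
    also have "\<dots> \<le> t * B"
      using t by (intro mult_left_mono top_total) auto
    finally have \<beta>: "(\<integral>x. (\<beta> x)\<^sup>2 \<partial>P) \<le> t * B" .
    have "(\<integral>x. ((\<Sum>S\<in>Pow I. u S x) - (\<Sum>S\<in>Pow I. v S x))\<^sup>2 \<partial>P) = (\<integral>x. (\<alpha> x + \<beta> x)\<^sup>2 \<partial>P)"
      by (simp only: sum_u \<alpha>_def \<beta>_def)
    also have "\<dots> \<le> (\<integral>x. 2 * (\<alpha> x)\<^sup>2 + 2 * (\<beta> x)\<^sup>2 \<partial>P)"
    proof (intro integral_mono integrable_bdd)
      show "(\<alpha> x + \<beta> x)\<^sup>2 \<le> 2 * (\<alpha> x)\<^sup>2 + 2 * (\<beta> x)\<^sup>2" for x
        using zero_le_power2[of "\<alpha> x - \<beta> x"] by (simp add: power2_eq_square algebra_simps)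
    qed (use b in auto)
    also have "\<dots> = 2 * (\<integral>x. (\<alpha> x)\<^sup>2 \<partial>P) + 2 * (\<integral>x. (\<beta> x)\<^sup>2 \<partial>P)"
      using b by (simp add: integrable_bdd)
    also have "\<dots> \<le> 2 * (t * (2 ^ (r + 2) * B) * 2 ^ ?E) + 2 * (t * B)"
      using v1(3) \<beta> by (simp add: \<alpha>_def)
    also have "\<dots> = t * B * (2 ^ (r + 3) * 2 ^ ?E + 2)" by (simp add: power_add algebra_simps)
    also have "\<dots> \<le> t * B * 2 ^ (Suc r * (Suc r + 3))"
    proof (rule mult_left_mono)
      have "(2::real) ^ 1 * 1 \<le> 2 ^ (r + 3) * 2 ^ ?E"
        by (intro mult_mono power_increasing one_le_power) auto
      thus "2 ^ (r + 3) * 2 ^ ?E + 2 \<le> (2::real) ^ (Suc r * (Suc r + 3))"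
        using expo_le unfolding expo(1)[symmetric] power_one_right mult_1_right by linarith
    qed (use B t in auto)
    finally show ?thesis .
  qed
  show ?case using vL cost err by blast
qed

subsection \<open>Pseudo-juntas from families of local functions\<close>

text \<open>If \<open>A\<close> is the junta set at \<open>x\<close>, every \<open>S\<close> with
  \<open>v S x \<noteq> 0\<close> lies in \<open>A\<close>, so the whole sum is computable from
  \<open>A\<close> and \<open>x_A\<close>.\<close>

lemma pseudo_junta_of_local_family:
  assumes I: "I = {1..n}" and v: "local_family v" and k: "support_cost v \<le> k"
  shows "pseudo_junta M n k (\<lambda>x. of_bool (1 / 2 \<le> (\<Sum>S\<in>Pow I. v S x)))"
proof -
  \<comment> \<open>Fills in missing coordinates: \<open>v S\<close> is a function on the full
    space, whereas the junta functions take points of \<open>power_space M S\<close>.\<close>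
  obtain x0 where x0: "x0 \<in> space P" by (rule obtain_point)
  note vb = local_familyD(1)[OF v] and vd = local_familyD(2)[OF v]
  have ext_space: "override_on x0 y S \<in> space P" if "y \<in> space (power_space M S)" "S \<subseteq> I" for y S
    using that x0 by (auto simp: space_PiM PiE_iff override_on_def extensional_def)
  have ext_meas: "(\<lambda>y. override_on x0 y S) \<in> power_space M S \<rightarrow>\<^sub>M P" if S: "S \<subseteq> I" for S
  proof (rule measurable_PiM_single')
    fix i assume i: "i \<in> I"
    have "x0 i \<in> space M" using x0 i by (auto simp: space_PiM)
    thus "(\<lambda>y. override_on x0 y S i) \<in> power_space M S \<rightarrow>\<^sub>M M"
      by (cases "i \<in> S") (simp_all add: override_on_def)
  next
    show "(\<lambda>y. override_on x0 y S) \<in> space (power_space M S) \<rightarrow> (\<Pi>\<^sub>E i\<in>I. space M)"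
      using ext_space[OF _ S] by (auto simp: space_PiM)
  qed
  have v_ext: "v S (override_on x0 (restrict x A) A) = v S x" if "S \<subseteq> A" "A \<subseteq> I" "x \<in> space P" for S A x
  proof (rule vd[unfolded dep_def, rule_format])
    show "override_on x0 (restrict x A) A \<in> space P"
      using that by (intro ext_space) (auto simp: space_PiM PiE_iff)
  qed (use that in \<open>auto simp: override_on_def\<close>)
  have v_ext_meas: "(\<lambda>y. v S (override_on x0 y A)) \<in> borel_measurable (power_space M A)" if "S \<subseteq> I" "A \<subseteq> I" for S A
    by (rule measurable_compose[OF ext_meas[OF that(2)] bddD(1)[OF vb[OF that(1)]]])
  define J where "J = (\<lambda>S y. of_bool (v S (override_on x0 y S) \<noteq> 0) :: real)"
  have J_meas: "zero_one_measurable (power_space M S) (J S)" if S: "S \<subseteq> {1..n}" for S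
  proof -
    have [measurable]: "(\<lambda>y. v S (override_on x0 y S)) \<in> borel_measurable (power_space M S)"
      using S by (intro v_ext_meas) (auto simp: I)
    have "J S \<in> borel_measurable (power_space M S)" unfolding J_def by measurable
    thus ?thesis by (auto simp: zero_one_measurable_def J_def)
  qed
  have junta: "junta_set n J x = \<Union>{S. S \<subseteq> I \<and> v S x \<noteq> 0}" if "x \<in> space P" for x
    unfolding junta_set_def I[symmetric] using v_ext[OF order_refl _ that] by (auto simp: J_def)
  have junta_sub: "junta_set n J x \<subseteq> I" for x by (auto simp: junta_set_def I)
  have int: "integrable P (\<lambda>x. real (card S) * indicator {x \<in> space P. v S x \<noteq> 0} x)" if "S \<in> Pow I" for S
    using that sets_nonzero[OF vb, of S]
    by (intro integrable_mult_right integrable_real_indicator) (auto simp: less_top[symmetric])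
  have "(\<integral>x. real (card (junta_set n J x)) \<partial>P)
     \<le> (\<integral>x. (\<Sum>S\<in>Pow I. real (card S) * indicator {x \<in> space P. v S x \<noteq> 0} x) \<partial>P)"
  proof (rule integral_mono')
    show "integrable P (\<lambda>x. \<Sum>S\<in>Pow I. real (card S) * indicator {x \<in> space P. v S x \<noteq> 0} x)"
      by (intro Bochner_Integration.integrable_sum int)
    fix x assume x: "x \<in> space P"
    have "card (junta_set n J x) = card (\<Union>S\<in>{S \<in> Pow I. v S x \<noteq> 0}. S)"
      unfolding junta[OF x] by (intro arg_cong[where f = card]) auto
    also have "\<dots> \<le> (\<Sum>S\<in>{S \<in> Pow I. v S x \<noteq> 0}. card S)" by (rule card_UN_le) simp
    finally have "real (card (junta_set n J x)) \<le> (\<Sum>S\<in>{S \<in> Pow I. v S x \<noteq> 0}. real (card S))"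
      unfolding of_nat_sum[symmetric] by (rule of_nat_mono)
    also have "\<dots> = (\<Sum>S\<in>Pow I. real (card S) * indicator {x \<in> space P. v S x \<noteq> 0} x)"
      using x by (intro sum.mono_neutral_cong_left) (auto simp: indicator_def)
    finally show "real (card (junta_set n J x)) \<le> (\<Sum>S\<in>Pow I. real (card S) * indicator {x \<in> space P. v S x \<noteq> 0} x)" .
  next
    fix x show "0 \<le> (\<Sum>S\<in>Pow I. real (card S) * indicator {x \<in> space P. v S x \<noteq> 0} x)"
      by (intro sum_nonneg) auto
  qed
  also have "\<dots> = support_cost v"
  proof -
    have "(\<integral>x. (\<Sum>S\<in>Pow I. real (card S) * indicator {x \<in> space P. v S x \<noteq> 0} x) \<partial>P)
      = (\<Sum>S\<in>Pow I. \<integral>x. real (card S) * indicator {x \<in> space P. v S x \<noteq> 0} x \<partial>P)"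
      by (intro Bochner_Integration.integral_sum int)
    also have "\<dots> = support_cost v" unfolding support_cost_def
      using sets_nonzero[OF vb] by (intro sum.cong refl) simp
    finally show ?thesis .
  qed
  finally have cost: "(\<integral>x. real (card (junta_set n J x)) \<partial>power_space M {1..n}) \<le> k"
    using k by (simp add: I)
  define G where "G = (\<lambda>A y. \<Sum>S\<in>Pow A. v S (override_on x0 y A))"
  define W where "W = (\<lambda>A. {y \<in> space (power_space M A). 1 / 2 \<le> G A y})"
  have W: "W A \<in> sets (power_space M A)" if "A \<subseteq> I" for A
  proof -
    have "G A \<in> borel_measurable (power_space M A)"
      unfolding G_def using that by (intro borel_measurable_sum v_ext_meas) auto
    thus ?thesis unfolding W_def by measurable
  qed
  let ?gen = "{{A} \<times> B | A B. A \<subseteq> {1..n} \<and> B \<in> sets (power_space M A)}"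
  have gen: "?gen \<subseteq> Pow (SIGMA A:Pow {1..n}. space (power_space M A))"
    using sets.sets_into_space by fastforce
  have "(\<Union>A\<in>Pow I. {A} \<times> W A) \<in> sets (subcube_union M n)"
  proof (rule sets.finite_UN)
    fix A assume A: "A \<in> Pow I"
    hence "{A} \<times> W A \<in> ?gen" using W I by auto
    thus "{A} \<times> W A \<in> sets (subcube_union M n)"
      unfolding subcube_union_def sets_measure_of[OF gen] by (rule sigma_sets.Basic)
  qed simp
  hence "(\<lambda>x. (junta_set n J x, restrict x (junta_set n J x))) -` (\<Union>A\<in>Pow I. {A} \<times> W A) \<inter> space P
      \<in> sets (junta_algebra M n J)"
    unfolding junta_algebra_def I[symmetric] by (rule in_vimage_algebra)
  also have "(\<lambda>x. (junta_set n J x, restrict x (junta_set n J x))) -` (\<Union>A\<in>Pow I. {A} \<times> W A) \<inter> space P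
    = {x \<in> space P. 1 / 2 \<le> (\<Sum>S\<in>Pow I. v S x)}"
  proof -
    have "G (junta_set n J x) (restrict x (junta_set n J x)) = (\<Sum>S\<in>Pow I. v S x)" if x: "x \<in> space P" for x
    proof -
      have "G (junta_set n J x) (restrict x (junta_set n J x)) = (\<Sum>S\<in>Pow (junta_set n J x). v S x)"
        unfolding G_def using x junta_sub by (intro sum.cong refl v_ext) auto
      also have "\<dots> = (\<Sum>S\<in>Pow I. v S x)"
        using junta_sub[of x] junta[OF x] by (intro sum.mono_neutral_left) auto
      finally show ?thesis .
    qed
    moreover have "restrict x (junta_set n J x) \<in> space (power_space M (junta_set n J x))" if "x \<in> space P" for x
      using that junta_sub[of x] by (auto simp: space_PiM PiE_iff)
    ultimately show ?thesis using junta_sub by (auto simp: W_def)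
  qed
  finally have set: "{x \<in> space P. 1 / 2 \<le> (\<Sum>S\<in>Pow I. v S x)} \<in> sets (junta_algebra M n J)" .
  have sp: "space (junta_algebra M n J) = space P" by (simp add: junta_algebra_def I)
  have "(indicator {x \<in> space P. 1 / 2 \<le> (\<Sum>S\<in>Pow I. v S x)} :: _ \<Rightarrow> real) \<in> borel_measurable (junta_algebra M n J)"
    using set by simp
  also have "?this \<longleftrightarrow> (\<lambda>x. of_bool (1 / 2 \<le> (\<Sum>S\<in>Pow I. v S x)) :: real) \<in> borel_measurable (junta_algebra M n J)"
    by (intro measurable_cong) (auto simp: sp indicator_def)
  finally have "zero_one_measurable (junta_algebra M n J) (\<lambda>x. of_bool (1 / 2 \<le> (\<Sum>S\<in>Pow I. v S x)))"
    by (auto simp: zero_one_measurable_def)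
  thus ?thesis unfolding pseudo_junta_def using J_meas cost by blast
qed

text \<open>The sum is rounded at one half. Where the rounding differs from \<open>f\<close>, the
  sum is at distance at least one half from \<open>f\<close>, so four times the squared distance
  dominates the error; hence the \<open>\<epsilon> / 4\<close>.\<close>

lemma pseudo_junta_approximation:
  assumes I: "I = {1..n}" and f: "bdd f" "\<And>x. f x \<in> {0, 1}"
    and v: "local_family v" "support_cost v \<le> k" "(\<integral>x. (f x - (\<Sum>S\<in>Pow I. v S x))\<^sup>2 \<partial>P) \<le> \<epsilon> / 4"
  shows "\<exists>h. pseudo_junta M n k h \<and> (\<integral>x. \<bar>f x - h x\<bar> \<partial>P) \<le> \<epsilon>"
proof -
  define g where "g = (\<lambda>x. \<Sum>S\<in>Pow I. v S x)"
  have g: "bdd g" unfolding g_def using local_familyD[OF v(1)] by auto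
  have "(\<integral>x. \<bar>f x - of_bool (1 / 2 \<le> g x)\<bar> \<partial>P) \<le> (\<integral>x. 4 * (f x - g x)\<^sup>2 \<partial>P)"
  proof (rule integral_mono')
    show "integrable P (\<lambda>x. 4 * (f x - g x)\<^sup>2)" using f(1) g by (intro integrable_bdd) auto
    fix x
    have "1 \<le> 4 * y\<^sup>2" if "1 / 2 \<le> \<bar>y\<bar>" for y :: real
      using power_mono[OF that, of 2] by (simp add: power_divide)
    moreover have "f x = 0 \<or> f x = 1" using f(2)[of x] by auto
    ultimately show "\<bar>f x - of_bool (1 / 2 \<le> g x)\<bar> \<le> 4 * (f x - g x)\<^sup>2" by fastforce
  qed simp
  also have "\<dots> \<le> \<epsilon>" using v(3) by (simp add: g_def)
  finally show ?thesis
    using pseudo_junta_of_local_family[OF I v(1,2)] by (auto simp: g_def)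
qed

end

subsection \<open>Energy on low degrees\<close>

locale low_degree_energy = finite_power M I for M :: "'a measure" and I :: "nat set" +
  fixes f :: "(nat \<Rightarrow> 'a) \<Rightarrow> real" and m :: nat and \<tau> :: real
  assumes bdd_f [simp, intro!]: "bdd f"
    and f_01: "f x \<in> {0, 1}"
    and \<tau>_pos: "0 < \<tau>"
begin

definition low :: "nat set set" where "low = {S \<in> Pow I. card S \<le> m}"

definition energy :: "nat set \<Rightarrow> (nat \<Rightarrow> 'a) \<Rightarrow> real" where
  "energy U = avg (I - U) (\<lambda>x. \<Sum>S\<in>{S\<in>low. U \<subseteq> S}. (es f S x)\<^sup>2)"

definition active :: "nat set \<Rightarrow> (nat \<Rightarrow> 'a) \<Rightarrow> bool" where
  "active U x \<longleftrightarrow> \<tau> \<le> energy U x"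

definition covers :: "nat set \<Rightarrow> nat \<Rightarrow> (nat \<Rightarrow> 'a) \<Rightarrow> bool" where
  "covers S i x \<longleftrightarrow> (\<exists>T\<in>Pow S. i \<in> T \<and> active T x)"

lemma low_finite: "finite low" and low_subset: "S \<in> low \<Longrightarrow> S \<subseteq> I" and low_card: "S \<in> low \<Longrightarrow> card S \<le> m"
  and low_finite_mem: "S \<in> low \<Longrightarrow> finite S"
  unfolding low_def by (auto intro: finite_subset_I)

lemma low_mono: "S \<in> low \<Longrightarrow> T \<subseteq> S \<Longrightarrow> T \<in> low"
  unfolding low_def using finite_subset_I card_mono[of S T] by fastforce

lemma bdd_energy [simp, intro!]: "bdd (energy U)"
  unfolding energy_def by auto

lemma dep_energy: "dep U (energy U)"
  unfolding energy_def by (rule dep_avg_compl)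

lemma energy_eq: "energy U x = (\<Sum>S\<in>{S\<in>low. U \<subseteq> S}. avg (I - U) (\<lambda>x. (es f S x)\<^sup>2) x)"
  unfolding energy_def by (simp add: avg_sum)

text \<open>Without the degree bound the sum would be the conditional energy of
  \<open>proj U f\<close>, which \<open>proj_square_le\<close> controls because
  \<open>f\<^sup>2 \<le> 1\<close>.\<close>

lemma energy_le:
  assumes "U \<subseteq> I" shows "energy U x \<le> 4 ^ card U"
proof -
  have finU: "finite U" using assms by (rule finite_subset_I)
  have fin: "finite {S\<in>Pow I. U \<subseteq> S}" by simp
  have "energy U x \<le> (\<Sum>S\<in>{S\<in>Pow I. U \<subseteq> S}. avg (I - U) (\<lambda>x. (es f S x)\<^sup>2) x)"
    unfolding energy_eq by (rule sum_mono2[OF fin]) (auto simp: low_def intro!: avg_nonneg)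
  also have "\<dots> = avg (I - U) (\<lambda>x. (\<Sum>S\<in>{S\<in>Pow I. U \<subseteq> S}. es f S x)\<^sup>2) x"
    by (subst avg_canonical_sum_square) (auto intro!: canonical_es)
  also have "(\<lambda>x. \<Sum>S\<in>{S\<in>Pow I. U \<subseteq> S}. es f S x) = proj U (\<lambda>x. \<Sum>S\<in>Pow I. 1 * es f S x)"
    using assms by (subst proj_canonical_sum) (auto intro!: canonical_es)
  also have "(\<lambda>x. \<Sum>S\<in>Pow I. 1 * es f S x) = f" using efron_stein[OF bdd_f] by simp
  also have "avg (I - U) (\<lambda>x. (proj U f x)\<^sup>2) x \<le> avg (I - U) (mix 2 2 U (\<lambda>x. (f x)\<^sup>2)) x"
    using finU by (intro avg_mono proj_square_le) auto
  also have "\<dots> \<le> (2 + 2) ^ card U * 1"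
  proof (intro avg_le_const mix_le_const finU)
    show "(f x)\<^sup>2 \<le> 1" for x using f_01[of x] by auto
  qed auto
  finally show ?thesis by simp
qed

lemma energy_nonneg: "0 \<le> energy U x"
  unfolding energy_def by (intro avg_nonneg sum_nonneg) auto

lemma measurable_energy [measurable]: "energy U \<in> borel_measurable P"
  by (rule bddD) auto

lemma measurable_active [measurable]: "Measurable.pred P (active U)"
  unfolding active_def by measurable

lemma measurable_covers [measurable]:
  assumes "S \<subseteq> I" shows "Measurable.pred P (covers S i)"
proof -
  have "finite (Pow S)" using assms by (simp add: finite_subset_I)
  thus ?thesis unfolding covers_def by (intro pred_intros_finite(4) pred_intros_logic measurable_active measurable_const) auto
qed

lemma active_cong:
  "x \<in> space P \<Longrightarrow> y \<in> space P \<Longrightarrow> T \<subseteq> S \<Longrightarrow> (\<And>i. i \<in> S \<Longrightarrow> x i = y i) \<Longrightarrow> active T x = active T y"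
  using dep_energy[of T, unfolded dep_def, rule_format, of x y] unfolding active_def by (metis subsetD)

lemma covers_cong:
  "x \<in> space P \<Longrightarrow> y \<in> space P \<Longrightarrow> (\<And>i. i \<in> S \<Longrightarrow> x i = y i) \<Longrightarrow> covers S i x = covers S i y"
  unfolding covers_def using active_cong[of x y _ S] by (intro bex_cong refl) auto

section \<open>Components with an uncovered coordinate\<close>

definition uncov :: "nat \<Rightarrow> nat set \<Rightarrow> (nat \<Rightarrow> 'a) \<Rightarrow> real" where
  "uncov i S x = of_bool (x \<in> space P \<and> \<not> covers S i x)"

lemma bdd_uncov: "S \<subseteq> I \<Longrightarrow> bdd (uncov i S)"
  unfolding uncov_def[abs_def] by (intro bdd_of_bool) measurable

lemma dep_uncov: "dep S (uncov i S)"
  unfolding dep_def uncov_def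
proof clarify
  fix x y assume "x \<in> space P" "y \<in> space P" "\<forall>i\<in>S. x i = y i"
  thus "of_bool (x \<in> space P \<and> \<not> covers S i x) = (of_bool (y \<in> space P \<and> \<not> covers S i y) :: real)"
    using covers_cong[of x y S i] by simp
qed

definition act :: "nat set \<Rightarrow> (nat \<Rightarrow> 'a) \<Rightarrow> real" where
  "act S x = of_bool (x \<in> space P \<and> active S x)"

lemma bdd_act [simp, intro!]: "bdd (act S)"
  unfolding act_def[abs_def] by (intro bdd_of_bool) measurable

lemma dep_act: "dep S (act S)"
  unfolding dep_def act_def
proof clarify
  fix x y assume "x \<in> space P" "y \<in> space P" "\<forall>i\<in>S. x i = y i"
  thus "of_bool (x \<in> space P \<and> active S x) = (of_bool (y \<in> space P \<and> active S y) :: real)"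
    using active_cong[of x y S S] by simp
qed

text \<open>Suppose first \<open>i \<in> U\<close>. If \<open>U\<close> is active, it covers
  \<open>i\<close> in every \<open>S \<supseteq> U\<close> and all terms vanish; if not, the energy
  of \<open>U\<close> is below \<open>\<tau>\<close>. For \<open>i \<notin> U\<close>, the bound for
  \<open>insert i U\<close> is averaged over coordinate \<open>i\<close>.\<close>

lemma uncovered_energy_bound:
  assumes i: "i \<in> I" and U: "U \<subseteq> I" and x: "x \<in> space P"
  shows "(\<Sum>S\<in>{S\<in>{S\<in>low. i \<in> S}. U \<subseteq> S}. avg (I - U) (\<lambda>x. (es f S x * uncov i S x)\<^sup>2) x) \<le> \<tau>"
proof -
  have bu [simp]: "bdd (uncov i S)" if "S \<in> low" for S using that bdd_uncov low_subset by auto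
  have main: "(\<Sum>S\<in>{S\<in>{S\<in>low. i \<in> S}. U \<subseteq> S}. avg (I - U) (\<lambda>x. (es f S x * uncov i S x)\<^sup>2) x) \<le> \<tau>"
    if "U \<subseteq> I" "i \<in> U" "x \<in> space P" for U x
  proof -
    define na where "na x = (of_bool (x \<in> space P \<and> \<not> active U x) :: real)" for x
    have na: "bdd na" "dep U na"
    proof -
      show "bdd na" unfolding na_def[abs_def] by (intro bdd_of_bool) measurable
      show "dep U na" unfolding dep_def na_def
      proof clarify
        fix x y assume "x \<in> space P" "y \<in> space P" "\<forall>i\<in>U. x i = y i"
        thus "of_bool (x \<in> space P \<and> \<not> active U x) = (of_bool (y \<in> space P \<and> \<not> active U y) :: real)"
          using active_cong[of x y U U] by simp
      qed
    qed
    have "(\<Sum>S\<in>{S\<in>{S\<in>low. i \<in> S}. U \<subseteq> S}. avg (I - U) (\<lambda>x. (es f S x * uncov i S x)\<^sup>2) x)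
      \<le> (\<Sum>S\<in>{S\<in>{S\<in>low. i \<in> S}. U \<subseteq> S}. avg (I - U) (\<lambda>x. na x * (es f S x)\<^sup>2) x)"
    proof (intro sum_mono avg_mono)
      fix S assume S: "S \<in> {S\<in>{S\<in>low. i \<in> S}. U \<subseteq> S}"
      show "bdd (\<lambda>x. (es f S x * uncov i S x)\<^sup>2)" using S by auto
      show "bdd (\<lambda>x. na x * (es f S x)\<^sup>2)" using na by auto
      fix y
      have "covers S i y" if "active U y"
        using S \<open>i \<in> U\<close> that unfolding covers_def by blast
      hence "uncov i S y \<le> na y" "uncov i S y \<in> {0,1}"
        by (auto simp: uncov_def na_def)
      thus "(es f S y * uncov i S y)\<^sup>2 \<le> na y * (es f S y)\<^sup>2"
        by (auto simp: na_def)
    qed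
    also have "\<dots> = (\<Sum>S\<in>{S\<in>low. U \<subseteq> S}. na x * avg (I - U) (\<lambda>x. (es f S x)\<^sup>2) x)"
      using that avg_dep_mult[OF na(2), of "I - U"] by (intro sum.cong) (auto simp: Int_commute)
    also have "\<dots> = na x * energy U x"
      by (simp add: energy_eq sum_distrib_left)
    also have "\<dots> \<le> \<tau>" using \<tau>_pos by (auto simp: na_def active_def)
    finally show ?thesis .
  qed
  show ?thesis
  proof (cases "i \<in> U")
    case True
    thus ?thesis using main U x by auto
  next
    case False
    let ?F = "{S\<in>{S\<in>low. i \<in> S}. insert i U \<subseteq> S}"
    have "{S\<in>{S\<in>low. i \<in> S}. U \<subseteq> S} = ?F" by auto
    moreover have "I - U = {i} \<union> (I - insert i U)" using False i by auto
    ultimately have "(\<Sum>S\<in>{S\<in>{S\<in>low. i \<in> S}. U \<subseteq> S}. avg (I - U) (\<lambda>x. (es f S x * uncov i S x)\<^sup>2) x)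
      = (\<Sum>S\<in>?F. avg {i} (avg (I - insert i U) (\<lambda>x. (es f S x * uncov i S x)\<^sup>2)) x)"
      by (intro sum.cong) (auto simp: avg_avg)
    also have "\<dots> = avg {i} (\<lambda>x. \<Sum>S\<in>?F. avg (I - insert i U) (\<lambda>x. (es f S x * uncov i S x)\<^sup>2) x) x"
      by (subst avg_sum) auto
    also have "\<dots> \<le> \<tau>"
      using main[of "insert i U"] U i \<tau>_pos by (intro avg_le_const) auto
    finally show ?thesis .
  qed
qed

text \<open>An L1 norm, lying between the squared L2 norm of the same difference, which is at most 1
  in absolute value, and \<open>influence\<close>.\<close>

definition infl :: "nat \<Rightarrow> real" where
  "infl i = (\<integral>x. \<bar>f x - avg {i} f x\<bar> \<partial>P)"

lemma diff_avg_le_1: "\<bar>f x - avg A f x\<bar> \<le> 1"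
proof -
  have "0 \<le> f y" "f y \<le> 1" for y using f_01[of y] by auto
  hence "0 \<le> avg A f x" "avg A f x \<le> 1" by (auto intro!: avg_nonneg avg_le_const)
  thus ?thesis using f_01[of x] by auto
qed

text \<open>The condition on \<open>\<tau>\<close> makes the fourth-moment term at most half of the
  weight being estimated; it is absorbed on the left, whence the factor 2.\<close>

lemma uncovered_weight:
  assumes i: "i \<in> I" and l: "0 < l" "2048 ^ m * \<tau> \<le> l ^ 3 / 2"
  shows "(\<Sum>S\<in>{S\<in>low. i \<in> S}. \<integral>x. (es f S x * uncov i S x)\<^sup>2 \<partial>P) \<le> 2 * l * infl i"
proof -
  let ?F = "{S\<in>low. i \<in> S}"
  define g where "g = (\<lambda>S x. es f S x * uncov i S x)"
  define \<psi> where "\<psi> = (\<lambda>x. \<Sum>S\<in>?F. proj S (g S) x)"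
  define Q where "Q = (\<Sum>S\<in>?F. \<integral>x. (g S x)\<^sup>2 \<partial>P)"
  define d where "d = (\<lambda>x. f x - avg {i} f x)"
  have g [simp]: "bdd (g S)" "dep S (g S)" if "S \<in> ?F" for S
    using that bdd_uncov[of S] low_subset[of S] by (auto simp: g_def intro!: dep_mult dep_es dep_uncov)
  have bd: "bdd d" "bdd \<psi>" by (auto simp: d_def \<psi>_def)
  have 4: "(\<integral>x. \<psi> x ^ 4 \<partial>P) \<le> 2048 ^ m * \<tau> * Q"
    unfolding \<psi>_def Q_def
  proof (rule fourth_moment)
    show "?F \<subseteq> Pow I" "\<And>S. S \<in> ?F \<Longrightarrow> card S \<le> m" by (auto simp: low_def)
    show "(\<Sum>S\<in>{S\<in>?F. U \<subseteq> S}. avg (I - U) (\<lambda>x. (g S x)\<^sup>2) x) \<le> \<tau>" if "U \<subseteq> I" "x \<in> space P" for U x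
      using uncovered_energy_bound[OF i that] by (simp add: g_def)
  qed (use \<tau>_pos in auto)
  have Q0: "Q \<ge> 0" unfolding Q_def by (intro sum_nonneg integral_nonneg_AE) auto
  have "avg {i} \<psi> = (\<lambda>x. \<Sum>S\<in>?F. avg {i} (proj S (g S)) x)"
    unfolding \<psi>_def by (rule avg_sum) auto
  also have "\<dots> = (\<lambda>x. 0)" using low_finite_mem by (simp add: avg_proj)
  finally have avg\<psi>: "avg {i} \<psi> = (\<lambda>x. 0)" .
  have "(\<integral>x. d x * \<psi> x \<partial>P) = (\<integral>x. f x * \<psi> x - avg {i} f x * \<psi> x \<partial>P)"
    by (simp add: d_def algebra_simps)
  also have "\<dots> = (\<integral>x. f x * \<psi> x \<partial>P) - (\<integral>x. f x * avg {i} \<psi> x \<partial>P)"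
    using bd by (simp add: integrable_bdd integral_avg_swap)
  also have "\<dots> = (\<integral>x. f x * \<psi> x \<partial>P)" by (simp add: avg\<psi>)
  also have "\<dots> = (\<integral>x. (\<Sum>S\<in>?F. f x * proj S (g S) x) \<partial>P)"
    by (simp add: \<psi>_def sum_distrib_left)
  also have "\<dots> = (\<Sum>S\<in>?F. \<integral>x. f x * proj S (g S) x \<partial>P)"
    by (rule Bochner_Integration.integral_sum) (auto intro!: integrable_bdd)
  also have "\<dots> = (\<Sum>S\<in>?F. \<integral>x. es f S x * g S x \<partial>P)"
    by (intro sum.cong refl integral_proj_es) auto
  \<comment> \<open>Since \<open>uncov\<close> is an indicator, \<open>es f S x * g S x\<close>
    equals \<open>(g S x)\<^sup>2\<close>.\<close>
  also have "\<dots> = Q" unfolding Q_def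
    by (intro sum.cong refl Bochner_Integration.integral_cong) (auto simp: g_def uncov_def power2_eq_square)
  finally have "Q = (\<integral>x. d x * \<psi> x \<partial>P)" by simp
  \<comment> \<open>Since \<open>\<bar>d\<bar> \<le> 1\<close>, this replaces Hoelder's inequality with exponents \<open>4/3\<close> and \<open>4\<close>.\<close>
  also have "\<dots> \<le> (\<integral>x. l * \<bar>d x\<bar> + \<psi> x ^ 4 / l ^ 3 \<partial>P)"
  proof (intro integral_mono integrable_bdd)
    fix x
    have d1: "\<bar>d x\<bar> \<le> 1" unfolding d_def by (rule diff_avg_le_1)
    have "d x * \<psi> x \<le> \<bar>d x\<bar> * \<bar>\<psi> x\<bar>" by (metis abs_ge_self abs_mult)
    also have "\<dots> \<le> l * \<bar>d x\<bar> + \<psi> x ^ 4 / l ^ 3"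
    proof (cases "\<bar>\<psi> x\<bar> \<le> l")
      case True
      have "\<bar>d x\<bar> * \<bar>\<psi> x\<bar> \<le> \<bar>d x\<bar> * l" using True by (intro mult_left_mono) auto
      moreover have "0 \<le> \<psi> x ^ 4 / l ^ 3" using l by auto
      ultimately show ?thesis by (simp add: mult.commute)
    next
      case False
      have "\<bar>d x\<bar> * \<bar>\<psi> x\<bar> \<le> 1 * \<bar>\<psi> x\<bar>" using d1 by (intro mult_right_mono) auto
      also have "\<dots> \<le> \<bar>\<psi> x\<bar> * (\<bar>\<psi> x\<bar> ^ 3 / l ^ 3)"
        using False l power_mono[of l "\<bar>\<psi> x\<bar>" 3] mult_left_mono[of 1 "\<bar>\<psi> x\<bar> ^ 3 / l ^ 3" "\<bar>\<psi> x\<bar>"]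
        by (simp add: divide_simps)
      also have "\<dots> = \<psi> x ^ 4 / l ^ 3"
      proof -
        have "\<bar>\<psi> x\<bar> * \<bar>\<psi> x\<bar> ^ 3 = \<bar>\<psi> x\<bar> ^ 4" by (simp add: numeral_eq_Suc)
        thus ?thesis by simp
      qed
      finally show ?thesis using l by (auto intro: add_increasing)
    qed
    finally show "d x * \<psi> x \<le> l * \<bar>d x\<bar> + \<psi> x ^ 4 / l ^ 3" .
  qed (use bd in auto)
  also have "\<dots> = l * infl i + (\<integral>x. \<psi> x ^ 4 \<partial>P) / l ^ 3"
    using bd by (subst Bochner_Integration.integral_add) (auto simp: infl_def d_def intro!: integrable_bdd)
  also have "\<dots> \<le> l * infl i + (2048 ^ m * \<tau> * Q) / l ^ 3"
    using 4 l by (intro add_left_mono divide_right_mono) auto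
  also have "\<dots> \<le> l * infl i + Q / 2"
    using mult_right_mono[OF l(2) Q0] l by (simp add: field_simps)
  finally show ?thesis by (simp add: Q_def g_def)
qed

definition uncovered :: "nat set \<Rightarrow> (nat \<Rightarrow> 'a) \<Rightarrow> real" where
  "uncovered S x = of_bool (x \<in> space P \<and> \<not> (\<forall>i\<in>S. covers S i x))"

definition covered :: "nat set \<Rightarrow> (nat \<Rightarrow> 'a) \<Rightarrow> real" where
  "covered S x = of_bool (x \<in> space P \<and> (\<forall>i\<in>S. covers S i x))"

lemma bdd_uncovered: "S \<subseteq> I \<Longrightarrow> bdd (uncovered S)" and bdd_covered: "S \<subseteq> I \<Longrightarrow> bdd (covered S)"
proof -
  assume S: "S \<subseteq> I"
  hence "finite S" by (rule finite_subset_I)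
  hence "Measurable.pred P (\<lambda>x. \<forall>i\<in>S. covers S i x)"
    by (rule pred_intros_finite(3)) (rule measurable_covers[OF S])
  hence *: "{x \<in> space P. \<forall>i\<in>S. covers S i x} \<in> sets P" by (rule predE)
  show "bdd (uncovered S)" unfolding uncovered_def[abs_def]
    by (rule bdd_of_bool[OF sets.sets_Collect_neg[OF *]])
  show "bdd (covered S)" unfolding covered_def[abs_def]
    by (rule bdd_of_bool[OF *])
qed

lemma dep_uncovered: "dep S (uncovered S)" and dep_covered: "dep S (covered S)"
proof -
  have *: "(\<forall>i\<in>S. covers S i x) = (\<forall>i\<in>S. covers S i y)"
    if "x \<in> space P" "y \<in> space P" "\<forall>i\<in>S. x i = y i" for x y
    using covers_cong[of x y S] that by simp
  have **: "uncovered S x = uncovered S y" "covered S x = covered S y"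
    if "x \<in> space P" "y \<in> space P" "\<forall>i\<in>S. x i = y i" for x y
    unfolding uncovered_def covered_def using that(1,2) *[OF that] by (simp_all only: simp_thms)
  show "dep S (uncovered S)" "dep S (covered S)" using ** unfolding dep_def by blast+
qed

text \<open>A set that is not fully covered has an uncovered coordinate, so
  \<open>uncovered S\<close> is at most the sum of \<open>uncov i S\<close> over
  \<open>i \<in> S\<close>.\<close>

lemma uncovered_total:
  assumes l: "0 < l" "2048 ^ m * \<tau> \<le> l ^ 3 / 2"
  shows "(\<Sum>S\<in>low. \<integral>x. (es f S x * uncovered S x)\<^sup>2 \<partial>P) \<le> 2 * l * (\<Sum>i\<in>I. infl i)"
proof -
  have "(\<Sum>S\<in>low. \<integral>x. (es f S x * uncovered S x)\<^sup>2 \<partial>P)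
    \<le> (\<Sum>S\<in>low. \<Sum>i\<in>{i\<in>I. i \<in> S}. \<integral>x. (es f S x * uncov i S x)\<^sup>2 \<partial>P)"
  proof (rule sum_mono)
    fix S assume S: "S \<in> low"
    note SI = low_subset[OF S]
    have b: "bdd (uncov i S)" "bdd (uncovered S)" for i using bdd_uncov[OF SI] bdd_uncovered[OF SI] by auto
    have "(\<integral>x. (es f S x * uncovered S x)\<^sup>2 \<partial>P) \<le> (\<integral>x. (\<Sum>i\<in>{i\<in>I. i \<in> S}. (es f S x * uncov i S x)\<^sup>2) \<partial>P)"
    proof (intro integral_mono integrable_bdd)
      fix x assume x: "x \<in> space P"
      show "(es f S x * uncovered S x)\<^sup>2 \<le> (\<Sum>i\<in>{i\<in>I. i \<in> S}. (es f S x * uncov i S x)\<^sup>2)"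
      proof (cases "\<forall>i\<in>S. covers S i x")
        case True
        thus ?thesis by (auto simp: uncovered_def intro!: sum_nonneg)
      next
        case False
        then obtain i where i: "i \<in> S" "\<not> covers S i x" by auto
        hence "(es f S x * uncovered S x)\<^sup>2 \<le> (es f S x * uncov i S x)\<^sup>2"
          using x by (auto simp: uncovered_def uncov_def)
        also have "\<dots> \<le> (\<Sum>i\<in>{i\<in>I. i \<in> S}. (es f S x * uncov i S x)\<^sup>2)"
          using i SI by (intro member_le_sum) auto
        finally show ?thesis .
      qed
    qed (use b in auto)
    also have "\<dots> = (\<Sum>i\<in>{i\<in>I. i \<in> S}. \<integral>x. (es f S x * uncov i S x)\<^sup>2 \<partial>P)"
      using b by (intro Bochner_Integration.integral_sum integrable_bdd) auto
    finally show "(\<integral>x. (es f S x * uncovered S x)\<^sup>2 \<partial>P) \<le> (\<Sum>i\<in>{i\<in>I. i \<in> S}. \<integral>x. (es f S x * uncov i S x)\<^sup>2 \<partial>P)" .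
  qed
  also have "\<dots> = (\<Sum>i\<in>I. \<Sum>S\<in>{S\<in>low. i \<in> S}. \<integral>x. (es f S x * uncov i S x)\<^sup>2 \<partial>P)"
    by (intro sum.swap_restrict low_finite finite_I)
  also have "\<dots> \<le> (\<Sum>i\<in>I. 2 * l * infl i)"
    by (intro sum_mono uncovered_weight l)
  finally show ?thesis by (simp add: sum_distrib_left)
qed

section \<open>Counting active and covered sets\<close>

lemma active_count:
  assumes V: "V \<subseteq> I"
  shows "(\<Sum>T\<in>{T\<in>low. V \<subseteq> T}. avg (I - V) (act T) x) \<le> 8 ^ m / \<tau>"
proof (cases "{T\<in>low. V \<subseteq> T} = {}")
  case True
  thus ?thesis using \<tau>_pos by (simp only: sum.empty) simp
next
  case False
  then obtain T0 where "T0 \<in> low" "V \<subseteq> T0" by auto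
  hence cV: "card V \<le> m" using low_card[of T0] low_finite_mem[of T0] card_mono[of T0 V] by auto
  let ?a = "\<lambda>S. avg (I - V) (\<lambda>x. (es f S x)\<^sup>2) x"
  have a0: "0 \<le> ?a S" for S by (rule avg_nonneg) simp
  have "(\<Sum>T\<in>{T\<in>low. V \<subseteq> T}. avg (I - V) (act T) x)
    \<le> (\<Sum>T\<in>{T\<in>low. V \<subseteq> T}. (\<Sum>S\<in>{S\<in>{S\<in>low. V \<subseteq> S}. T \<subseteq> S}. ?a S / \<tau>))"
  proof (rule sum_mono)
    fix T assume T: "T \<in> {T\<in>low. V \<subseteq> T}"
    \<comment> \<open>The pointwise form of Markov's inequality.\<close>
    have "act T y \<le> energy T y / \<tau>" for y
      using energy_nonneg[of T y] \<tau>_pos by (auto simp: act_def active_def)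
    hence "avg (I - V) (act T) x \<le> avg (I - V) (\<lambda>y. energy T y / \<tau>) x"
      by (intro avg_mono) auto
    also have "\<dots> = avg (I - V) (energy T) x / \<tau>" by (simp add: avg_divide)
    also have "avg (I - V) (energy T) = avg (I - V) (\<lambda>x. \<Sum>S\<in>{S\<in>low. T \<subseteq> S}. (es f S x)\<^sup>2)"
    proof -
      have "I - V \<union> (I - T) = I - V" using T by auto
      thus ?thesis unfolding energy_def by (simp add: avg_avg)
    qed
    also have "\<dots> x / \<tau> = (\<Sum>S\<in>{S\<in>low. T \<subseteq> S}. ?a S / \<tau>)"
      by (simp add: avg_sum sum_divide_distrib)
    also have "{S\<in>low. T \<subseteq> S} = {S\<in>{S\<in>low. V \<subseteq> S}. T \<subseteq> S}" using T by auto
    finally show "avg (I - V) (act T) x \<le> (\<Sum>S\<in>{S\<in>{S\<in>low. V \<subseteq> S}. T \<subseteq> S}. ?a S / \<tau>)" .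
  qed
  \<comment> \<open>After the exchange, the component on \<open>S\<close> is counted for at most
    \<open>2 ^ m\<close> sets \<open>T \<subseteq> S\<close>, and what remains is the energy of
    \<open>V\<close>, at most \<open>4 ^ m\<close>.\<close>
  also have "\<dots> = (\<Sum>S\<in>{S\<in>low. V \<subseteq> S}. \<Sum>T\<in>{T\<in>{T\<in>low. V \<subseteq> T}. T \<subseteq> S}. ?a S / \<tau>)"
    by (rule sum.swap_restrict) (use low_finite in simp_all)
  also have "\<dots> \<le> (\<Sum>S\<in>{S\<in>low. V \<subseteq> S}. 2 ^ m * (?a S / \<tau>))"
  proof (rule sum_mono)
    fix S assume S: "S \<in> {S\<in>low. V \<subseteq> S}"
    have "card {T\<in>{T\<in>low. V \<subseteq> T}. T \<subseteq> S} \<le> card (Pow S)"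
      using S low_finite_mem by (intro card_mono) auto
    also have "\<dots> = 2 ^ card S" using S low_finite_mem by (simp add: card_Pow)
    also have "\<dots> \<le> 2 ^ m" using S low_card by (simp add: power_increasing)
    finally have "real (card {T\<in>{T\<in>low. V \<subseteq> T}. T \<subseteq> S}) \<le> 2 ^ m"
      using of_nat_le_iff[where 'a = real] by fastforce
    thus "(\<Sum>T\<in>{T\<in>{T\<in>low. V \<subseteq> T}. T \<subseteq> S}. ?a S / \<tau>) \<le> 2 ^ m * (?a S / \<tau>)"
      unfolding sum_constant using a0 \<tau>_pos by (intro mult_right_mono) auto
  qed
  also have "\<dots> = 2 ^ m * energy V x / \<tau>"
    by (simp add: energy_eq sum_distrib_left sum_divide_distrib)
  also have "\<dots> \<le> 2 ^ m * 4 ^ m / \<tau>"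
  proof (intro divide_right_mono mult_left_mono)
    have "energy V x \<le> 4 ^ card V" by (rule energy_le[OF V])
    also have "\<dots> \<le> 4 ^ m" using cV by (simp add: power_increasing)
    finally show "energy V x \<le> 4 ^ m" .
  qed (use \<tau>_pos in auto)
  also have "\<dots> = 8 ^ m / \<tau>" by (simp flip: power_mult_distrib)
  finally show ?thesis .
qed

text \<open>Given \<open>x_W\<close>, the probability that \<open>T\<close> is active depends only
  on \<open>x_V\<close> with \<open>V = W \<inter> T\<close>. Grouping the sets \<open>T\<close> by
  \<open>V\<close> takes at most \<open>2 ^ m\<close> uses of \<open>active_count\<close>.\<close>

lemma active_total:
  assumes W: "W \<in> low"
  shows "(\<Sum>T\<in>low. avg (I - W) (act T) x) \<le> 16 ^ m / \<tau>"
proof -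
  have WI: "W \<subseteq> I" and finW: "finite W" using W low_subset low_finite_mem by auto
  have eq: "avg (I - W) (act T) = avg (I - W \<inter> T) (act T)" if "T \<in> low" for T
  proof -
    have "act T = avg (I - T) (act T)"
      by (rule avg_dep[symmetric, OF _ dep_act]) auto
    hence "avg (I - W) (act T) = avg ((I - W) \<union> (I - T)) (act T)" by (metis avg_avg bdd_act)
    also have "(I - W) \<union> (I - T) = I - W \<inter> T" by auto
    finally show ?thesis .
  qed
  have "(\<Sum>T\<in>low. avg (I - W) (act T) x) = (\<Sum>T\<in>low. avg (I - W \<inter> T) (act T) x)"
    by (intro sum.cong refl) (simp add: eq)
  also have "\<dots> = (\<Sum>V\<in>Pow W. \<Sum>T\<in>{T\<in>low. W \<inter> T = V}. avg (I - W \<inter> T) (act T) x)"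
    using finW by (intro sum.group[symmetric] low_finite) auto
  also have "\<dots> \<le> (\<Sum>V\<in>Pow W. \<Sum>T\<in>{T\<in>low. V \<subseteq> T}. avg (I - V) (act T) x)"
  proof (rule sum_mono)
    fix V assume "V \<in> Pow W"
    have "(\<Sum>T\<in>{T\<in>low. W \<inter> T = V}. avg (I - W \<inter> T) (act T) x) = (\<Sum>T\<in>{T\<in>low. W \<inter> T = V}. avg (I - V) (act T) x)"
      by (intro sum.cong) auto
    also have "\<dots> \<le> (\<Sum>T\<in>{T\<in>low. V \<subseteq> T}. avg (I - V) (act T) x)"
      using low_finite by (intro sum_mono2) (auto simp: act_def intro!: avg_nonneg)
    finally show "(\<Sum>T\<in>{T\<in>low. W \<inter> T = V}. avg (I - W \<inter> T) (act T) x) \<le> (\<Sum>T\<in>{T\<in>low. V \<subseteq> T}. avg (I - V) (act T) x)" .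
  qed
  also have "\<dots> \<le> (\<Sum>V\<in>Pow W. 8 ^ m / \<tau>)"
    using WI by (intro sum_mono active_count) auto
  also have "\<dots> = 2 ^ card W * (8 ^ m / \<tau>)" using finW by (simp add: card_Pow)
  also have "\<dots> \<le> 2 ^ m * (8 ^ m / \<tau>)"
    using W low_card \<tau>_pos by (intro mult_right_mono) (auto simp: power_increasing)
  also have "\<dots> = 16 ^ m / \<tau>" by (simp flip: power_mult_distrib)
  finally show ?thesis .
qed

text \<open>Counts the ways to write \<open>S\<close> as a union of at most \<open>r\<close> active sets.\<close>

fun covering_count :: "nat \<Rightarrow> nat set \<Rightarrow> (nat \<Rightarrow> 'a) \<Rightarrow> real" where
  "covering_count 0 S x = of_bool (x \<in> space P \<and> S = {})"
| "covering_count (Suc r) S x = covering_count r S x +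
     (\<Sum>p\<in>{p\<in>low \<times> low. fst p \<union> snd p = S}. covering_count r (fst p) x * act (snd p) x)"

lemma bdd_covering_count [simp, intro!]: "bdd (covering_count r S)"
proof (induction r arbitrary: S)
  case 0
  have "bdd (\<lambda>x. of_bool (x \<in> space P \<and> S = {}))" by (rule bdd_of_bool) simp
  thus ?case by simp
next
  case (Suc r)
  thus ?case by (simp add: case_prod_unfold)
qed

lemma covering_count_nonneg: "0 \<le> covering_count r S x"
  by (induction r arbitrary: S) (auto intro!: add_nonneg_nonneg sum_nonneg mult_nonneg_nonneg simp: act_def)

lemma dep_covering_count: "dep S (covering_count r S)"
proof (induction r arbitrary: S)
  case 0
  show ?case by (simp add: dep_def)
next
  case (Suc r)
  have "dep S (\<lambda>x. covering_count r (fst p) x * act (snd p) x)" if "fst p \<union> snd p = S" for p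
    using that by (intro dep_mult dep_mono[OF Suc] dep_mono[OF dep_act]) auto
  hence "dep S (\<lambda>x. covering_count r S x + (\<Sum>p\<in>{p\<in>low \<times> low. fst p \<union> snd p = S}. covering_count r (fst p) x * act (snd p) x))"
    by (intro dep_add Suc dep_sum) auto
  thus ?case by simp
qed

text \<open>The count for \<open>W\<close> is a function of \<open>x_W\<close>, so conditioning on
  \<open>x_W\<close> lets \<open>active_total\<close> bound the effect of adjoining one more active
  set. The summand 1 accounts for adjoining none.\<close>

lemma covering_count_total:
  "(\<Sum>S\<in>low. \<integral>x. covering_count r S x \<partial>P) \<le> (1 + 16 ^ m / \<tau>) ^ r"
proof (induction r)
  case 0
  have *: "(\<integral>x. covering_count 0 S x \<partial>P) = of_bool (S = {})" for S
  proof -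
    have "(\<integral>x. covering_count 0 S x \<partial>P) = (\<integral>x. of_bool (S = {}) \<partial>P)"
      by (intro Bochner_Integration.integral_cong) auto
    thus ?thesis by (simp add: P.prob_space)
  qed
  have "(\<Sum>S\<in>low. \<integral>x. covering_count 0 S x \<partial>P) = (if {} \<in> low then 1 else 0)"
    unfolding * using low_finite by (simp add: of_bool_def)
  also have "\<dots> \<le> 1" by simp
  finally show ?case by simp
next
  case (Suc r)
  let ?c = "covering_count r"
  have W: "(\<Sum>T\<in>low. \<integral>x. ?c W x * act T x \<partial>P) \<le> 16 ^ m / \<tau> * (\<integral>x. ?c W x \<partial>P)" if "W \<in> low" for W
  proof -
    have "(\<Sum>T\<in>low. \<integral>x. ?c W x * act T x \<partial>P) = (\<Sum>T\<in>low. \<integral>x. avg (I - W) (\<lambda>x. ?c W x * act T x) x \<partial>P)"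
      by (simp add: integral_avg)
    also have "\<dots> = (\<Sum>T\<in>low. \<integral>x. ?c W x * avg (I - W) (act T) x \<partial>P)"
      using avg_dep_mult[OF dep_covering_count[of W r], of "I - W"] by (simp add: Int_commute)
    also have "\<dots> = (\<integral>x. (\<Sum>T\<in>low. ?c W x * avg (I - W) (act T) x) \<partial>P)"
      by (intro Bochner_Integration.integral_sum[symmetric] integrable_bdd) auto
    also have "\<dots> \<le> (\<integral>x. 16 ^ m / \<tau> * ?c W x \<partial>P)"
    proof (intro integral_mono integrable_bdd)
      fix x
      have "?c W x * (\<Sum>T\<in>low. avg (I - W) (act T) x) \<le> ?c W x * (16 ^ m / \<tau>)"
        by (intro mult_left_mono active_total that covering_count_nonneg)
      thus "(\<Sum>T\<in>low. ?c W x * avg (I - W) (act T) x) \<le> 16 ^ m / \<tau> * ?c W x"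
        by (simp add: sum_distrib_left mult.commute)
    qed auto
    finally show ?thesis by simp
  qed
  let ?h = "\<lambda>p. \<integral>x. ?c (fst p) x * act (snd p) x \<partial>P"
  have h0: "0 \<le> ?h p" for p
    by (intro integral_nonneg_AE AE_I2 mult_nonneg_nonneg covering_count_nonneg) (simp add: act_def)
  have fin: "finite (low \<times> low)" using low_finite by simp
  \<comment> \<open>Admitting unions of more than \<open>m\<close> elements adds only nonnegative
    terms and lets every pair be grouped by its union.\<close>
  have "(\<Sum>S\<in>low. \<Sum>p\<in>{p\<in>low \<times> low. fst p \<union> snd p = S}. ?h p)
    \<le> (\<Sum>S\<in>Pow I. \<Sum>p\<in>{p\<in>low \<times> low. fst p \<union> snd p = S}. ?h p)"
  proof (rule sum_mono2)
    show "low \<subseteq> Pow I" using low_subset by blast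
  qed (simp_all add: sum_nonneg h0)
  also have "\<dots> = (\<Sum>p\<in>low \<times> low. ?h p)"
  proof (rule sum.group[OF fin])
    show "(\<lambda>p. fst p \<union> snd p) ` (low \<times> low) \<subseteq> Pow I" using low_subset by fastforce
  qed simp
  also have "\<dots> = (\<Sum>W\<in>low. \<Sum>T\<in>low. \<integral>x. ?c W x * act T x \<partial>P)"
    by (simp only: sum.cartesian_product case_prod_unfold)
  also have "\<dots> \<le> (\<Sum>W\<in>low. 16 ^ m / \<tau> * (\<integral>x. ?c W x \<partial>P))"
    by (intro sum_mono W)
  also have "\<dots> = 16 ^ m / \<tau> * (\<Sum>W\<in>low. \<integral>x. ?c W x \<partial>P)"
    by (simp only: sum_distrib_left)
  finally have step: "(\<Sum>S\<in>low. \<Sum>p\<in>{p\<in>low \<times> low. fst p \<union> snd p = S}. ?h p)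
    \<le> 16 ^ m / \<tau> * (\<Sum>W\<in>low. \<integral>x. ?c W x \<partial>P)" .
  have "(\<integral>x. covering_count (Suc r) S x \<partial>P) = (\<integral>x. ?c S x \<partial>P) + (\<Sum>p\<in>{p\<in>low \<times> low. fst p \<union> snd p = S}. ?h p)" for S
    unfolding covering_count.simps
    by (subst Bochner_Integration.integral_add, (intro integrable_bdd bdd_sum bdd_mult bdd_covering_count bdd_act)+)
      (subst Bochner_Integration.integral_sum, (intro integrable_bdd bdd_mult bdd_covering_count bdd_act refl)+)
  hence "(\<Sum>S\<in>low. \<integral>x. covering_count (Suc r) S x \<partial>P)
    = (\<Sum>S\<in>low. \<integral>x. ?c S x \<partial>P) + (\<Sum>S\<in>low. \<Sum>p\<in>{p\<in>low \<times> low. fst p \<union> snd p = S}. ?h p)"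
    by (simp only: sum.distrib)
  hence "(\<Sum>S\<in>low. \<integral>x. covering_count (Suc r) S x \<partial>P) \<le> (1 + 16 ^ m / \<tau>) * (\<Sum>S\<in>low. \<integral>x. ?c S x \<partial>P)"
    using step by (simp only: distrib_right)
  also have "\<dots> \<le> (1 + 16 ^ m / \<tau>) * (1 + 16 ^ m / \<tau>) ^ r"
    using Suc \<tau>_pos by (intro mult_left_mono) (auto intro!: add_nonneg_nonneg)
  finally show ?case by simp
qed

text \<open>Active subsets of \<open>S\<close> are adjoined one for each element of
  \<open>S\<close>: at most \<open>m\<close> steps suffice and the union never leaves
  \<open>S\<close>.\<close>

lemma covered_le_covering_count:
  assumes S: "S \<in> low" shows "covered S x \<le> covering_count m S x"
proof (cases "x \<in> space P \<and> (\<forall>i\<in>S. covers S i x)")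
  case True
  \<comment> \<open>The induction runs over the elements \<open>A\<close> already treated; the union
    \<open>W\<close> may be larger than \<open>A\<close>, since an active set brings further
    elements.\<close>
  have "\<exists>W. A \<subseteq> W \<and> W \<subseteq> S \<and> 1 \<le> covering_count r W x" if "A \<subseteq> S" "card A \<le> r" for A r
    using that
  proof (induction r arbitrary: A)
    case 0
    hence "A = {}" using low_finite_mem[OF S] finite_subset[of A S] by auto
    thus ?case using True by (intro exI[of _ "{}"]) auto
  next
    case (Suc r)
    have mono: "covering_count r W x \<le> covering_count (Suc r) W x" for W
      by (simp add: sum_nonneg covering_count_nonneg act_def)
    show ?case
    proof (cases "A = {}")
      case True
      hence "\<exists>W. A \<subseteq> W \<and> W \<subseteq> S \<and> 1 \<le> covering_count r W x" using Suc.IH[of "{}"] by simp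
      thus ?thesis using mono order_trans by blast
    next
      case False
      then obtain i where i: "i \<in> A" by auto
      have finA: "finite A" using low_finite_mem[OF S] finite_subset Suc.prems by auto
      have "card (A - {i}) \<le> r" using i finA Suc.prems by (simp add: card_Diff_singleton)
      then obtain W where W: "A - {i} \<subseteq> W" "W \<subseteq> S" "1 \<le> covering_count r W x"
        using Suc.IH[of "A - {i}"] Suc.prems by auto
      obtain T where T: "T \<subseteq> S" "i \<in> T" "active T x"
        using True i Suc.prems unfolding covers_def by blast
      have WT: "W \<in> low" "T \<in> low" using low_mono[OF S] W T by auto
      have "1 \<le> covering_count r W x * act T x" using W T True by (simp add: act_def)
      also have "\<dots> = (\<lambda>p. covering_count r (fst p) x * act (snd p) x) (W, T)" by simp
      also have "\<dots> \<le> (\<Sum>p\<in>{p\<in>low \<times> low. fst p \<union> snd p = W \<union> T}. covering_count r (fst p) x * act (snd p) x)"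
        using low_finite WT
        by (intro member_le_sum mult_nonneg_nonneg covering_count_nonneg) (auto simp: act_def)
      also have "\<dots> \<le> covering_count (Suc r) (W \<union> T) x" by (simp add: covering_count_nonneg)
      finally show ?thesis using W T i by (intro exI[of _ "W \<union> T"]) auto
    qed
  qed
  from this[of S m] obtain W where "S \<subseteq> W" "W \<subseteq> S" "1 \<le> covering_count m W x"
    using low_card[OF S] by auto
  hence "1 \<le> covering_count m S x" by (metis subset_antisym)
  thus ?thesis by (simp add: covered_def)
qed (use covering_count_nonneg in \<open>auto simp: covered_def\<close>)

lemma covered_total: "(\<Sum>S\<in>low. \<integral>x. covered S x \<partial>P) \<le> (1 + 16 ^ m / \<tau>) ^ m"
proof -
  have "(\<Sum>S\<in>low. \<integral>x. covered S x \<partial>P) \<le> (\<Sum>S\<in>low. \<integral>x. covering_count m S x \<partial>P)"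
    by (intro sum_mono integral_mono integrable_bdd covered_le_covering_count bdd_covered low_subset) auto
  thus ?thesis using covering_count_total[of m] by linarith
qed

section \<open>Weights by degree and assembly of the approximation\<close>

lemma weight_by_degree: "(\<Sum>S\<in>Pow I. real (card S) * (\<integral>x. (es f S x)\<^sup>2 \<partial>P)) \<le> (\<Sum>i\<in>I. infl i)"
proof -
  have "(\<Sum>S\<in>Pow I. real (card S) * (\<integral>x. (es f S x)\<^sup>2 \<partial>P)) = (\<Sum>S\<in>Pow I. \<Sum>i\<in>{i\<in>I. i \<in> S}. \<integral>x. (es f S x)\<^sup>2 \<partial>P)"
    by (intro sum.cong refl) (auto simp: Collect_conj_eq Int_absorb1)
  also have "\<dots> = (\<Sum>i\<in>I. \<Sum>S\<in>{S\<in>Pow I. i \<in> S}. \<integral>x. (es f S x)\<^sup>2 \<partial>P)"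
    by (intro sum.swap_restrict) auto
  also have "\<dots> \<le> (\<Sum>i\<in>I. infl i)"
  proof (rule sum_mono)
    fix i assume i: "i \<in> I"
    \<comment> \<open>The orthogonal components on sets containing \<open>i\<close> add up to
      \<open>f - avg {i} f\<close>.\<close>
    have "(\<Sum>S\<in>{S\<in>Pow I. i \<in> S}. \<integral>x. (es f S x)\<^sup>2 \<partial>P) = (\<integral>x. (\<Sum>S\<in>{S\<in>Pow I. i \<in> S}. es f S x)\<^sup>2 \<partial>P)"
      by (intro integral_canonical_sum_square[symmetric]) (auto intro!: canonical_es)
    also have "(\<lambda>x. \<Sum>S\<in>{S\<in>Pow I. i \<in> S}. es f S x) = proj {i} (\<lambda>x. \<Sum>S\<in>Pow I. 1 * es f S x)"
      using i by (subst proj_canonical_sum) (auto intro!: canonical_es)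
    also have "(\<lambda>x. \<Sum>S\<in>Pow I. 1 * es f S x) = f" using efron_stein[OF bdd_f] by simp
    also have "proj {i} f = (\<lambda>x. f x - avg {i} f x)" by (simp add: mix_insert)
    also have "(\<integral>x. (f x - avg {i} f x)\<^sup>2 \<partial>P) \<le> infl i" unfolding infl_def
    proof (intro integral_mono integrable_bdd)
      show "(f x - avg {i} f x)\<^sup>2 \<le> \<bar>f x - avg {i} f x\<bar>" for x
        using diff_avg_le_1[of x "{i}"] mult_left_mono[of "\<bar>f x - avg {i} f x\<bar>" 1 "\<bar>f x - avg {i} f x\<bar>"]
        by (simp add: power2_eq_square)
    qed auto
    finally show "(\<Sum>S\<in>{S\<in>Pow I. i \<in> S}. \<integral>x. (es f S x)\<^sup>2 \<partial>P) \<le> infl i" .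
  qed
  finally show ?thesis .
qed

lemma high_degree_weight: "(\<integral>x. (\<Sum>S\<in>Pow I - low. es f S x)\<^sup>2 \<partial>P) \<le> (\<Sum>i\<in>I. infl i) / (real m + 1)"
proof -
  have "(real m + 1) * (\<Sum>S\<in>Pow I - low. \<integral>x. (es f S x)\<^sup>2 \<partial>P)
     \<le> (\<Sum>S\<in>Pow I - low. real (card S) * (\<integral>x. (es f S x)\<^sup>2 \<partial>P))"
    unfolding sum_distrib_left
    by (intro sum_mono mult_right_mono integral_nonneg_AE) (auto simp: low_def)
  also have "\<dots> \<le> (\<Sum>S\<in>Pow I. real (card S) * (\<integral>x. (es f S x)\<^sup>2 \<partial>P))"
    by (intro sum_mono2) auto
  also note weight_by_degree
  also have "(\<Sum>S\<in>Pow I - low. \<integral>x. (es f S x)\<^sup>2 \<partial>P) = (\<integral>x. (\<Sum>S\<in>Pow I - low. es f S x)\<^sup>2 \<partial>P)"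
    by (intro integral_canonical_sum_square[symmetric]) (auto intro!: canonical_es)
  finally show ?thesis by (simp add: field_simps)
qed

lemma integral_sum_es_square_le: "(\<Sum>S\<in>low. \<integral>x. (es f S x)\<^sup>2 \<partial>P) \<le> 1"
proof -
  have "(\<Sum>S\<in>low. \<integral>x. (es f S x)\<^sup>2 \<partial>P) \<le> (\<Sum>S\<in>Pow I. \<integral>x. (es f S x)\<^sup>2 \<partial>P)"
    using low_subset by (intro sum_mono2) auto
  also have "\<dots> = (\<integral>x. (\<Sum>S\<in>Pow I. es f S x)\<^sup>2 \<partial>P)"
    by (intro integral_canonical_sum_square[symmetric]) (auto intro!: canonical_es)
  also have "\<dots> = (\<integral>x. (f x)\<^sup>2 \<partial>P)" by (simp add: efron_stein)
  also have "\<dots> \<le> 1"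
  proof (rule P.integral_le_const[OF integrable_bdd])
    have "(f x)\<^sup>2 \<le> 1" for x using f_01[of x] by auto
    thus "AE x in P. (f x)\<^sup>2 \<le> 1" by simp
  qed auto
  finally show ?thesis .
qed

text \<open>The three errors come from degrees above \<open>m\<close>, from the recentred uncovered
  parts and from truncating the recentred covered parts; the factor 3 is that of squaring a sum of
  three. In \<open>B\<close>, the factor \<open>2 ^ m\<close> pays for redistribution, the 1 for the
  energy of \<open>f\<close>, and the power for the expected number of covered sets.\<close>

theorem local_family_approximation:
  fixes l t :: real
  defines "B \<equiv> 2 ^ m * (1 + (1 + 16 ^ m / \<tau>) ^ m)"
  assumes l: "0 < l" "2048 ^ m * \<tau> \<le> l ^ 3 / 2" and t: "0 < t"
  shows "\<exists>v. local_family v \<and> support_cost v \<le> B / t * 2 ^ (m * (m + 3)) \<and>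
    (\<integral>x. (f x - (\<Sum>S\<in>Pow I. v S x))\<^sup>2 \<partial>P)
      \<le> 3 * ((\<Sum>i\<in>I. infl i) / (real m + 1) + 2 * l * (\<Sum>i\<in>I. infl i) + t * B * 2 ^ (m * (m + 3)))"
proof -
  define q where "q = (\<lambda>S x. es f S x * covered S x)"
  define p where "p = (\<lambda>S x. es f S x * uncovered S x)"
  have low: "low \<subseteq> Pow I" using low_subset by blast
  have qb: "bdd (q S)" "dep S (q S)" and pb: "bdd (p S)" "dep S (p S)" if "S \<in> low" for S
    using low_subset[OF that] unfolding q_def p_def
    by (auto intro!: dep_mult dep_es dep_covered dep_uncovered bdd_covered bdd_uncovered bdd_mult)
  define u where "u = redist low q"
  have uL: "local_family u" unfolding local_family_def u_def
    using qb low by (auto intro!: bdd_redist dep_redist)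
  have u0: "u S = (\<lambda>x. 0)" if S: "S \<subseteq> I" "m < card S" for S
  proof -
    have "\<not> S \<subseteq> T" if "T \<in> low" for T
      using card_mono[of T S] low_card[OF that] low_finite_mem[OF that] S by auto
    hence "{T \<in> low. S \<subseteq> T} = {}" by blast
    thus ?thesis unfolding u_def redist_def by (simp only: sum.empty)
  qed
  have uB: "(\<Sum>S\<in>Pow I. \<integral>x. \<bar>u S x\<bar> \<partial>P) \<le> B"
  proof -
    have "(\<Sum>S\<in>Pow I. \<integral>x. \<bar>u S x\<bar> \<partial>P) \<le> (\<Sum>S\<in>low. 2 ^ card S * (\<integral>x. \<bar>q S x\<bar> \<partial>P))"
      unfolding u_def using qb low by (intro redist_total) auto
    also have "\<dots> \<le> (\<Sum>S\<in>low. 2 ^ m * ((\<integral>x. (es f S x)\<^sup>2 \<partial>P) + (\<integral>x. covered S x \<partial>P)))"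
    proof (intro sum_mono mult_mono)
      fix S assume S: "S \<in> low"
      note cb = bdd_covered[OF low_subset[OF S]]
      have "(\<integral>x. \<bar>q S x\<bar> \<partial>P) \<le> (\<integral>x. (es f S x)\<^sup>2 + covered S x \<partial>P)"
      proof (intro integral_mono integrable_bdd bdd_abs qb S bdd_add cb bdd_power)
        fix x
        \<comment> \<open>The bound \<open>\<bar>y\<bar> \<le> y\<^sup>2 + 1\<close> on the covered
          event replaces an L1 norm by an energy plus a probability, both of which have bounded sums
          over \<open>S\<close>.\<close>
        have "0 \<le> (\<bar>es f S x\<bar> - 1)\<^sup>2 + es f S x * es f S x" by simp
        hence "\<bar>es f S x\<bar> \<le> (es f S x)\<^sup>2 + 1"
          using zero_le_power2[of "es f S x"] unfolding power2_diff by (simp add: power2_eq_square)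
        thus "\<bar>q S x\<bar> \<le> (es f S x)\<^sup>2 + covered S x"
          by (cases "covered S x = 0") (auto simp: q_def covered_def)
      qed auto
      also have "\<dots> = (\<integral>x. (es f S x)\<^sup>2 \<partial>P) + (\<integral>x. covered S x \<partial>P)"
        using cb by (intro Bochner_Integration.integral_add integrable_bdd) auto
      finally show "(\<integral>x. \<bar>q S x\<bar> \<partial>P) \<le> (\<integral>x. (es f S x)\<^sup>2 \<partial>P) + (\<integral>x. covered S x \<partial>P)" .
      show "(2::real) ^ card S \<le> 2 ^ m" using low_card[OF S] by (intro power_increasing) auto
    qed (auto intro!: integral_nonneg_AE)
    also have "\<dots> = 2 ^ m * ((\<Sum>S\<in>low. \<integral>x. (es f S x)\<^sup>2 \<partial>P) + (\<Sum>S\<in>low. \<integral>x. covered S x \<partial>P))"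
      by (simp only: sum_distrib_left[symmetric] sum.distrib)
    also have "\<dots> \<le> B" unfolding B_def
      by (intro mult_left_mono add_mono integral_sum_es_square_le covered_total) simp
    finally show ?thesis .
  qed
  obtain v where v: "local_family v" "support_cost v \<le> B / t * 2 ^ (m * (m + 3))"
    "(\<integral>x. ((\<Sum>S\<in>Pow I. u S x) - (\<Sum>S\<in>Pow I. v S x))\<^sup>2 \<partial>P) \<le> t * B * 2 ^ (m * (m + 3))"
    using truncation[OF t uL u0 uB] by blast
  define a where "a = (\<lambda>x. \<Sum>S\<in>Pow I - low. es f S x)"
  define b where "b = (\<lambda>x. \<Sum>S\<in>low. proj S (p S) x)"
  define c where "c = (\<lambda>x. (\<Sum>S\<in>Pow I. u S x) - (\<Sum>S\<in>Pow I. v S x))"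
  have bd: "bdd a" "bdd b" "bdd c"
    unfolding a_def b_def c_def using pb local_familyD(1)[OF uL] local_familyD(1)[OF v(1)]
    by (auto intro!: bdd_sum bdd_diff)
  have split: "f x - (\<Sum>S\<in>Pow I. v S x) = a x + b x + c x" for x
  proof -
    \<comment> \<open>\<open>proj S\<close> fixes the canonical function \<open>es f S\<close>, so
      recentring its two parts separately preserves their sum.\<close>
    have "es f S x = proj S (p S) x + proj S (q S) x" if S: "S \<in> low" for S x
    proof (cases "x \<in> space P")
      case True
      have "es f S = (\<lambda>y. p S y + q S y)"
      proof
        fix y show "es f S y = p S y + q S y"
          using bddD(2)[OF bdd_es[OF bdd_f]]
          by (cases "y \<in> space P") (auto simp: p_def q_def covered_def uncovered_def)
      qed
      hence "proj S (es f S) = (\<lambda>x. proj S (p S) x + proj S (q S) x)"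
        using pb[OF S] qb[OF S] by (simp add: mix_add)
      thus ?thesis
        using proj_canonical[OF canonical_es[OF bdd_f low_subset[OF S]] low_subset[OF S] low_subset[OF S]]
        by (metis order_refl)
    next
      case False
      thus ?thesis using bddD(2)[OF bdd_es[OF bdd_f]] bddD(2)[OF bdd_mix[OF pb(1)[OF S]]]
          bddD(2)[OF bdd_mix[OF qb(1)[OF S]]] by simp
    qed
    hence "(\<Sum>S\<in>low. es f S x) = b x + (\<Sum>S\<in>low. proj S (q S) x)"
      unfolding b_def by (simp add: sum.distrib)
    also have "(\<Sum>S\<in>low. proj S (q S) x) = (\<Sum>S\<in>Pow I. u S x)"
      unfolding u_def by (rule sum_redist[symmetric, OF low]) (use qb in auto)
    finally have "(\<Sum>S\<in>low. es f S x) = b x + (\<Sum>S\<in>Pow I. u S x)" .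
    moreover have "(\<Sum>S\<in>Pow I. es f S x) = a x + (\<Sum>S\<in>low. es f S x)"
      unfolding a_def using low by (intro sum.subset_diff) auto
    hence "f x = a x + (\<Sum>S\<in>low. es f S x)" by (simp add: efron_stein)
    ultimately show ?thesis by (simp add: c_def)
  qed
  have "(\<integral>x. (f x - (\<Sum>S\<in>Pow I. v S x))\<^sup>2 \<partial>P) \<le> (\<integral>x. 3 * ((a x)\<^sup>2 + (b x)\<^sup>2 + (c x)\<^sup>2) \<partial>P)"
    unfolding split
  proof (intro integral_mono integrable_bdd)
    fix x
    have "3 * ((a x)\<^sup>2 + (b x)\<^sup>2 + (c x)\<^sup>2) - (a x + b x + c x)\<^sup>2 = (a x - b x)\<^sup>2 + (b x - c x)\<^sup>2 + (a x - c x)\<^sup>2"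
      by (simp add: power2_eq_square algebra_simps)
    moreover have "0 \<le> (a x - b x)\<^sup>2 + (b x - c x)\<^sup>2 + (a x - c x)\<^sup>2" by simp
    ultimately show "(a x + b x + c x)\<^sup>2 \<le> 3 * ((a x)\<^sup>2 + (b x)\<^sup>2 + (c x)\<^sup>2)" by linarith
  qed (use bd in auto)
  also have "\<dots> = 3 * ((\<integral>x. (a x)\<^sup>2 \<partial>P) + (\<integral>x. (b x)\<^sup>2 \<partial>P) + (\<integral>x. (c x)\<^sup>2 \<partial>P))"
    using bd by (simp add: integrable_bdd)
  also have "\<dots> \<le> 3 * ((\<Sum>i\<in>I. infl i) / (real m + 1) + 2 * l * (\<Sum>i\<in>I. infl i) + t * B * 2 ^ (m * (m + 3)))"
  proof (intro mult_left_mono add_mono)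
    show "(\<integral>x. (a x)\<^sup>2 \<partial>P) \<le> (\<Sum>i\<in>I. infl i) / (real m + 1)"
      unfolding a_def by (rule high_degree_weight)
    have "(\<integral>x. (b x)\<^sup>2 \<partial>P) \<le> (\<Sum>S\<in>low. \<integral>x. (p S x)\<^sup>2 \<partial>P)"
      unfolding b_def using low pb by (intro integral_proj_sum_square_le) auto
    also have "\<dots> \<le> 2 * l * (\<Sum>i\<in>I. infl i)"
      unfolding p_def by (rule uncovered_total[OF l])
    finally show "(\<integral>x. (b x)\<^sup>2 \<partial>P) \<le> 2 * l * (\<Sum>i\<in>I. infl i)" .
    show "(\<integral>x. (c x)\<^sup>2 \<partial>P) \<le> t * B * 2 ^ (m * (m + 3))" unfolding c_def by (rule v(3))
  qed simp
  finally show ?thesis using v(1,2) by blast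
qed

text \<open>The absolute value is moved inside the average over the resampled coordinate, where a
  difference of 0-1 values becomes the indicator of disagreement. Two functions occur because
  \<open>f\<close> has to vanish outside the space.\<close>

lemma infl_le_influence:
  assumes I: "I = {1..n}" and g: "\<And>x. x \<in> space P \<Longrightarrow> g x = f x"
  shows "infl i \<le> influence M n g i"
proof -
  have upd: "x(i := y i) = override_on x y {i}" for x y :: "nat \<Rightarrow> 'a"
    by (auto simp: override_on_def)
  define A where "A = {z \<in> space (P \<Otimes>\<^sub>M P). f (fst z) \<noteq> f (case z of (x, y) \<Rightarrow> override_on x y {i})}"
  have [measurable]: "f \<in> borel_measurable P" using bdd_f by (rule bddD)
  have m1: "(\<lambda>z. f (case z of (x, y) \<Rightarrow> override_on x y {i})) \<in> borel_measurable (P \<Otimes>\<^sub>M P)"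
    by (rule measurable_compose[OF measurable_override_on]) simp
  have A: "A \<in> sets (P \<Otimes>\<^sub>M P)" unfolding A_def using m1 by measurable
  have infl_eq: "influence M n g i = measure (P \<Otimes>\<^sub>M P) A"
    unfolding influence_def Let_def I[symmetric] A_def
    by (intro arg_cong2[where f = measure] refl)
      (auto simp: space_pair_measure g override_on_space upd)
  have int: "integrable (P \<Otimes>\<^sub>M P) (indicator A :: _ \<Rightarrow> real)"
    by (rule integrable_real_indicator[OF A]) (simp add: less_top[symmetric])
  have "infl i \<le> (\<integral>x. \<integral>y. indicator A (x, y) \<partial>P \<partial>P)"
    unfolding infl_def
  proof (rule integral_mono)
    show "integrable P (\<lambda>x. \<bar>f x - avg {i} f x\<bar>)" by (intro integrable_bdd) auto
    show "integrable P (\<lambda>x. \<integral>y. (indicator A (x, y) :: real) \<partial>P)"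
      using PP.integrable_fst'[OF int] by simp
    fix x assume x: "x \<in> space P"
    have i1: "integrable P (\<lambda>y. f x - f (override_on x y {i}))"
      using integrable_override_on[OF bdd_f x] by simp
    have i2: "integrable P (\<lambda>y. indicator A (x, y) :: real)"
    proof (rule P.integrable_const_bound[of _ 1])
      show "(\<lambda>y. indicator A (x, y) :: real) \<in> borel_measurable P"
        by (rule measurable_compose[OF measurable_Pair1'[OF x]]) (use A in simp)
    qed (auto simp: indicator_def)
    have "f x - avg {i} f x = (\<integral>y. f x - f (override_on x y {i}) \<partial>P)"
      using x integrable_override_on[OF bdd_f x] by (simp add: avg_def P.prob_space)
    hence "\<bar>f x - avg {i} f x\<bar> \<le> (\<integral>y. \<bar>f x - f (override_on x y {i})\<bar> \<partial>P)"
      by (simp only: integral_abs_bound)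
    also have "\<dots> \<le> (\<integral>y. indicator A (x, y) \<partial>P)"
    proof (intro integral_mono integrable_abs i1 i2)
      fix y assume "y \<in> space P"
      thus "\<bar>f x - f (override_on x y {i})\<bar> \<le> indicator A (x, y)"
        using f_01[of x] f_01[of "override_on x y {i}"] x by (auto simp: indicator_def A_def space_pair_measure)
    qed
    finally show "\<bar>f x - avg {i} f x\<bar> \<le> (\<integral>y. indicator A (x, y) \<partial>P)" .
  qed
  also have "\<dots> = (\<integral>z. indicator A z \<partial>(P \<Otimes>\<^sub>M P))"
    using PP.integral_fst'[OF int] by (simp add: split_beta')
  also have "\<dots> = measure (P \<Otimes>\<^sub>M P) A" using A by simp
  finally show ?thesis by (simp add: infl_eq)
qed

end

subsection \<open>The structure theorem\<close>

text \<open>The cost equals \<open>36 * (B * Z)\<^sup>2 / \<epsilon>\<close>. Here \<open>B\<close>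
  is at most \<open>2 ^ (21 * (m * m))\<close>, \<open>Z\<close> at most
  \<open>2 ^ (4 * (m * m))\<close>, and \<open>36 / \<epsilon>\<close> at most
  \<open>2 ^ (m * m)\<close>, which makes the exponent \<open>51 * (m * m)\<close> with
  \<open>m \<le> 37 * N\<close>.\<close>

lemma structure_constants:
  fixes N \<epsilon> :: real and m :: nat
  defines "B \<equiv> 2 ^ m * (1 + (1 + 16 ^ m / ((1 / (72 * N)) ^ 3 / (2 * 2048 ^ m))) ^ m)"
  defines "Z \<equiv> 2 ^ (m * (m + 3))"
  assumes N: "1 \<le> N" and \<epsilon>: "0 < \<epsilon>" "1 / \<epsilon> \<le> N" and m: "36 * N \<le> real m" "real m \<le> 36 * N + 1"
  shows "B / (\<epsilon> / (36 * B * Z)) * Z \<le> exp (10 ^ 15 * N ^ 3)"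
proof -
  have m12: "12 \<le> m" using N m(1) by linarith
  have m2: "real m \<le> 2 ^ m" using of_nat_less_two_power[of m, where 'a = real] by simp
  have sq: "m \<le> m * m" "1 \<le> m * m" using m12 by auto
  have "16 ^ m / ((1 / (72 * N)) ^ 3 / (2 * 2048 ^ m)) = (16 * 2048) ^ m * 2 * (72 * N) ^ 3"
    using N unfolding power_mult_distrib by (simp add: power_divide)
  also have "\<dots> \<le> (2 ^ 15) ^ m * 2 * (2 * 2 ^ m) ^ 3"
  proof -
    have "72 * N \<le> 2 * 2 ^ m" using m m2 by linarith
    hence "(72 * N) ^ 3 \<le> (2 * 2 ^ m) ^ 3" using N by (intro power_mono) auto
    thus ?thesis by simp
  qed
  also have "\<dots> = 2 ^ (18 * m + 4)"
  proof -
    have "((2::real) ^ 15) ^ m = 2 ^ (15 * m)" "((2::real) ^ m) ^ 3 = 2 ^ (3 * m)"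
      by (simp_all only: power_mult[symmetric] mult.commute)
    moreover have "(2::real) ^ (18 * m + 4) = 2 ^ (15 * m + (1 + (3 + 3 * m)))"
      by (rule arg_cong[where f = "\<lambda>k. 2 ^ k"]) simp
    ultimately show ?thesis by (simp only: power_mult_distrib power_add power_one_right mult.assoc)
  qed
  finally have q: "16 ^ m / ((1 / (72 * N)) ^ 3 / (2 * 2048 ^ m)) \<le> 2 ^ (18 * m + 4)" .
  have "(1::real) \<le> 2 ^ (18 * m + 4)" by (rule one_le_power) simp
  hence "1 + 16 ^ m / ((1 / (72 * N)) ^ 3 / (2 * 2048 ^ m)) \<le> 2 ^ Suc (18 * m + 4)"
    using q unfolding power_Suc by linarith
  also have "\<dots> \<le> 2 ^ (19 * m)" using m12 by (intro power_increasing) auto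
  finally have "(1 + 16 ^ m / ((1 / (72 * N)) ^ 3 / (2 * 2048 ^ m))) ^ m \<le> (2 ^ (19 * m)) ^ m"
    using N by (intro power_mono) auto
  moreover have "(1::real) \<le> (2 ^ (19 * m)) ^ m" by (intro one_le_power) simp
  ultimately have "1 + (1 + 16 ^ m / ((1 / (72 * N)) ^ 3 / (2 * 2048 ^ m))) ^ m \<le> 2 * (2 ^ (19 * m)) ^ m"
    by linarith
  hence "B \<le> 2 ^ m * (2 * (2 ^ (19 * m)) ^ m)" unfolding B_def by (intro mult_left_mono) auto
  also have "\<dots> = 2 ^ (m + 1 + 19 * m * m)" by (simp add: power_add power_mult)
  also have "\<dots> \<le> 2 ^ (21 * (m * m))"
  proof (rule power_increasing)
    show "m + 1 + 19 * m * m \<le> 21 * (m * m)" using sq by linarith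
  qed simp
  finally have B: "B \<le> 2 ^ (21 * (m * m))" .
  have "m * (m + 3) \<le> 4 * (m * m)" using sq by (simp add: algebra_simps)
  hence Z: "Z \<le> 2 ^ (4 * (m * m))" unfolding Z_def by (intro power_increasing) auto
  have pos: "0 < B" "0 < Z" unfolding B_def Z_def using N by (auto intro!: mult_pos_pos add_pos_nonneg)
  have "B * Z \<le> 2 ^ (21 * (m * m)) * 2 ^ (4 * (m * m))" using B Z pos by (intro mult_mono) auto
  also have "\<dots> = 2 ^ (25 * (m * m))" by (simp flip: power_add)
  finally have BZ: "B * Z \<le> 2 ^ (25 * (m * m))" .
  have "B / (\<epsilon> / (36 * B * Z)) * Z = 36 * (1 / \<epsilon>) * (B * Z)\<^sup>2"
    using \<epsilon> by (simp add: power2_eq_square field_simps)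
  also have "\<dots> \<le> 36 * N * (2 ^ (25 * (m * m)))\<^sup>2"
    using N \<epsilon> BZ pos by (intro mult_mono power_mono) auto
  also have "36 * N \<le> 2 ^ (m * m)"
  proof -
    have "36 * N \<le> 2 ^ m" using m m2 by linarith
    also have "\<dots> \<le> 2 ^ (m * m)" using sq by (intro power_increasing) auto
    finally show ?thesis .
  qed
  also have "2 ^ (m * m) * ((2::real) ^ (25 * (m * m)))\<^sup>2 = 2 ^ (51 * (m * m))"
    by (simp add: power2_eq_square flip: power_add)
  also have "(2::real) ^ (51 * (m * m)) \<le> exp 1 ^ (51 * (m * m))"
    using exp_ge_add_one_self[of 1] by (intro power_mono) auto
  also have "\<dots> = exp (51 * (real m)\<^sup>2)"
    by (simp add: power2_eq_square flip: exp_of_nat_mult)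
  also have "\<dots> \<le> exp (10 ^ 15 * N ^ 3)"
  proof -
    have "(real m)\<^sup>2 \<le> (37 * N)\<^sup>2" using m N by (intro power_mono) auto
    also have "\<dots> = 1369 * N\<^sup>2" by (simp add: power2_eq_square)
    \<comment> \<open>The exponent obtained is quadratic in \<open>N\<close>;
      \<open>1 \<le> N\<close> passes to the cube of the statement.\<close>
    also have "N\<^sup>2 \<le> N ^ 3" using N by (intro power_increasing) auto
    finally have "51 * (real m)\<^sup>2 \<le> 51 * (1369 * N ^ 3)" by simp
    also have "\<dots> \<le> 10 ^ 15 * N ^ 3" using N by simp
    finally show ?thesis by simp
  qed
  finally show ?thesis using N by simp
qed

theorem theorem2p6:
  fixes M :: "'a measure" and n :: nat and f :: "(nat \<Rightarrow> 'a) \<Rightarrow> real" and \<epsilon> :: real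
  assumes "prob_space M"
    and "n \<ge> 1"
    and "zero_one_measurable (power_space M {1..n}) f"
    and "\<epsilon> > 0"
  shows "\<exists>h. pseudo_junta M n
               (exp (10 ^ 15 * \<epsilon> powi (-3) * of_int \<lceil>total_influence M n f\<rceil> ^ 3)) h \<and>
             (\<integral>x. \<bar>f x - h x\<bar> \<partial>power_space M {1..n}) \<le> \<epsilon>"
proof -
  interpret prob_space M by fact
  \<comment> \<open>Keeping \<open>I\<close> abstract stops the simplifier from rewriting \<open>{1..n}\<close> in the instantiated constants.\<close>
  obtain I where I: "I = {1..n}" by blast
  interpret finite_power M I by unfold_locales (simp add: I)
  define K where "K = (of_int \<lceil>total_influence M n f\<rceil> :: real)"
  let ?k = "exp (10 ^ 15 * \<epsilon> powi (-3) * K ^ 3)"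
  \<comment> \<open>Outside the space \<open>f\<close> is arbitrary, whereas \<open>bdd\<close> asks
    for the value zero there.\<close>
  define g where "g = (\<lambda>x. if x \<in> space P then f x else 0)"
  have g01: "g x \<in> {0, 1}" for x
    using assms(3)[folded I] by (auto simp: zero_one_measurable_def g_def)
  have "f \<in> borel_measurable P" using assms(3)[folded I] by (simp add: zero_one_measurable_def)
  also have "?this \<longleftrightarrow> g \<in> borel_measurable P" by (intro measurable_cong) (simp add: g_def)
  finally have "g \<in> borel_measurable P" .
  moreover have "\<bar>g x\<bar> \<le> 1" for x using g01[of x] by auto
  ultimately have gb: "bdd g" unfolding bdd_def
    by (intro conjI exI[of _ 1] allI impI) (auto simp: g_def)
  have fg: "(\<integral>x. \<bar>f x - h x\<bar> \<partial>P) = (\<integral>x. \<bar>g x - h x\<bar> \<partial>P)" for h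
    by (intro Bochner_Integration.integral_cong) (auto simp: g_def)
  have main: "\<exists>h. pseudo_junta M n ?k h \<and> (\<integral>x. \<bar>f x - h x\<bar> \<partial>P) \<le> \<epsilon>"
    if "local_family v" "support_cost v \<le> ?k" "(\<integral>x. (g x - (\<Sum>S\<in>Pow I. v S x))\<^sup>2 \<partial>P) \<le> \<epsilon> / 4" for v
    unfolding fg by (rule pseudo_junta_approximation[OF I gb g01 that])
  have infl: "0 \<le> (\<Sum>i\<in>I. low_degree_energy.infl M I g i)"
      "(\<Sum>i\<in>I. low_degree_energy.infl M I g i) \<le> K"
  proof -
    \<comment> \<open>\<open>infl\<close> depends on neither the degree nor the threshold, so the
      values 0 and 1 are arbitrary.\<close>
    interpret low_degree_energy M I g 0 1
      using gb g01 by unfold_locales auto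
    show "0 \<le> (\<Sum>i\<in>I. infl i)"
      unfolding infl_def by (intro sum_nonneg integral_nonneg_AE) auto
    have "(\<Sum>i\<in>I. infl i) \<le> total_influence M n f"
      unfolding total_influence_def I[symmetric]
      by (intro sum_mono infl_le_influence[OF I]) (simp add: g_def)
    thus "(\<Sum>i\<in>I. infl i) \<le> K" unfolding K_def by linarith
  qed
  have "\<exists>h. pseudo_junta M n ?k h \<and> (\<integral>x. \<bar>f x - h x\<bar> \<partial>P) \<le> \<epsilon>"
  \<comment> \<open>For \<open>1 \<le> \<epsilon>\<close> the zero function serves. If
    \<open>K < 1\<close>, the integer \<open>K\<close> is at most zero and \<open>g\<close> equals
    its mean almost everywhere. In the remaining case rounding up gives \<open>1 \<le> K\<close>, so
    \<open>K / \<epsilon>\<close> is at least \<open>1 / \<epsilon>\<close>, as the choice of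
    constants requires.\<close>
  proof (cases "1 \<le> \<epsilon> \<or> K < 1")
    case True
    thus ?thesis
    proof (cases "1 \<le> \<epsilon>")
      case True
      have "support_cost (\<lambda>_ _. 0) \<le> ?k" unfolding support_cost_def by simp
      moreover have "local_family (\<lambda>_ _. 0)" unfolding local_family_def by (intro ballI conjI dep_zero bdd_zero)
      ultimately have "pseudo_junta M n ?k (\<lambda>x. of_bool (1 / 2 \<le> (\<Sum>S\<in>Pow I. 0 :: real)))"
        by (intro pseudo_junta_of_local_family I)
      moreover have "(\<integral>x. \<bar>g x - 0\<bar> \<partial>P) \<le> \<epsilon>"
      proof (rule P.integral_le_const[OF integrable_bdd])
        have "\<bar>g x - 0\<bar> \<le> \<epsilon>" for x using g01[of x] True by auto
        thus "AE x in P. \<bar>g x - 0\<bar> \<le> \<epsilon>" by simp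
      qed (intro bdd_abs bdd_diff gb bdd_zero)
      ultimately show ?thesis unfolding fg by (intro exI[of _ "\<lambda>_. 0"]) simp
    next
      case False
      hence "\<lceil>total_influence M n f\<rceil> < 1" using True unfolding K_def of_int_less_1_iff by blast
      hence "K \<le> 0" unfolding K_def of_int_le_0_iff by linarith
      \<comment> \<open>At degree 0 only the mean is kept, and \<open>high_degree_weight\<close>
        bounds the whole variance by the sum of the \<open>infl i\<close>, which is now
        zero.\<close>
      interpret low_degree_energy M I g 0 1
        using gb g01 by unfold_locales auto
      define v where "v = (\<lambda>S x. if S = {} then es g S x else 0)"
      have "low = {{}}" by (auto simp: low_def dest: finite_subset_I)
      hence split: "g x - (\<Sum>S\<in>Pow I. v S x) = (\<Sum>S\<in>Pow I - low. es g S x)" for x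
        using efron_stein[OF gb, of x] sum.subset_diff[of "{{}}" "Pow I" "\<lambda>S. es g S x"]
        by (simp add: v_def)
      have "(\<integral>x. (\<Sum>S\<in>Pow I - low. es g S x)\<^sup>2 \<partial>P) \<le> \<epsilon> / 4"
        using high_degree_weight infl \<open>K \<le> 0\<close> assms(4) by simp
      moreover have "bdd (v S) \<and> dep S (v S)" for S
      proof (cases "S = {}")
        case True
        hence "v S = es g {}" by (simp add: v_def fun_eq_iff)
        thus ?thesis using True canonical_es[OF gb, of "{}"] by (simp add: canonical_def)
      next
        case False
        hence "v S = (\<lambda>_. 0)" by (simp add: v_def)
        thus ?thesis by (simp add: dep_zero)
      qed
      hence "local_family v" by (simp add: local_family_def)
      moreover have "support_cost v \<le> ?k"
      proof -
        have "real (card S) * measure P {x \<in> space P. v S x \<noteq> 0} = 0" for S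
          by (cases "S = {}") (simp_all add: v_def)
        hence "support_cost v = 0" unfolding support_cost_def by (intro sum.neutral ballI)
        thus ?thesis by simp
      qed
      ultimately show ?thesis using main[of v] by (simp only: split)
    qed
  next
    case False
    hence \<epsilon>: "\<epsilon> < 1" and K: "1 \<le> K" by auto
    \<comment> \<open>Each of the three errors becomes at most \<open>\<epsilon> / 36\<close>, and
      tripling their sum gives \<open>\<epsilon> / 4\<close>: \<open>m\<close> serves the high
      degrees, \<open>l\<close> the uncovered parts, \<open>t\<close> the truncation. The threshold
      \<open>\<tau>\<close> is the largest that \<open>l\<close> permits.\<close>
    define N where "N = K / \<epsilon>"
    define m where "m = nat \<lceil>36 * N\<rceil>"
    define l where "l = 1 / (72 * N)"
    define \<tau> where "\<tau> = l ^ 3 / (2 * 2048 ^ m)"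
    define B where "B = 2 ^ m * (1 + (1 + 16 ^ m / \<tau>) ^ m)"
    define Z where "Z = (2::real) ^ (m * (m + 3))"
    define t where "t = \<epsilon> / (36 * B * Z)"
    have N: "1 \<le> N" "1 / \<epsilon> \<le> N" using K \<epsilon> assms(4) by (auto simp: N_def divide_simps)
    have m: "36 * N \<le> real m" "real m \<le> 36 * N + 1" using N by (auto simp: m_def)
    have l: "0 < l" using N by (simp add: l_def)
    have \<tau>: "0 < \<tau>" using l by (simp add: \<tau>_def)
    have BZ: "0 < B" "0 < Z" using \<tau> by (auto simp: B_def Z_def intro!: mult_pos_pos add_pos_nonneg)
    have t: "0 < t" using BZ assms(4) by (simp add: t_def)
    interpret low_degree_energy M I g m \<tau>
      using gb g01 \<tau> by unfold_locales auto
    have "2048 ^ m * \<tau> \<le> l ^ 3 / 2" by (simp add: \<tau>_def)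
    then obtain v where v: "local_family v" "support_cost v \<le> B / t * Z"
      "(\<integral>x. (g x - (\<Sum>S\<in>Pow I. v S x))\<^sup>2 \<partial>P)
        \<le> 3 * ((\<Sum>i\<in>I. infl i) / (real m + 1) + 2 * l * (\<Sum>i\<in>I. infl i) + t * B * Z)"
      using local_family_approximation[OF l _ t] unfolding B_def Z_def by blast
    show ?thesis
    proof (rule main[OF v(1)])
      have "10 ^ 15 * N ^ 3 = 10 ^ 15 * \<epsilon> powi (-3) * K ^ 3"
        by (simp add: N_def power_divide power_int_minus field_simps)
      moreover have "B / t * Z \<le> exp (10 ^ 15 * N ^ 3)"
        unfolding t_def B_def Z_def \<tau>_def l_def by (rule structure_constants[OF N(1) assms(4) N(2) m])
      ultimately show "support_cost v \<le> ?k" using v(2) by (metis order_trans)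
      have "(\<Sum>i\<in>I. infl i) / (real m + 1) \<le> K / (36 * N)"
        using infl m N by (intro frac_le) auto
      also have "\<dots> = \<epsilon> / 36" using K assms(4) by (simp add: N_def)
      finally have 1: "(\<Sum>i\<in>I. infl i) / (real m + 1) \<le> \<epsilon> / 36" .
      have "2 * l * (\<Sum>i\<in>I. infl i) \<le> 2 * l * K" using infl l by (intro mult_left_mono) auto
      also have "\<dots> = \<epsilon> / 36" using K assms(4) by (simp add: l_def N_def)
      finally have 2: "2 * l * (\<Sum>i\<in>I. infl i) \<le> \<epsilon> / 36" .
      have 3: "t * B * Z = \<epsilon> / 36" using BZ by (simp add: t_def)
      show "(\<integral>x. (g x - (\<Sum>S\<in>Pow I. v S x))\<^sup>2 \<partial>P) \<le> \<epsilon> / 4"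
      proof (rule order_trans[OF v(3)])
        have "3 * ((\<Sum>i\<in>I. infl i) / (real m + 1) + 2 * l * (\<Sum>i\<in>I. infl i) + t * B * Z)
          \<le> 3 * (\<epsilon> / 36 + \<epsilon> / 36 + \<epsilon> / 36)"
          by (intro mult_left_mono add_mono 1 2 eq_refl[OF 3]) simp
        thus "3 * ((\<Sum>i\<in>I. infl i) / (real m + 1) + 2 * l * (\<Sum>i\<in>I. infl i) + t * B * Z) \<le> \<epsilon> / 4"
          by (simp only: add_divide_distrib[symmetric]) simp
      qed
    qed
  qed
  thus ?thesis unfolding I[symmetric] K_def .
qed

end
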